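(* Let $n \geq 6$ and $3 \leq d \leq n-2$ be integers. Among all unicyclic graphs of order $n$ with diameter $d$, the graph $C_{3}(P^{n-d-2}_{\lceil \frac{d-1}{2} \rceil}, P_{\lfloor \frac{d-1}{2} \rfloor +1}, S_{1})$ is the unique graph (up to isomorphism) with minimum edge Szeged index.
   Context: All graphs are finite, simple, undirected and connected. A unicyclic graph of order $n$ is a connected graph with $n$ vertices and $n$ edges. The diameter of $G$ is the maximum distance $d(u,v|G)$ over all pairs of vertices. For an edge $f=ab$ and a vertex $w$, the distance is $d(f,w|G)=\min\{d(a,w|G),d(b,w|G)\}$. For an edge $e=uv$, let $m_u(e|G)$ be the number of edges $f\in E(G)$ with $d(f,u|G)<d(f,v|G)$, and $m_v(e|G)$ the number of edges $f$ with $d(f,v|G)<d(f,u|G)$. The edge Szeged index is $Sz_e(G)=\sum_{uv\in E(G)} m_u(uv|G)\,m_v(uv|G)$. The graph $C_{3}(P^{n-d-2}_{\lceil \frac{d-1}{2} \rceil}, P_{\lfloor \frac{d-1}{2} \rfloor +1}, S_{1})$ is defined as follows: take a triangle $v_1v_2v_3v_1$; at $v_1$ attach a pendent path with $\lceil \frac{d-1}{2}\rceil$ edges (i.e. $v_1$ is an end vertex of a path on $\lceil \frac{d-1}{2}\rceil+1$ vertices) together with $n-d-2$ pendent vertices adjacent to $v_1$; at $v_2$ attach a pendent path with $\lfloor \frac{d-1}{2}\rfloor$ edges (i.e. $v_2$ is an end vertex of a path on $\lfloor \frac{d-1}{2}\rfloor+1$ vertices); $v_3$ has no further neighbours. This graph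 has $n$ vertices and diameter $d$. *)

theory Defs
  imports Complex_Main
begin

text \<open>A graph is given by a vertex set V and an edge set E of 2-element subsets of V.\<close>

definition simple_graph :: "'a set \<Rightarrow> 'a set set \<Rightarrow> bool" where
  "simple_graph V E \<longleftrightarrow> finite V \<and>
     (\<forall>e\<in>E. \<exists>u v. e = {u, v} \<and> u \<noteq> v \<and> u \<in> V \<and> v \<in> V)"

definition adj_rel :: "'a set set \<Rightarrow> ('a \<times> 'a) set" where
  "adj_rel E = {(u, v). {u, v} \<in> E}"

definition connected_graph :: "'a set \<Rightarrow> 'a set set \<Rightarrow> bool" where
  "connected_graph V E \<longleftrightarrow> V \<noteq> {} \<and> (\<forall>u\<in>V. \<forall>v\<in>V. (u, v) \<in> (adj_rel E)\<^sup>*)"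

definition unicyclic :: "'a set \<Rightarrow> 'a set set \<Rightarrow> bool" where
  "unicyclic V E \<longleftrightarrow> simple_graph V E \<and> connected_graph V E \<and> card E = card V"

text \<open>Distance d(u,v|G): length of a shortest walk from u to v.\<close>
definition gdist :: "'a set set \<Rightarrow> 'a \<Rightarrow> 'a \<Rightarrow> nat" where
  "gdist E u v = (LEAST k. (u, v) \<in> (adj_rel E) ^^ k)"

definition diameter :: "'a set \<Rightarrow> 'a set set \<Rightarrow> nat" where
  "diameter V E = Max {gdist E u v | u v. u \<in> V \<and> v \<in> V}"

text \<open>d(f,w|G) = min over the endpoints of f.\<close>
definition edist :: "'a set set \<Rightarrow> 'a set \<Rightarrow> 'a \<Rightarrow> nat" where
  "edist E f w = Min ((\<lambda>a. gdist E a w) ` f)"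

definition m_edge :: "'a set set \<Rightarrow> 'a \<Rightarrow> 'a \<Rightarrow> nat" where
  "m_edge E u v = card {f \<in> E. edist E f u < edist E f v}"

text \<open>Edge Szeged index. Each edge uv is counted once for each orientation (u,v) and (v,u),
  which give the same product, hence the division by 2 is exact.\<close>
definition edge_szeged :: "'a set set \<Rightarrow> nat" where
  "edge_szeged E = (\<Sum>(u, v) \<in> {(u, v). {u, v} \<in> E}. m_edge E u v * m_edge E v u) div 2"

definition graph_iso :: "'a set \<Rightarrow> 'a set set \<Rightarrow> 'b set \<Rightarrow> 'b set set \<Rightarrow> bool" where
  "graph_iso V1 E1 V2 E2 \<longleftrightarrow> (\<exists>f. bij_betw f V1 V2 \<and>
     (\<forall>u\<in>V1. \<forall>v\<in>V1. {u, v} \<in> E1 \<longleftrightarrow> {f u, f v} \<in> E2))"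

text \<open>The graph C_3(P^{n-d-2}_{ceil((d-1)/2)}, P_{floor((d-1)/2)+1}, S_1) on vertices {0..<n}:
  triangle 0,1,2 (v1 = 0, v2 = 1, v3 = 2); a pendent path 0-3-4-...-(a+2) with a = ceil((d-1)/2) edges;
  a pendent path 1-(a+3)-...-(a+b+2) with b = floor((d-1)/2) edges; pendent vertices
  a+b+3, ..., n-1 adjacent to 0 (there are n-d-2 of them).\<close>
definition C3_a :: "nat \<Rightarrow> nat" where
  "C3_a d = nat \<lceil>(real d - 1) / 2\<rceil>"

definition C3_b :: "nat \<Rightarrow> nat" where
  "C3_b d = nat \<lfloor>(real d - 1) / 2\<rfloor>"

definition C3_V :: "nat \<Rightarrow> nat set" where
  "C3_V n = {0..<n}"

definition C3_E :: "nat \<Rightarrow> nat \<Rightarrow> nat set set" where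
  "C3_E n d = {{0, 1}, {1, 2}, {0, 2}}
     \<union> {{if i = 1 then 0 else i + 1, i + 2} | i. 1 \<le> i \<and> i \<le> C3_a d}
     \<union> {{if j = 1 then 1 else C3_a d + j + 1, C3_a d + j + 2} | j. 1 \<le> j \<and> j \<le> C3_b d}
     \<union> {{0, k} | k. C3_a d + C3_b d + 3 \<le> k \<and> k < n}"

end

theory Submission
  imports Defs
begin

text \<open>
  On a graph with n vertices and n edges a bridge with p edges on one side has weight
  \<open>F p = p * (n - 1 - p)\<close>. The j-th edge of a diametral path has at least \<open>\<mu> j = min j (d - 1 - j)\<close>
  edges on either side, so a path of bridges contributes at least the sum of the \<open>F (\<mu> j)\<close>.
  If the path runs along the cycle, then each edge e that it shares with the cycle is compensated by the
  edge of the cycle opposite to e: together they weigh at least \<open>F (\<mu> j)\<close> plus about n. Only for a triangle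
  sharing one edge with the path does the total of the cycle come down to the weight of the extremal graph,
  and then the third vertex of the triangle has degree two, the shared edge lies in the middle of the path,
  and every other edge off the path has weight zero, hence is pendant. Counting edges along the path shows
  that all these pendant edges are attached to the same vertex of the triangle.
\<close>

section \<open>Distances and pendant vertices\<close>

text \<open>The counting rests on growing the graph from its cycle leaf by leaf. A new leaf brings
  one vertex and one edge, and with respect to any two older vertices both fall on the same side.
  Counting edges thus becomes counting vertices, and for an edge of the cycle it becomes adding up
  the sizes of the trees at consecutive cycle vertices. With b = (d - 1) div 2, the constant 2n - 3
  - 2b that recurs below is the excess over \<open>F b\<close> of a triangle whose three trees have
  b + 1, n - 2 - b and 1 vertices. The delicate case is that of even cycles. There an edge is tied
  not only with itself but also with its opposite edge, so the two sides hold only n - 2 edges, and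
  a pair of opposite edges is only known to exceed the weight of a bridge by n - 4. One such pair
  does not reach the target; two pairs have to be balanced against each other, and n = 6 is a
  boundary case.\<close>

lemma adj_relI: "{a, b} \<in> E \<Longrightarrow> (a, b) \<in> adj_rel E"
  by (simp add: adj_rel_def)

lemma adj_rel_sym: "(a, b) \<in> adj_rel E \<Longrightarrow> (b, a) \<in> adj_rel E"
  by (simp add: adj_rel_def insert_commute)

lemma adj_rel_relpow_sym: "(a, b) \<in> adj_rel E ^^ m \<Longrightarrow> (b, a) \<in> adj_rel E ^^ m"
proof (induction m arbitrary: b)
  case (Suc m)
  then obtain z where "(a, z) \<in> adj_rel E ^^ m" "(z, b) \<in> adj_rel E" by auto
  then show ?case using Suc.IH adj_rel_sym by (metis relpow_Suc_I2)
qed auto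

lemma gdist_sym: "gdist E a b = gdist E b a"
  unfolding gdist_def using adj_rel_relpow_sym by metis

lemma gdist_self [simp]: "gdist E a a = 0"
  unfolding gdist_def by (rule Least_eq_0) simp

lemma gdist_le: "(a, b) \<in> adj_rel E ^^ m \<Longrightarrow> gdist E a b \<le> m"
  unfolding gdist_def by (rule Least_le)

lemma gdist_relpow:
  assumes "(a, b) \<in> (adj_rel E)\<^sup>*"
  shows "(a, b) \<in> adj_rel E ^^ gdist E a b"
  using assms unfolding gdist_def by (auto simp: rtrancl_power intro: LeastI)

lemma simple_graphD:
  assumes "simple_graph V E" "{a, b} \<in> E"
  shows "a \<in> V" "b \<in> V" "a \<noteq> b"
  using assms unfolding simple_graph_def by (metis doubleton_eq_iff)+

lemma simple_graphE:
  assumes "simple_graph V E" "e \<in> E"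
  obtains a b where "e = {a, b}" "a \<noteq> b" "a \<in> V" "b \<in> V"
  using assms unfolding simple_graph_def by blast

lemma simple_graph_finite_edges: "simple_graph V E \<Longrightarrow> finite E"
  by (rule finite_subset[of _ "Pow V"]) (auto simp: simple_graph_def)

text \<open>Following descents gives a walk of length \<open>\<phi> a\<close>, and along any walk to
  v the value falls by at most one per step. Distances on the cycle, after attaching a leaf and
  under an isomorphism are all computed in this way.\<close>

lemma gdist_eqI:
  assumes zero: "\<phi> v = (0 :: nat)"
    and lip: "\<And>a b. {a, b} \<in> E \<Longrightarrow> \<phi> a \<le> Suc (\<phi> b)"
    and desc: "\<And>a. a \<in> V \<Longrightarrow> a \<noteq> v \<Longrightarrow> \<exists>b\<in>V. {a, b} \<in> E \<and> \<phi> a = Suc (\<phi> b)"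
    and a: "a \<in> V"
  shows "gdist E a v = \<phi> a"
proof -
  have walk: "(a, v) \<in> adj_rel E ^^ \<phi> a"
    using a
  proof (induction "\<phi> a" arbitrary: a)
    case 0
    then have "a = v" using desc by (metis Zero_not_Suc)
    then show ?case using 0 by (metis relpow_0_I)
  next
    case (Suc m)
    then have "a \<noteq> v" using zero by auto
    then obtain b where b: "b \<in> V" "{a, b} \<in> E" "\<phi> a = Suc (\<phi> b)" using desc Suc.prems by blast
    with Suc have "(b, v) \<in> adj_rel E ^^ \<phi> b" by simp
    then show ?case using b adj_relI by (metis relpow_Suc_I2)
  qed
  have "\<phi> a \<le> m" if "(a, v) \<in> adj_rel E ^^ m" for m a
    using that
  proof (induction m arbitrary: a)
    case 0
    then show ?case using zero by simp
  next
    case (Suc m)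
    then obtain b where "(a, b) \<in> adj_rel E" "(b, v) \<in> adj_rel E ^^ m" by (meson relpow_Suc_D2)
    then show ?case using Suc.IH[of b] lip[of a b] by (simp add: adj_rel_def)
  qed
  then show ?thesis unfolding gdist_def using walk by (intro Least_equality) auto
qed

locale cgraph =
  fixes V :: "'a set" and E :: "'a set set"
  assumes simple: "simple_graph V E" and conn: "connected_graph V E"
begin

lemma reach: "a \<in> V \<Longrightarrow> b \<in> V \<Longrightarrow> (a, b) \<in> (adj_rel E)\<^sup>*"
  using conn unfolding connected_graph_def by blast

lemma finV: "finite V" using simple by (simp add: simple_graph_def)

lemma finE: "finite E" using simple by (rule simple_graph_finite_edges)

lemma gdist_walk: "a \<in> V \<Longrightarrow> b \<in> V \<Longrightarrow> (a, b) \<in> adj_rel E ^^ gdist E a b"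
  by (intro gdist_relpow reach)

lemma gdist_triangle:
  assumes "a \<in> V" "b \<in> V" "z \<in> V"
  shows "gdist E a z \<le> gdist E a b + gdist E b z"
proof -
  have "(a, z) \<in> adj_rel E ^^ (gdist E a b + gdist E b z)"
    unfolding relpow_add using gdist_walk assms by blast
  then show ?thesis by (rule gdist_le)
qed

lemma gdist_edge:
  assumes "{a, b} \<in> E"
  shows "gdist E a b = 1"
proof -
  have "(a, b) \<in> adj_rel E ^^ 1" using assms by (simp add: adj_rel_def)
  then have 1: "gdist E a b \<le> 1" by (rule gdist_le)
  have "gdist E a b \<noteq> 0"
    using gdist_walk[of a b] simple_graphD[OF simple assms] by (metis relpow_0_E)
  with 1 show ?thesis by simp
qed

lemma gdist_lip:
  assumes "{a, b} \<in> E" "v \<in> V"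
  shows "gdist E a v \<le> Suc (gdist E b v)"
  using gdist_triangle[of a b v] gdist_edge[OF assms(1)] simple_graphD[OF simple assms(1)] assms(2) by simp

lemma gdist_eq_0: "a \<in> V \<Longrightarrow> b \<in> V \<Longrightarrow> gdist E a b = 0 \<longleftrightarrow> a = b"
  using gdist_walk[of a b] by auto

lemma gdist_desc:
  assumes "a \<in> V" "v \<in> V" "a \<noteq> v"
  obtains b where "b \<in> V" "{a, b} \<in> E" "gdist E a v = Suc (gdist E b v)"
proof -
  obtain m where m: "gdist E a v = Suc m" using gdist_eq_0 assms by (metis not0_implies_Suc)
  then obtain b where b: "(a, b) \<in> adj_rel E" "(b, v) \<in> adj_rel E ^^ m"
    using gdist_walk[OF assms(1,2)] by (metis relpow_Suc_D2)
  have e: "{a, b} \<in> E" using b by (simp add: adj_rel_def)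
  have "gdist E b v \<le> m" using b(2) by (rule gdist_le)
  moreover have "Suc m \<le> Suc (gdist E b v)" using gdist_lip[OF e assms(2)] m by simp
  ultimately show ?thesis using that[of b] e m simple_graphD[OF simple e] by simp
qed

text \<open>No segment of the walk can be shortened without shortening the whole, so all pairs of
  its vertices, not only the two ends, are at their index distance.\<close>

lemma geodesic:
  assumes "u \<in> V" "v \<in> V" "gdist E u v = d"
  obtains x where "x 0 = u" "x d = v" "\<And>i. i < d \<Longrightarrow> {x i, x (Suc i)} \<in> E"
    "\<And>i. i \<le> d \<Longrightarrow> x i \<in> V"
    "\<And>i j. i \<le> j \<Longrightarrow> j \<le> d \<Longrightarrow> gdist E (x i) (x j) = j - i"
proof -
  have "(u, v) \<in> adj_rel E ^^ d" using gdist_walk[OF assms(1,2)] assms(3) by simp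
  then obtain x where x: "x 0 = u" "x d = v" "\<And>i. i < d \<Longrightarrow> (x i, x (Suc i)) \<in> adj_rel E"
    unfolding relpow_fun_conv by blast
  have e: "{x i, x (Suc i)} \<in> E" if "i < d" for i using x(3)[OF that] by (simp add: adj_rel_def)
  have inV: "x i \<in> V" if "i \<le> d" for i
    using that x(1) assms(1) simple_graphD[OF simple e] by (cases i) (auto dest: Suc_le_lessD)
  have ub: "gdist E (x i) (x (i + m)) \<le> m" if "i + m \<le> d" for i m
    using that
  proof (induction m)
    case (Suc m)
    then have "gdist E (x (i + m)) (x (Suc (i + m))) = 1" using gdist_edge e by simp
    moreover have "gdist E (x i) (x (Suc (i + m))) \<le> gdist E (x i) (x (i + m)) + gdist E (x (i + m)) (x (Suc (i + m)))"
      using Suc.prems by (intro gdist_triangle inV) auto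
    ultimately show ?case using Suc by simp
  qed simp
  have "gdist E (x i) (x j) = j - i" if "i \<le> j" "j \<le> d" for i j
  proof -
    have "d \<le> gdist E (x 0) (x i) + gdist E (x i) (x d)"
      using gdist_triangle[OF inV[of 0] inV[of i] inV[of d]] that x(1,2) assms(3) by simp
    moreover have "gdist E (x i) (x d) \<le> gdist E (x i) (x j) + gdist E (x j) (x d)"
      using inV that by (intro gdist_triangle) auto
    moreover have "gdist E (x 0) (x i) \<le> i" using ub[of 0 i] that by simp
    moreover have "gdist E (x i) (x j) \<le> j - i" using ub[of i "j - i"] that by simp
    moreover have "gdist E (x j) (x d) \<le> d - j" using ub[of j "d - j"] that by simp
    ultimately show ?thesis using that by linarith
  qed
  then show ?thesis using that[of x] x e inV by blast
qed

text \<open>If no edge left \<open>V0\<close>, every walk starting in it would stay inside, against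
  connectedness.\<close>

lemma grow:
  assumes "V0 \<subseteq> V" "V0 \<noteq> {}" "V0 \<noteq> V"
  obtains x y where "y \<in> V0" "x \<in> V - V0" "{x, y} \<in> E"
proof (rule ccontr)
  assume no: "\<not> thesis"
  obtain p q where p: "p \<in> V0" and q: "q \<in> V" "q \<notin> V0" using assms by auto
  have "(p, q) \<in> (adj_rel E)\<^sup>*" using reach p q assms(1) by auto
  then have "q \<in> V0"
  proof induction
    case (step y z)
    then have "{z, y} \<in> E" by (simp add: adj_rel_def insert_commute)
    then show ?case using no that step simple_graphD[OF simple] by blast
  qed (use p in simp)
  then show False using q by simp
qed

end

lemma edist_doubleton: "edist E {a, b} w = min (gdist E a w) (gdist E b w)"
  unfolding edist_def by simp

section \<open>Attaching a pendant vertex\<close>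

locale leaf_ext = cgraph +
  fixes x y
  assumes y: "y \<in> V" and x: "x \<notin> V"
begin

abbreviation "V' \<equiv> insert x V"
abbreviation "E' \<equiv> insert {x, y} E"

lemma x_notin: "{a, b} \<in> E \<Longrightarrow> a \<noteq> x \<and> b \<noteq> x"
  using simple_graphD[OF simple] x by blast

lemma new_edge: "{x, y} \<notin> E" using x_notin by blast

lemma leaf_gdist:
  assumes v: "v \<in> V"
  shows "a \<in> V \<Longrightarrow> gdist E' a v = gdist E a v" "gdist E' x v = Suc (gdist E y v)"
proof -
  define \<phi> where "\<phi> z = (if z = x then Suc (gdist E y v) else gdist E z v)" for z
  have main: "gdist E' z v = \<phi> z" if "z \<in> V'" for z
  proof (rule gdist_eqI[where V = V'])
    show "\<phi> v = 0" using v x by (auto simp: \<phi>_def)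
  next
    fix a b assume "{a, b} \<in> E'"
    then consider "{a, b} \<in> E" | "a = x" "b = y" | "a = y" "b = x" by (auto simp: doubleton_eq_iff)
    then show "\<phi> a \<le> Suc (\<phi> b)"
      by cases (use gdist_lip[OF _ v] x_notin y x in \<open>auto simp: \<phi>_def\<close>)
  next
    fix a assume a: "a \<in> V'" "a \<noteq> v"
    show "\<exists>b\<in>V'. {a, b} \<in> E' \<and> \<phi> a = Suc (\<phi> b)"
    proof (cases "a = x")
      case True
      then show ?thesis using x y by (intro bexI[of _ y]) (auto simp: \<phi>_def)
    next
      case False
      with a have "a \<in> V" by simp
      from gdist_desc[OF this v a(2)] obtain b where "b \<in> V" "{a, b} \<in> E" "gdist E a v = Suc (gdist E b v)" .
      then show ?thesis using False x by (intro bexI[of _ b]) (auto simp: \<phi>_def)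
    qed
  qed (use that in simp)
  show "a \<in> V \<Longrightarrow> gdist E' a v = gdist E a v" using main[of a] x by (auto simp: \<phi>_def)
  show "gdist E' x v = Suc (gdist E y v)" using main[of x] by (simp add: \<phi>_def)
qed

lemma leaf_gdist':
  assumes "v \<in> V"
  shows "gdist E' v x = Suc (gdist E v y)"
  using leaf_gdist(2)[OF assms] by (simp add: gdist_sym)

lemma leaf_simple: "simple_graph V' E'"
  using simple x y unfolding simple_graph_def by (metis finite_insert insert_iff)

lemma leaf_connected: "connected_graph V' E'"
proof -
  have sub: "(adj_rel E)\<^sup>* \<subseteq> (adj_rel E')\<^sup>*" by (rule rtrancl_mono) (auto simp: adj_rel_def)
  have xy: "(x, y) \<in> (adj_rel E')\<^sup>*" "(y, x) \<in> (adj_rel E')\<^sup>*"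
    by (auto simp: adj_rel_def insert_commute intro!: r_into_rtrancl)
  have old: "(a, b) \<in> (adj_rel E')\<^sup>*" if "a \<in> V" "b \<in> V" for a b using reach[OF that] sub by blast
  show ?thesis unfolding connected_graph_def
    using old xy y by (auto intro: rtrancl_trans)
qed

lemma leaf_cgraph: "cgraph V' E'"
  by unfold_locales (rule leaf_simple leaf_connected)+

lemma leaf_edist:
  assumes "f \<in> E" "v \<in> V"
  shows "edist E' f v = edist E f v"
proof -
  from simple assms(1) obtain a b where "f = {a, b}" "a \<in> V" "b \<in> V" by (rule simple_graphE)
  then show ?thesis using leaf_gdist assms by (simp add: edist_doubleton)
qed

lemma leaf_edist_new: "v \<in> V \<Longrightarrow> edist E' {x, y} v = gdist E y v"
  using leaf_gdist y by (simp add: edist_doubleton)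

text \<open>The new edge is as far from an old vertex as y is, so it joins the side on which y lies;
  nothing changes for the old edges.\<close>

lemma leaf_m_edge:
  assumes "u \<in> V" "v \<in> V"
  shows "m_edge E' u v = m_edge E u v + (if gdist E y u < gdist E y v then 1 else 0)"
proof -
  have "{f \<in> E'. edist E' f u < edist E' f v} =
      {f \<in> E. edist E f u < edist E f v} \<union> (if gdist E y u < gdist E y v then {{x, y}} else {})"
    using leaf_edist leaf_edist_new assms by auto
  then show ?thesis using finE new_edge by (auto simp: m_edge_def)
qed

lemma leaf_edist_child:
  assumes "f \<in> E"
  shows "edist E' f x = Suc (edist E f y)"
proof -
  from simple assms(1) obtain a b where "f = {a, b}" "a \<in> V" "b \<in> V" by (rule simple_graphE)
  then show ?thesis using leaf_gdist' by (simp add: edist_doubleton)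
qed

text \<open>Old edges are one step farther from the leaf than from y, and the new edge is at
  distance 0 from both.\<close>

lemma leaf_m_edge_child: "m_edge E' x y = 0"
proof -
  have "\<not> edist E' f x < edist E' f y" if "f \<in> E'" for f
    using that leaf_edist_child leaf_edist y by (auto simp: edist_doubleton)
  then have "{f \<in> E'. edist E' f x < edist E' f y} = {}" by blast
  then show ?thesis unfolding m_edge_def by (metis card.empty)
qed

end

section \<open>Cycles with trees attached\<close>

definition cycle_edges :: "nat \<Rightarrow> (nat \<Rightarrow> 'a) \<Rightarrow> 'a set set" where
  "cycle_edges k c = (\<lambda>i. {c i, c (Suc i mod k)}) ` {..<k}"

text \<open>The two arcs between the positions have \<delta> and k - \<delta> edges. Adding k before
  subtracting i keeps the difference from being truncated.\<close>

definition cycle_dist :: "nat \<Rightarrow> nat \<Rightarrow> nat \<Rightarrow> nat" where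
  "cycle_dist k p i = (let \<delta> = (p + k - i) mod k in min \<delta> (k - \<delta>))"

lemma mod_offset:
  fixes k :: nat
  assumes "p < k" "i < k"
  obtains \<delta> where "\<delta> < k" "p = (i + \<delta>) mod k" "\<delta> = 0 \<longleftrightarrow> p = i"
proof
  show "(p + k - i) mod k < k" using assms by simp
  have "(i + (p + k - i) mod k) mod k = (i + (p + k - i)) mod k" by (simp add: mod_simps)
  then show "p = (i + (p + k - i) mod k) mod k" using assms by simp
  then show "(p + k - i) mod k = 0 \<longleftrightarrow> p = i" using assms by auto
qed

lemma inj_on_mod_offset: "inj_on (\<lambda>\<delta>. (i + \<delta>) mod k) {..<k :: nat}"
proof (rule inj_onI)
  fix a b assume ab: "a \<in> {..<k}" "b \<in> {..<k}" "(i + a) mod k = (i + b) mod k"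
  define j where "j = i mod k"
  have j: "j < k" unfolding j_def using ab(1) by (intro mod_less_divisor) auto
  have add: "(j + e) mod k = (if j + e < k then j + e else j + e - k)" if "e < k" for e
    using that j by (simp add: le_mod_geq)
  have "(j + a) mod k = (j + b) mod k" using ab(3) unfolding j_def by (simp add: mod_simps)
  then show "a = b" using ab j by (simp add: add split: if_splits)
qed

lemma bij_mod_offset: "bij_betw (\<lambda>\<delta>. (i + \<delta>) mod k) {..<k :: nat} {..<k}"
proof (cases "k = 0")
  case False
  then have "(\<lambda>\<delta>. (i + \<delta>) mod k) ` {..<k} = {..<k}"
    by (intro card_subset_eq) (auto simp: card_image inj_on_mod_offset)
  then show ?thesis by (simp add: bij_betw_def inj_on_mod_offset)
qed auto

lemma cycle_dist_offset:
  assumes "\<delta> < k"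
  shows "cycle_dist k ((i + \<delta>) mod k) (i mod k) = min \<delta> (k - \<delta>)"
proof -
  have i: "i mod k < k" using assms by (intro mod_less_divisor) auto
  have "((i + \<delta>) mod k + k - i mod k) mod k = \<delta>"
  proof (cases "i mod k + \<delta> < k")
    case True
    then have "(i + \<delta>) mod k = i mod k + \<delta>" by (metis mod_add_left_eq mod_less)
    then show ?thesis using assms by simp
  next
    case False
    moreover have "i mod k + \<delta> - k < k" using i assms by linarith
    ultimately have "(i mod k + \<delta>) mod k = i mod k + \<delta> - k" by (simp add: le_mod_geq)
    then have "(i + \<delta>) mod k = i mod k + \<delta> - k" by (simp add: mod_simps)
    then show ?thesis using assms False by simp
  qed
  then show ?thesis by (simp add: cycle_dist_def Let_def)
qed

text \<open>Offset 0 is singled out because \<delta> - 1 is truncated there: seen from the next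
  position it is the offset k - 1.\<close>

lemma cycle_dist_offset_Suc:
  assumes "\<delta> < k"
  shows "cycle_dist k ((i + \<delta>) mod k) (Suc i mod k) = (if \<delta> = 0 then min 1 (k - 1) else min (\<delta> - 1) (k - \<delta> + 1))"
proof (cases "\<delta> = 0")
  case True
  have "cycle_dist k ((Suc i + (k - 1)) mod k) (Suc i mod k) = min (k - 1) (k - (k - 1))"
    using assms by (intro cycle_dist_offset) auto
  moreover have "(Suc i + (k - 1)) mod k = (i + \<delta>) mod k" using assms True by simp
  ultimately show ?thesis using assms True by (simp add: min.commute)
next
  case False
  have "cycle_dist k ((Suc i + (\<delta> - 1)) mod k) (Suc i mod k) = min (\<delta> - 1) (k - (\<delta> - 1))"
    using assms by (intro cycle_dist_offset) auto
  then show ?thesis using assms False by (simp add: Suc_diff_le)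
qed

lemma cycle_dist_self [simp]: "cycle_dist k i i = 0"
  by (simp add: cycle_dist_def)

lemma cycle_dist_Suc_offset:
  assumes "\<delta> < k"
  shows "cycle_dist k (Suc (i + \<delta>) mod k) (i mod k) = (if Suc \<delta> = k then 0 else min (Suc \<delta>) (k - Suc \<delta>))"
proof (cases "Suc \<delta> = k")
  case True
  then have "Suc (i + \<delta>) mod k = i mod k" by (metis add_Suc_right mod_add_self2)
  then show ?thesis using True by simp
next
  case False
  then show ?thesis using cycle_dist_offset[of "Suc \<delta>" k i] assms by simp
qed

lemma cycle_dist_Suc_offset_Suc:
  assumes "\<delta> < k"
  shows "cycle_dist k (Suc (i + \<delta>) mod k) (Suc i mod k) = min \<delta> (k - \<delta>)"
  using cycle_dist_offset[OF assms, of "Suc i"] by simp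

text \<open>The subgraphs that arise from a cycle c by attaching leaves. The position on the cycle at which
  the tree of x is rooted is \<open>\<rho> x\<close>, the depth of x in this tree is \<open>h x\<close>.\<close>

inductive leaf_grown for k :: nat and c :: "nat \<Rightarrow> 'a" and \<rho> h :: "'a \<Rightarrow> nat" where
  cycle: "leaf_grown k c \<rho> h (c ` {..<k}) (cycle_edges k c)"
| leaf: "leaf_grown k c \<rho> h V E \<Longrightarrow> y \<in> V \<Longrightarrow> x \<notin> V \<Longrightarrow> \<rho> x = \<rho> y \<Longrightarrow> h x = Suc (h y)
    \<Longrightarrow> leaf_grown k c \<rho> h (insert x V) (insert {x, y} E)"

text \<open>Both functions are total and fixed before the trees grow, so inductions over
  \<open>leaf_grown\<close> never have to update them.\<close>

locale rooted_cycle =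
  fixes k :: nat and c :: "nat \<Rightarrow> 'a" and \<rho> h :: "'a \<Rightarrow> nat"
  assumes k: "3 \<le> k" and inj: "inj_on c {..<k}"
    and \<rho>_c: "\<And>i. i < k \<Longrightarrow> \<rho> (c i) = i" and h_c: "\<And>i. i < k \<Longrightarrow> h (c i) = 0"
begin

abbreviation "cyc_edge i \<equiv> {c i, c (Suc i mod k)}"
abbreviation "VC \<equiv> c ` {..<k}"
abbreviation "EC \<equiv> cycle_edges k c"

lemma c_eq: "i < k \<Longrightarrow> j < k \<Longrightarrow> c i = c j \<longleftrightarrow> i = j"
  using inj by (auto dest: inj_onD)

lemma Suc_mod_neq: "i < k \<Longrightarrow> Suc i mod k \<noteq> i" "i < k \<Longrightarrow> Suc (Suc i mod k) mod k \<noteq> i"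
  using k by (auto simp: mod_Suc)

lemma Suc_mod_less: "Suc i mod k < k" using k by simp

lemma cyc_edge_inj: "inj_on cyc_edge {..<k}"
proof (rule inj_onI)
  fix i j assume "i \<in> {..<k}" "j \<in> {..<k}" "cyc_edge i = cyc_edge j"
  then show "i = j" using c_eq Suc_mod_less Suc_mod_neq(2)[of i] by (auto simp: doubleton_eq_iff)
qed

lemma card_EC: "card EC = k"
  unfolding cycle_edges_def using card_image[OF cyc_edge_inj] by simp

lemma card_VC: "card VC = k" using card_image[OF inj] by simp

lemma EC_cases:
  assumes "{a, b} \<in> EC"
  obtains i where "i < k" "a = c i" "b = c (Suc i mod k)" | i where "i < k" "b = c i" "a = c (Suc i mod k)"
  using assms unfolding cycle_edges_def by (auto simp: doubleton_eq_iff)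

lemma EC_I: "i < k \<Longrightarrow> cyc_edge i \<in> EC" unfolding cycle_edges_def by blast

lemma VC_simple: "simple_graph VC EC"
proof -
  have "\<exists>u v. e = {u, v} \<and> u \<noteq> v \<and> u \<in> VC \<and> v \<in> VC" if "e \<in> EC" for e
  proof -
    from that obtain i where i: "i < k" "e = cyc_edge i" unfolding cycle_edges_def by blast
    then show ?thesis using c_eq Suc_mod_less Suc_mod_neq(1)[of i]
      by (intro exI[of _ "c i"] exI[of _ "c (Suc i mod k)"]) auto
  qed
  then show ?thesis by (simp add: simple_graph_def)
qed

lemma VC_connected: "connected_graph VC EC"
proof -
  have 1: "(c 0, c i) \<in> (adj_rel EC)\<^sup>*" if "i < k" for i
    using that
  proof (induction i)
    case (Suc i)
    then have "(c i, c (Suc i)) \<in> adj_rel EC" using EC_I[of i] by (simp add: adj_rel_def)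
    then show ?case using Suc by simp
  qed simp
  have 2: "(c i, c 0) \<in> (adj_rel EC)\<^sup>*" if "i < k" for i
    using 1[OF that] by (metis rtrancl_power adj_rel_relpow_sym)
  show ?thesis unfolding connected_graph_def using 1 2 k by (auto simp: lessThan_empty_iff intro: rtrancl_trans)
qed

lemma VC_gdist:
  assumes i: "i < k" and p: "p < k"
  shows "gdist EC (c p) (c i) = cycle_dist k p i"
proof -
  have "gdist EC (c p) (c i) = cycle_dist k (\<rho> (c p)) i"
  proof (rule gdist_eqI[where V = VC])
    show "cycle_dist k (\<rho> (c i)) i = 0" using i \<rho>_c by simp
  next
    fix a b assume "{a, b} \<in> EC"
    then show "cycle_dist k (\<rho> a) i \<le> Suc (cycle_dist k (\<rho> b) i)"
    proof (cases rule: EC_cases)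
      case (1 p)
      from mod_offset[OF 1(1) i] obtain \<delta> where "\<delta> < k" "p = (i + \<delta>) mod k" by blast
      then show ?thesis using 1 \<rho>_c Suc_mod_less cycle_dist_offset[of \<delta> k i] cycle_dist_Suc_offset[of \<delta> k i] i
        by (simp add: mod_Suc_eq) linarith
    next
      case (2 p)
      from mod_offset[OF 2(1) i] obtain \<delta> where "\<delta> < k" "p = (i + \<delta>) mod k" by blast
      then show ?thesis using 2 \<rho>_c Suc_mod_less cycle_dist_offset[of \<delta> k i] cycle_dist_Suc_offset[of \<delta> k i] i
        by (simp add: mod_Suc_eq) linarith
    qed
  next
    fix a assume a: "a \<in> VC" "a \<noteq> c i"
    then obtain p where p: "p < k" "a = c p" "p \<noteq> i" by auto
    from mod_offset[OF p(1) i] p(3) obtain \<delta> where \<delta>: "\<delta> < k" "p = (i + \<delta>) mod k" "\<delta> > 0" by blast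
    have cdp: "cycle_dist k p i = min \<delta> (k - \<delta>)" using cycle_dist_offset[OF \<delta>(1), of i] \<delta> i by simp
    show "\<exists>b\<in>VC. {a, b} \<in> EC \<and> cycle_dist k (\<rho> a) i = Suc (cycle_dist k (\<rho> b) i)"
    \<comment> \<open>The neighbour closer to position i is the one on the shorter arc.\<close>
    proof (cases "\<delta> \<le> k - \<delta>")
      case True
      define q where "q = (i + (\<delta> - 1)) mod k"
      have q: "q < k" "Suc q mod k = p" using \<delta> k by (auto simp: q_def mod_Suc_eq)
      have "cycle_dist k q i = min (\<delta> - 1) (k - (\<delta> - 1))" using cycle_dist_offset[of "\<delta> - 1" k i] \<delta> i by (simp add: q_def)
      then have "cycle_dist k p i = Suc (cycle_dist k q i)" using cdp True \<delta> by simp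
      moreover have "{a, c q} \<in> EC" using EC_I[OF q(1)] q p by (simp add: insert_commute)
      ultimately show ?thesis using p q \<rho>_c by (intro bexI[of _ "c q"]) auto
    next
      case False
      have "cycle_dist k (Suc p mod k) i = (if Suc \<delta> = k then 0 else min (Suc \<delta>) (k - Suc \<delta>))"
        using cycle_dist_Suc_offset[OF \<delta>(1), of i] \<delta>(2) i by (simp add: mod_Suc_eq)
      then have "cycle_dist k p i = Suc (cycle_dist k (Suc p mod k) i)" using cdp False \<delta> by (auto split: if_splits)
      then show ?thesis using EC_I[OF p(1)] p Suc_mod_less \<rho>_c by (intro bexI[of _ "c (Suc p mod k)"]) auto
    qed
  qed (use p in simp)
  then show ?thesis using \<rho>_c p by simp
qed

end

section \<open>Distances and edge counts in a cycle with trees\<close>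

context rooted_cycle
begin

abbreviation grown :: "'a set \<Rightarrow> 'a set set \<Rightarrow> bool" where
  "grown \<equiv> leaf_grown k c \<rho> h"

lemma VC_cgraph: "cgraph VC EC"
  by unfold_locales (rule VC_simple VC_connected)+

lemma grown_cgraph: "grown V E \<Longrightarrow> cgraph V E"
proof (induction rule: leaf_grown.induct)
  case cycle
  then show ?case by (rule VC_cgraph)
next
  case (leaf V E y x)
  then interpret leaf_ext V E x y by (simp add: leaf_ext_def leaf_ext_axioms_def)
  show ?case by (rule leaf_cgraph)
qed

lemma grown_leaf_ext: "grown V E \<Longrightarrow> y \<in> V \<Longrightarrow> x \<notin> V \<Longrightarrow> leaf_ext V E x y"
  by (simp add: leaf_ext_def leaf_ext_axioms_def grown_cgraph)

lemma grown_c: "grown V E \<Longrightarrow> i < k \<Longrightarrow> c i \<in> V"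
  by (induction rule: leaf_grown.induct) auto

lemma grown_EC: "grown V E \<Longrightarrow> EC \<subseteq> E"
  by (induction rule: leaf_grown.induct) auto

lemma grown_card: "grown V E \<Longrightarrow> card E = card V"
proof (induction rule: leaf_grown.induct)
  case cycle
  then show ?case using card_EC card_VC by simp
next
  case (leaf V E y x)
  then interpret leaf_ext V E x y by (simp add: grown_leaf_ext)
  show ?case using leaf finE finV new_edge by simp
qed

lemma grown_\<rho>: "grown V E \<Longrightarrow> x \<in> V \<Longrightarrow> \<rho> x < k"
  by (induction arbitrary: x rule: leaf_grown.induct) (auto simp: \<rho>_c)

lemma grown_gdist_c:
  "grown V E \<Longrightarrow> i < k \<Longrightarrow> x \<in> V \<Longrightarrow> gdist E x (c i) = h x + cycle_dist k (\<rho> x) i"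
proof (induction arbitrary: x rule: leaf_grown.induct)
  case cycle
  then show ?case using VC_gdist \<rho>_c h_c by auto
next
  case (leaf V E y w)
  then interpret leaf_ext V E w y by (simp add: grown_leaf_ext)
  show ?case using leaf leaf_gdist[of "c i"] grown_c y by auto
qed

text \<open>Trees at different cycle vertices are joined only through their roots.\<close>

lemma grown_gdist_classes:
  "grown V E \<Longrightarrow> x \<in> V \<Longrightarrow> z \<in> V \<Longrightarrow> \<rho> x \<noteq> \<rho> z \<Longrightarrow>
    gdist E x z = h x + cycle_dist k (\<rho> x) (\<rho> z) + h z"
proof (induction arbitrary: x z rule: leaf_grown.induct)
  case cycle
  then show ?case using VC_gdist \<rho>_c h_c by auto
next
  case (leaf V E y w)
  then interpret leaf_ext V E w y by (simp add: grown_leaf_ext)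
  show ?case using leaf leaf_gdist[of x] leaf_gdist[of z] leaf_gdist'[of x] leaf_gdist'[of z] y by auto
qed

lemma grown_bridge_\<rho>: "grown V E \<Longrightarrow> {u, v} \<in> E \<Longrightarrow> {u, v} \<notin> EC \<Longrightarrow> \<rho> u = \<rho> v"
  by (induction rule: leaf_grown.induct) (auto simp: doubleton_eq_iff)

text \<open>Such an edge is a bridge, so every vertex reaches one of its ends only through the
  other.\<close>

lemma grown_bridge_gdist:
  "grown V E \<Longrightarrow> {u, v} \<in> E \<Longrightarrow> {u, v} \<notin> EC \<Longrightarrow> z \<in> V \<Longrightarrow> gdist E z u \<noteq> gdist E z v"
proof (induction arbitrary: z rule: leaf_grown.induct)
  case (leaf V E y x)
  then interpret leaf_ext V E x y by (simp add: grown_leaf_ext)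
  show ?case
  proof (cases "{u, v} = {x, y}")
    case True
    then show ?thesis using leaf_gdist' leaf_gdist leaf.prems y x by (auto simp: doubleton_eq_iff)
  next
    case False
    then have uv: "{u, v} \<in> E" "u \<in> V" "v \<in> V" using leaf.prems simple_graphD[OF simple] by auto
    show ?thesis using leaf_gdist(1)[OF uv(2)] leaf_gdist(1)[OF uv(3)] leaf_gdist(2)[OF uv(2)]
        leaf_gdist(2)[OF uv(3)] leaf.IH[OF uv(1) _ y] leaf.IH[OF uv(1), of z] leaf.prems by auto
  qed
qed simp

lemma grown_bridge_edist:
  "grown V E \<Longrightarrow> {u, v} \<in> E \<Longrightarrow> {u, v} \<notin> EC \<Longrightarrow> f \<in> E \<Longrightarrow> f \<noteq> {u, v} \<Longrightarrow> edist E f u \<noteq> edist E f v"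
proof (induction arbitrary: f rule: leaf_grown.induct)
  case (leaf V E y x)
  then interpret leaf_ext V E x y by (simp add: grown_leaf_ext)
  show ?case
  proof (cases "{u, v} = {x, y}")
    case True
    then have "f \<in> E" using leaf.prems by auto
    then show ?thesis using True leaf_edist_child leaf_edist y by (auto simp: doubleton_eq_iff)
  next
    case False
    then have uv: "{u, v} \<in> E" "u \<in> V" "v \<in> V" using leaf.prems simple_graphD[OF simple] by auto
    show ?thesis
    proof (cases "f = {x, y}")
      case True
      then show ?thesis using leaf_edist_new[OF uv(2)] leaf_edist_new[OF uv(3)]
          grown_bridge_gdist[OF leaf.hyps(1) uv(1) _ y] leaf.prems by simp
    next
      case False
      then have "f \<in> E" using leaf.prems by simp
      then show ?thesis using leaf_edist uv leaf.IH[OF uv(1)] leaf.prems by simp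
    qed
  qed
qed simp

text \<open>A bridge is the only edge tied between its ends, and there are as many edges as
  vertices.\<close>

lemma grown_bridge_m:
  assumes g: "grown V E" and e: "{u, v} \<in> E" "{u, v} \<notin> EC"
  shows "m_edge E u v + m_edge E v u + 1 = card V"
proof -
  interpret cgraph V E using grown_cgraph[OF g] .
  have *: "E = insert {u, v} ({f \<in> E. edist E f u < edist E f v} \<union> {f \<in> E. edist E f v < edist E f u})"
    using e grown_bridge_edist[OF g e] by (auto simp: linorder_neq_iff)
  have "edist E {u, v} u = edist E {u, v} v" by (simp add: edist_doubleton)
  then have "card E = Suc (card ({f \<in> E. edist E f u < edist E f v} \<union> {f \<in> E. edist E f v < edist E f u}))"
    using finE by (subst *) (simp add: card_insert_if)
  also have "card ({f \<in> E. edist E f u < edist E f v} \<union> {f \<in> E. edist E f v < edist E f u}) =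
    m_edge E u v + m_edge E v u"
    unfolding m_edge_def using finE by (intro card_Un_disjoint) auto
  finally show ?thesis using grown_card[OF g] by simp
qed

text \<open>The path from x to the root of its tree stays in the class of x and has
  \<open>h x\<close> + 1 vertices.\<close>

lemma grown_class_card: "grown V E \<Longrightarrow> x \<in> V \<Longrightarrow> Suc (h x) \<le> card {z \<in> V. \<rho> z = \<rho> x}"
proof (induction arbitrary: x rule: leaf_grown.induct)
  case cycle
  then have "card {x} \<le> card {z \<in> VC. \<rho> z = \<rho> x}" by (intro card_mono) auto
  moreover have "h x = 0" using h_c cycle by auto
  ultimately show ?case by simp
next
  case (leaf V E y w)
  then interpret leaf_ext V E w y by (simp add: grown_leaf_ext)
  show ?case
  proof (cases "x = w")
    case True
    then have "{z \<in> insert w V. \<rho> z = \<rho> x} = insert w {z \<in> V. \<rho> z = \<rho> y}" using leaf by auto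
    then show ?thesis using leaf.IH[OF y] leaf.hyps x finV True by simp
  next
    case False
    then have "Suc (h x) \<le> card {z \<in> V. \<rho> z = \<rho> x}" using leaf by simp
    also have "\<dots> \<le> card {z \<in> insert w V. \<rho> z = \<rho> x}" using finV by (intro card_mono) auto
    finally show ?thesis .
  qed
qed

lemma card_offset:
  assumes "\<And>\<delta>. \<delta> < k \<Longrightarrow> P ((i + \<delta>) mod k) \<longleftrightarrow> \<delta> \<in> D" "D \<subseteq> {..<k}"
  shows "card {p \<in> {..<k}. P p} = card D"
proof -
  have "{p \<in> {..<k}. P p} = (\<lambda>\<delta>. (i + \<delta>) mod k) ` D"
  proof (intro set_eqI iffI)
    fix p assume "p \<in> {p \<in> {..<k}. P p}"
    moreover then have "p \<in> (\<lambda>\<delta>. (i + \<delta>) mod k) ` {..<k}" using bij_mod_offset[of i k] by (auto simp: bij_betw_def)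
    ultimately show "p \<in> (\<lambda>\<delta>. (i + \<delta>) mod k) ` D" using assms by auto
  next
    fix p assume "p \<in> (\<lambda>\<delta>. (i + \<delta>) mod k) ` D"
    then obtain \<delta> where d: "\<delta> \<in> D" "p = (i + \<delta>) mod k" by blast
    then show "p \<in> {p \<in> {..<k}. P p}" using assms(1)[of \<delta>] assms(2) k by auto
  qed
  then show ?thesis using card_image inj_on_subset[OF inj_on_mod_offset assms(2)] by metis
qed

text \<open>For odd k the offset \<open>k - k div 2\<close> occurs neither here nor in
  \<open>closer_iff\<close>: it is the vertex opposite to the edge, equidistant from both
  ends.\<close>

lemma closer_Suc_iff:
  assumes "\<delta> < k"
  shows "cycle_dist k ((i + \<delta>) mod k) (Suc i mod k) < cycle_dist k ((i + \<delta>) mod k) (i mod k) \<longleftrightarrow> \<delta> \<in> {1..k div 2}"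
  unfolding cycle_dist_offset_Suc[OF assms] cycle_dist_offset[OF assms] using assms k by auto

lemma closer_iff:
  assumes "\<delta> < k"
  shows "cycle_dist k ((i + \<delta>) mod k) (i mod k) < cycle_dist k ((i + \<delta>) mod k) (Suc i mod k) \<longleftrightarrow>
    \<delta> \<in> insert 0 {k - k div 2 + 1..<k}"
  unfolding cycle_dist_offset_Suc[OF assms] cycle_dist_offset[OF assms] using assms k by auto

text \<open>The tied edges are the edge itself and, for even k, also the opposite one; the others
  split evenly.\<close>

lemma cycle_m_edge:
  assumes i: "i < k"
  shows "m_edge EC (c (Suc i mod k)) (c i) = k - 1 - k div 2" (is ?A)
    and "m_edge EC (c i) (c (Suc i mod k)) = k - 1 - k div 2" (is ?B)
proof -
  have ed: "edist EC (cyc_edge p) (c j) = min (cycle_dist k p j) (cycle_dist k (Suc p mod k) j)" if "p < k" "j < k" for p j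
    using VC_gdist that Suc_mod_less by (simp add: edist_doubleton)
  have "m_edge EC u v = card {p \<in> {..<k}. edist EC (cyc_edge p) u < edist EC (cyc_edge p) v}" for u v
  proof -
    have "{f \<in> EC. edist EC f u < edist EC f v} = cyc_edge ` {p \<in> {..<k}. edist EC (cyc_edge p) u < edist EC (cyc_edge p) v}"
      unfolding cycle_edges_def[of k c] by auto
    then show ?thesis unfolding m_edge_def by (simp only:) (rule card_image[OF inj_on_subset[OF cyc_edge_inj]], auto)
  qed
  note m = this
  have off: "edist EC (cyc_edge ((i + \<delta>) mod k)) (c i) = min \<delta> (k - 1 - \<delta>)"
    "edist EC (cyc_edge ((i + \<delta>) mod k)) (c (Suc i mod k)) = min (\<delta> - 1) (k - \<delta>)" if "\<delta> < k" for \<delta>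
  proof -
    have q: "(i + \<delta>) mod k < k" "i mod k = i" "Suc ((i + \<delta>) mod k) mod k = Suc (i + \<delta>) mod k"
      using i k by (simp_all add: mod_Suc_eq)
    have "edist EC (cyc_edge ((i + \<delta>) mod k)) (c i) =
        min (min \<delta> (k - \<delta>)) (if Suc \<delta> = k then 0 else min (Suc \<delta>) (k - Suc \<delta>))"
      using ed[OF q(1) i] cycle_dist_offset[OF that, of i] cycle_dist_Suc_offset[OF that, of i] unfolding q by simp
    also have "\<dots> = min \<delta> (k - 1 - \<delta>)" using that by auto
    finally show "edist EC (cyc_edge ((i + \<delta>) mod k)) (c i) = min \<delta> (k - 1 - \<delta>)" .
    have "edist EC (cyc_edge ((i + \<delta>) mod k)) (c (Suc i mod k)) =
        min (if \<delta> = 0 then min 1 (k - 1) else min (\<delta> - 1) (k - \<delta> + 1)) (min \<delta> (k - \<delta>))"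
      using ed[OF q(1) Suc_mod_less] cycle_dist_offset_Suc[OF that, of i] cycle_dist_Suc_offset_Suc[OF that, of i] unfolding q by simp
    also have "\<dots> = min (\<delta> - 1) (k - \<delta>)" by auto
    finally show "edist EC (cyc_edge ((i + \<delta>) mod k)) (c (Suc i mod k)) = min (\<delta> - 1) (k - \<delta>)" .
  qed
  have "card {p \<in> {..<k}. edist EC (cyc_edge p) (c (Suc i mod k)) < edist EC (cyc_edge p) (c i)}
      = card {1..k - 1 - k div 2}"
  proof (rule card_offset[where i = i])
    show "edist EC (cyc_edge ((i + \<delta>) mod k)) (c (Suc i mod k)) < edist EC (cyc_edge ((i + \<delta>) mod k)) (c i)
        \<longleftrightarrow> \<delta> \<in> {1..k - 1 - k div 2}" if "\<delta> < k" for \<delta>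
      unfolding off[OF that] atLeastAtMost_iff using that k by linarith
  qed (use k in auto)
  then show ?A using m by simp
  have "card {p \<in> {..<k}. edist EC (cyc_edge p) (c i) < edist EC (cyc_edge p) (c (Suc i mod k))}
      = card {k div 2 + 1..<k}"
  proof (rule card_offset[where i = i])
    show "edist EC (cyc_edge ((i + \<delta>) mod k)) (c i) < edist EC (cyc_edge ((i + \<delta>) mod k)) (c (Suc i mod k))
        \<longleftrightarrow> \<delta> \<in> {k div 2 + 1..<k}" if "\<delta> < k" for \<delta>
      unfolding off[OF that] atLeastLessThan_iff using that k by linarith
  qed auto
  then show ?B using m by simp
qed

text \<open>A leaf adds its vertex and its edge to the same side, if to any. So the difference
  between vertices and edges on a side stays what it is on the bare cycle: one for even k, zero for
  odd k.\<close>

lemma grown_cycle_m: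
  "grown V E \<Longrightarrow> i < k \<Longrightarrow>
    m_edge E (c (Suc i mod k)) (c i) + (if even k then 1 else 0) =
      card {x \<in> V. cycle_dist k (\<rho> x) (Suc i mod k) < cycle_dist k (\<rho> x) i} \<and>
    m_edge E (c i) (c (Suc i mod k)) + (if even k then 1 else 0) =
      card {x \<in> V. cycle_dist k (\<rho> x) i < cycle_dist k (\<rho> x) (Suc i mod k)}"
proof (induction rule: leaf_grown.induct)
  case cycle
  have *: "card {x \<in> VC. P (\<rho> x)} = card {p \<in> {..<k}. P p}" for P
  proof -
    have "{x \<in> VC. P (\<rho> x)} = c ` {p \<in> {..<k}. P p}" using \<rho>_c by auto
    then show ?thesis by (simp only:) (rule card_image[OF inj_on_subset[OF inj]], auto)
  qed
  have "card {p \<in> {..<k}. cycle_dist k p (Suc i mod k) < cycle_dist k p i} = card {1..k div 2}"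
    using closer_Suc_iff[of _ i] cycle k by (intro card_offset[where i = i]) auto
  moreover have "card {p \<in> {..<k}. cycle_dist k p i < cycle_dist k p (Suc i mod k)} = card (insert 0 {k - k div 2 + 1..<k})"
    using closer_iff[of _ i] cycle k by (intro card_offset[where i = i]) auto
  moreover have "k - 1 - k div 2 + (if even k then 1 else 0) = k div 2" using k by (auto elim!: evenE oddE)
  ultimately show ?case using cycle_m_edge[OF cycle] k
      *[of "\<lambda>p. cycle_dist k p (Suc i mod k) < cycle_dist k p i"] *[of "\<lambda>p. cycle_dist k p i < cycle_dist k p (Suc i mod k)"]
    by (auto simp: card_insert_if)
next
  case (leaf V E y x)
  then interpret leaf_ext V E x y by (simp add: grown_leaf_ext)
  have c: "c i \<in> V" "c (Suc i mod k) \<in> V" using grown_c[OF leaf.hyps(1)] leaf.prems Suc_mod_less by auto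
  have *: "card {z \<in> insert x V. P (\<rho> z)} = card {z \<in> V. P (\<rho> z)} + (if P (\<rho> y) then 1 else 0)" for P
  proof -
    have "{z \<in> insert x V. P (\<rho> z)} = {z \<in> V. P (\<rho> z)} \<union> (if P (\<rho> y) then {x} else {})"
      using leaf.hyps(4) by auto
    then show ?thesis using finV leaf.hyps(3) by auto
  qed
  show ?case
    using leaf.IH leaf.prems leaf_m_edge[OF c] leaf_m_edge[OF c(2) c(1)] Suc_mod_less
      grown_gdist_c[OF leaf.hyps(1) _ y, of i] grown_gdist_c[OF leaf.hyps(1) _ y, of "Suc i mod k"]
      *[of "\<lambda>p. cycle_dist k p (Suc i mod k) < cycle_dist k p i"] *[of "\<lambda>p. cycle_dist k p i < cycle_dist k p (Suc i mod k)"]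
    by simp
qed

text \<open>The vertices closer to the child u form the subtree below it, and a tree has one edge
  fewer than vertices. This serves to weigh the pendent paths of the extremal graph.\<close>

lemma grown_h_parent:
  "grown V E \<Longrightarrow> {u, v} \<in> E \<Longrightarrow> {u, v} \<notin> EC \<Longrightarrow> h v < h u \<Longrightarrow>
    m_edge E u v + 1 = card {x \<in> V. gdist E x u < gdist E x v}"
proof (induction rule: leaf_grown.induct)
  case (leaf V E y x)
  then interpret leaf_ext V E x y by (simp add: grown_leaf_ext)
  show ?case
  proof (cases "{u, v} = {x, y}")
    case True
    then have uv: "u = x" "v = y" using leaf.prems leaf.hyps by (auto simp: doubleton_eq_iff)
    have "{z \<in> insert x V. gdist E' z x < gdist E' z y} = {x}"
      using leaf_gdist' leaf_gdist y x by auto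
    then show ?thesis using leaf_m_edge_child uv by simp
  next
    case False
    then have uv: "{u, v} \<in> E" "u \<in> V" "v \<in> V" using leaf.prems simple_graphD[OF simple] by auto
    have "{z \<in> insert x V. gdist E' z u < gdist E' z v} =
        {z \<in> V. gdist E z u < gdist E z v} \<union> (if gdist E y u < gdist E y v then {x} else {})"
      using leaf_gdist[OF uv(2)] leaf_gdist[OF uv(3)] x by auto
    then show ?thesis using leaf_m_edge[OF uv(2,3)] leaf.IH uv leaf.prems finV x by auto
  qed
qed simp

end

section \<open>Every unicyclic graph is a cycle with trees\<close>

lemma leaf_grown_cong:
  assumes "leaf_grown k c \<rho> h V E" "\<And>x. x \<in> V \<Longrightarrow> \<rho> x = \<rho>' x" "\<And>x. x \<in> V \<Longrightarrow> h x = h' x"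
  shows "leaf_grown k c \<rho>' h' V E"
  using assms
proof (induction rule: leaf_grown.induct)
  case cycle
  show ?case by (rule leaf_grown.cycle)
next
  case (leaf V E y x)
  have "leaf_grown k c \<rho>' h' V E" using leaf.prems by (intro leaf.IH) auto
  then show ?case by (rule leaf_grown.leaf) (use leaf in auto)
qed

context cgraph
begin

text \<open>Each step adds one vertex and one edge, so the difference of the two numbers is
  invariant. Started from a single vertex, this yields a spanning tree.\<close>

lemma spanning_tree:
  assumes "V0 \<subseteq> V" "cgraph V0 E0" "E0 \<subseteq> E"
  shows "\<exists>E1\<subseteq>E. cgraph V E1 \<and> card E1 + card V0 = card E0 + card V"
  using assms
proof (induction "card (V - V0)" arbitrary: V0 E0)
  case 0
  then have "V0 = V" using finV by auto
  then show ?case using 0 by auto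
next
  case (Suc m)
  have "V0 \<noteq> V" using Suc.hyps(2) by auto
  moreover have "V0 \<noteq> {}" using cgraph.conn[OF Suc.prems(2)] by (simp add: connected_graph_def)
  ultimately obtain x y where xy: "y \<in> V0" "x \<in> V - V0" "{x, y} \<in> E"
    by (metis grow[OF Suc.prems(1)])
  interpret ext: leaf_ext V0 E0 x y using xy Suc.prems by (simp add: leaf_ext_def leaf_ext_axioms_def)
  have "V - insert x V0 = (V - V0) - {x}" by blast
  then have "m = card (V - insert x V0)" using Suc.hyps(2) xy by simp
  moreover have "insert x V0 \<subseteq> V" "insert {x, y} E0 \<subseteq> E" using xy Suc.prems(1,3) by auto
  ultimately obtain E1 where "E1 \<subseteq> E" "cgraph V E1"
    "card E1 + card (insert x V0) = card (insert {x, y} E0) + card V"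
    using Suc.hyps(1)[OF _ _ ext.leaf_cgraph] by blast
  then show ?case using xy ext.finE ext.finV ext.new_edge by (intro exI[of _ E1]) simp
qed

lemma grow_leaves:
  assumes "rooted_cycle k c \<rho> h" "leaf_grown k c \<rho> h V0 E0" "V0 \<subseteq> V" "E0 \<subseteq> E"
  shows "\<exists>\<rho>' h' E1. rooted_cycle k c \<rho>' h' \<and> leaf_grown k c \<rho>' h' V E1 \<and> E1 \<subseteq> E"
  using assms
proof (induction "card (V - V0)" arbitrary: V0 E0 \<rho> h)
  case 0
  then have "V0 = V" using finV by auto
  then show ?case using 0 by blast
next
  case (Suc m)
  interpret rooted_cycle k c \<rho> h by (rule Suc.prems(1))
  have "V0 \<noteq> V" using Suc.hyps(2) by auto
  moreover have "V0 \<noteq> {}" using grown_c[OF Suc.prems(2), of 0] k by auto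
  ultimately obtain x y where xy: "y \<in> V0" "x \<in> V - V0" "{x, y} \<in> E"
    by (metis grow[OF Suc.prems(3)])
  \<comment> \<open>The vertex x has not occurred yet, so redefining both functions at x leaves the
    part already grown intact.\<close>
  define \<rho>' h' where "\<rho>' = \<rho>(x := \<rho> y)" and "h' = h(x := Suc (h y))"
  have "x \<noteq> c i" if "i < k" for i using grown_c[OF Suc.prems(2) that] xy by auto
  then have rc: "rooted_cycle k c \<rho>' h'"
    using k inj \<rho>_c h_c by unfold_locales (auto simp: \<rho>'_def h'_def)
  have "leaf_grown k c \<rho>' h' V0 E0"
    by (rule leaf_grown_cong[OF Suc.prems(2)]) (use xy in \<open>auto simp: \<rho>'_def h'_def\<close>)
  then have lg: "leaf_grown k c \<rho>' h' (insert x V0) (insert {x, y} E0)"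
    by (rule leaf_grown.leaf) (use xy in \<open>auto simp: \<rho>'_def h'_def\<close>)
  have "V - insert x V0 = (V - V0) - {x}" by blast
  then have "m = card (V - insert x V0)" using Suc.hyps(2) xy by simp
  from Suc.hyps(1)[OF this rc lg] show ?case using xy Suc.prems(3,4) by simp
qed

end

text \<open>A spanning tree misses an edge; together with a shortest path in the tree between its ends
  this edge forms a cycle.\<close>
lemma unicyclic_leaf_grown:
  assumes "unicyclic V E"
  obtains k c \<rho> h where "rooted_cycle k c \<rho> h" "leaf_grown k c \<rho> h V E"
proof -
  interpret cgraph V E using assms by unfold_locales (auto simp: unicyclic_def)
  have card: "card E = card V" using assms by (simp add: unicyclic_def)
  obtain r where r: "r \<in> V" using conn by (auto simp: connected_graph_def)
  have "cgraph {r} {}" by unfold_locales (auto simp: simple_graph_def connected_graph_def)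
  from spanning_tree[OF _ this] r obtain T where T: "T \<subseteq> E" "cgraph V T" "card T + 1 = card V" by auto
  interpret T: cgraph V T by (rule T(2))
  have "T \<noteq> E" using T(3) card by auto
  then obtain e where e: "e \<in> E" "e \<notin> T" using T(1) by blast
  from simple e(1) obtain u v where uv: "e = {u, v}" "u \<noteq> v" "u \<in> V" "v \<in> V" by (rule simple_graphE)
  define d where "d = gdist T u v"
  from T.geodesic[OF uv(3,4) d_def[symmetric]] obtain x where x: "x 0 = u" "x d = v"
    "\<And>i. i < d \<Longrightarrow> {x i, x (Suc i)} \<in> T" "\<And>i. i \<le> d \<Longrightarrow> x i \<in> V"
    "\<And>i j. i \<le> j \<Longrightarrow> j \<le> d \<Longrightarrow> gdist T (x i) (x j) = j - i" by blast
  have "d \<noteq> 0" using x(1,2) uv(2) by (cases "d = 0") auto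
  moreover have "d \<noteq> 1" using x(1,2) x(3)[of 0] e uv by auto
  ultimately have d: "2 \<le> d" by simp
  define \<rho> where "\<rho> = the_inv_into {..<Suc d} x"
  have inj: "inj_on x {..<Suc d}"
  proof (rule linorder_inj_onI)
    fix i j assume ij: "i < j" "i \<in> {..<Suc d}" "j \<in> {..<Suc d}"
    then have "gdist T (x i) (x j) = j - i" using x(5)[of i j] by simp
    then show "x i \<noteq> x j" using ij by auto
  qed auto
  have rc: "rooted_cycle (Suc d) x \<rho> (\<lambda>_. 0)"
    using d inj by unfold_locales (auto simp: \<rho>_def intro!: the_inv_into_f_f)
  have "x ` {..<Suc d} \<subseteq> V" using x(4) by auto
  moreover have "cycle_edges (Suc d) x \<subseteq> E"
  proof
    fix f assume "f \<in> cycle_edges (Suc d) x"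
    then obtain i where i: "i < Suc d" "f = {x i, x (Suc i mod Suc d)}" by (auto simp: cycle_edges_def)
    show "f \<in> E"
    proof (cases "i = d")
      case True
      then show ?thesis using i x(1,2) e uv by (simp add: insert_commute)
    next
      case False
      then show ?thesis using i x(3)[of i] T(1) by auto
    qed
  qed
  ultimately obtain \<rho>' h' E1 where G: "rooted_cycle (Suc d) x \<rho>' h'" "leaf_grown (Suc d) x \<rho>' h' V E1" "E1 \<subseteq> E"
    using grow_leaves[OF rc leaf_grown.cycle] by blast
  \<comment> \<open>The grown graph has as many edges as vertices, and so has E; hence no edge of E
    is left over.\<close>
  have "E1 = E" using rooted_cycle.grown_card[OF G(1,2)] card G(3) finE by (intro card_subset_eq) auto
  then show ?thesis using that G by blast
qed

section \<open>Weights of edges along a geodesic\<close>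

text \<open>The contribution of an edge to the index. The maximum selects the distance to the other end, so
  that no orientation of the edge has to be chosen.\<close>
definition edge_weight :: "'a set set \<Rightarrow> 'a set \<Rightarrow> nat" where
  "edge_weight E e = (\<Prod>u\<in>e. card {f \<in> E. edist E f u < Max (edist E f ` e)})"

lemma edge_weight_doubleton:
  assumes "u \<noteq> v"
  shows "edge_weight E {u, v} = m_edge E u v * m_edge E v u"
proof -
  have "{f \<in> E. edist E f u < Max (edist E f ` {u, v})} = {f \<in> E. edist E f u < edist E f v}"
    "{f \<in> E. edist E f v < Max (edist E f ` {u, v})} = {f \<in> E. edist E f v < edist E f u}" by auto
  then show ?thesis using assms unfolding edge_weight_def m_edge_def by simp
qed

lemma edge_szeged_sum:
  assumes s: "simple_graph V E"
  shows "edge_szeged E = sum (edge_weight E) E"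
proof -
  let ?P = "{(u, v). {u, v} \<in> E}" and ?g = "\<lambda>(u, v). m_edge E u v * m_edge E v u"
  have finP: "finite ?P"
    by (rule finite_subset[of _ "V \<times> V"]) (use simple_graphD[OF s] s in \<open>auto simp: simple_graph_def\<close>)
  \<comment> \<open>Ordered pairs are grouped by their underlying edge. Each edge has exactly two
    orientations, which the division by 2 absorbs.\<close>
  have "sum ?g ?P = (\<Sum>e\<in>E. sum ?g {p \<in> ?P. (\<lambda>(u, v). {u, v}) p = e})"
    by (rule sum.group[symmetric]) (use finP simple_graph_finite_edges[OF s] in auto)
  also have "\<dots> = (\<Sum>e\<in>E. 2 * edge_weight E e)"
  proof (rule sum.cong)
    fix e assume e: "e \<in> E"
    from s e obtain a b where ab: "e = {a, b}" "a \<noteq> b" by (rule simple_graphE)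
    have "{p \<in> ?P. (\<lambda>(u, v). {u, v}) p = e} = {(a, b), (b, a)}"
      using e ab by (auto simp: doubleton_eq_iff insert_commute)
    then show "sum ?g {p \<in> ?P. (\<lambda>(u, v). {u, v}) p = e} = 2 * edge_weight E e"
      using ab by (simp add: edge_weight_doubleton)
  qed simp
  finally show ?thesis by (simp add: edge_szeged_def sum_distrib_left[symmetric])
qed

locale geodesic_path = cgraph +
  fixes x :: "nat \<Rightarrow> 'a" and d :: nat
  assumes xE: "\<And>i. i < d \<Longrightarrow> {x i, x (Suc i)} \<in> E" and xV: "\<And>i. i \<le> d \<Longrightarrow> x i \<in> V"
    and x_dist: "\<And>i j. i \<le> j \<Longrightarrow> j \<le> d \<Longrightarrow> gdist E (x i) (x j) = j - i"
begin

abbreviation "path_edge i \<equiv> {x i, x (Suc i)}"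

lemma x_inj: "i \<le> d \<Longrightarrow> j \<le> d \<Longrightarrow> x i = x j \<longleftrightarrow> i = j"
  by (metis gdist_self x_dist diff_is_0_eq le_antisym nat_le_linear)

lemma path_edge_inj: "inj_on path_edge {..<d}"
proof (rule inj_onI)
  fix i j assume ij: "i \<in> {..<d}" "j \<in> {..<d}" "path_edge i = path_edge j"
  then consider "x i = x j" | "x i = x (Suc j)" "x (Suc i) = x j" by (auto simp: doubleton_eq_iff)
  then show "i = j" using ij x_inj[of i j] x_inj[of i "Suc j"] x_inj[of "Suc i" j] by cases auto
qed

lemma path_edist:
  assumes "i < j" "j \<le> d"
  shows "edist E (path_edge i) (x j) = j - 1 - i"
  using x_dist[of i j] x_dist[of "Suc i" j] assms by (simp add: edist_doubleton)

lemma path_edist':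
  assumes "j \<le> i" "i < d"
  shows "edist E (path_edge i) (x j) = i - j"
  using x_dist[of j i] x_dist[of j "Suc i"] assms by (simp add: edist_doubleton gdist_sym[of E _ "x j"])

text \<open>On a geodesic the j earlier edges are closer to \<open>x j\<close> and the d - 1 - j
  later ones to \<open>x (Suc j)\<close>.\<close>

lemma path_m_lower:
  assumes "j < d"
  shows "j \<le> m_edge E (x j) (x (Suc j))" "d - 1 - j \<le> m_edge E (x (Suc j)) (x j)"
proof -
  have "card (path_edge ` {..<j}) \<le> m_edge E (x j) (x (Suc j))"
    unfolding m_edge_def
    by (rule card_mono) (use assms xE path_edist finE in auto)
  moreover have "card (path_edge ` {..<j}) = j"
    using card_image[OF inj_on_subset[OF path_edge_inj, of "{..<j}"]] assms by auto
  ultimately show "j \<le> m_edge E (x j) (x (Suc j))" by simp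
  have "card (path_edge ` {Suc j..<d}) \<le> m_edge E (x (Suc j)) (x j)"
    unfolding m_edge_def
    by (rule card_mono) (use assms xE path_edist' finE in auto)
  moreover have "card (path_edge ` {Suc j..<d}) = d - 1 - j"
    using card_image[OF inj_on_subset[OF path_edge_inj, of "{Suc j..<d}"]] by (simp add: subset_eq)
  ultimately show "d - 1 - j \<le> m_edge E (x (Suc j)) (x j)" by simp
qed

end

lemma sum_lessThan_add:
  "(\<Sum>\<delta><a + b. f \<delta>) = (\<Sum>\<delta><a. f \<delta>) + (\<Sum>\<delta><b. f (a + \<delta>))" for f :: "nat \<Rightarrow> 'b::comm_monoid_add"
  by (induction b) (simp_all add: add.assoc)

section \<open>Tree sizes and the sides of cycle edges\<close>

locale grown_graph = rooted_cycle k c \<rho> h + cgraph V E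
  for k and c :: "nat \<Rightarrow> 'a" and \<rho> h and V :: "'a set" and E :: "'a set set" +
  assumes grown: "grown V E"
begin

abbreviation "n \<equiv> card V"
abbreviation "half \<equiv> k div 2"

definition A :: "nat \<Rightarrow> nat" where "A i = card {z \<in> V. \<rho> z = i mod k}"
text \<open>One side of a cycle edge consists of the trees at \<open>half\<close> consecutive
  positions, and \<open>W i\<close> is the size of such a block. Positions are read modulo k, so a
  block may run past the end of the numbering.\<close>

definition W :: "nat \<Rightarrow> nat" where "W i = (\<Sum>\<delta><half. A (i + \<delta>))"

lemma A_pos: "1 \<le> A i"
proof -
  have "i mod k < k" using k by simp
  then have "card {c (i mod k)} \<le> A i"
    unfolding A_def using grown_c[OF grown] \<rho>_c finV by (intro card_mono) auto
  then show ?thesis by simp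
qed

lemma A_period: "A (i + k) = A i" by (simp add: A_def)

lemma W_mod: "W (i mod k) = W i"
  unfolding W_def A_def by (simp add: mod_simps)

lemma W_period: "W (i + k) = W i"
  by (metis W_mod mod_add_self2)

lemma W_ge: "half \<le> W i"
  unfolding W_def using sum_mono[of "{..<half}" "\<lambda>_. 1" "\<lambda>\<delta>. A (i + \<delta>)"] A_pos by simp

lemma card_class_offsets:
  assumes P: "\<And>\<delta>. \<delta> < k \<Longrightarrow> P ((i + \<delta>) mod k) \<longleftrightarrow> \<delta> \<in> D" and D: "D \<subseteq> {..<k}"
  shows "card {z \<in> V. P (\<rho> z)} = (\<Sum>\<delta>\<in>D. A (i + \<delta>))"
proof -
  have fin: "finite D" using D finite_subset by blast
  have "{z \<in> V. P (\<rho> z)} = (\<Union>\<delta>\<in>D. {z \<in> V. \<rho> z = (i + \<delta>) mod k})"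
  proof (intro set_eqI iffI)
    fix z assume z: "z \<in> {z \<in> V. P (\<rho> z)}"
    then have "\<rho> z \<in> (\<lambda>\<delta>. (i + \<delta>) mod k) ` {..<k}"
      using grown_\<rho>[OF grown] bij_mod_offset[of i k] by (auto simp: bij_betw_def)
    then show "z \<in> (\<Union>\<delta>\<in>D. {z \<in> V. \<rho> z = (i + \<delta>) mod k})" using z P by auto
  qed (use P D in auto)
  also have "card \<dots> = (\<Sum>\<delta>\<in>D. A (i + \<delta>))"
    unfolding A_def
  proof (rule card_UN_disjoint)
    show "\<forall>\<delta>\<in>D. \<forall>\<delta>'\<in>D. \<delta> \<noteq> \<delta>' \<longrightarrow>
        {z \<in> V. \<rho> z = (i + \<delta>) mod k} \<inter> {z \<in> V. \<rho> z = (i + \<delta>') mod k} = {}"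
      using inj_on_subset[OF inj_on_mod_offset D, of i] by (auto dest: inj_onD)
  qed (use fin finV in auto)
  finally show ?thesis .
qed

lemma sum_A: "(\<Sum>\<delta><k. A (i + \<delta>)) = n"
  using card_class_offsets[of "\<lambda>_. True" i "{..<k}"] by simp

abbreviation "fwd i \<equiv> {z \<in> V. cycle_dist k (\<rho> z) (Suc i mod k) < cycle_dist k (\<rho> z) (i mod k)}"
abbreviation "bwd i \<equiv> {z \<in> V. cycle_dist k (\<rho> z) (i mod k) < cycle_dist k (\<rho> z) (Suc i mod k)}"

lemma card_fwd: "card (fwd i) = W (Suc i)"
proof -
  have "card (fwd i) = (\<Sum>\<delta>\<in>{1..half}. A (i + \<delta>))"
    by (rule card_class_offsets) (use closer_Suc_iff k in auto)
  also have "\<dots> = (\<Sum>\<delta><half. A (i + Suc \<delta>))"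
    by (rule sum.reindex_bij_witness[of _ Suc "\<lambda>\<delta>. \<delta> - 1"]) auto
  finally show ?thesis by (simp add: W_def)
qed

lemma card_bwd: "card (bwd i) = W (i + k - half + 1)"
proof -
  have "card (bwd i) = (\<Sum>\<delta>\<in>insert 0 {k - half + 1..<k}. A (i + \<delta>))"
    by (rule card_class_offsets) (use closer_iff k in auto)
  \<comment> \<open>Replacing offset 0 by offset k makes the offsets consecutive.\<close>
  also have "\<dots> = A (i + k) + (\<Sum>\<delta>\<in>{k - half + 1..<k}. A (i + \<delta>))"
    by (subst sum.insert) (auto simp: A_period)
  also have "\<dots> = (\<Sum>\<delta>\<in>{k - half + 1..k}. A (i + \<delta>))"
  proof -
    have "{k - half + 1..k} = insert k {k - half + 1..<k}" using k by auto
    then show ?thesis by simp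
  qed
  also have "\<dots> = (\<Sum>\<delta><half. A (i + k - half + 1 + \<delta>))"
    by (rule sum.reindex_bij_witness[of _ "\<lambda>\<delta>. k - half + 1 + \<delta>" "\<lambda>\<delta>. \<delta> - (k - half + 1)"]) (auto simp: algebra_simps)
  finally show ?thesis by (simp add: W_def)
qed

text \<open>Of the \<open>half\<close> trees on this side, the one containing z has more than
  \<open>h z\<close> vertices and each of the others at least one.\<close>

lemma class_in_side:
  assumes z: "z \<in> V" and S: "S = fwd i \<or> S = bwd i" and zS: "z \<in> S"
  shows "h z + half \<le> card S"
proof -
  have "\<exists>D. card S = (\<Sum>\<delta>\<in>D. A (i + \<delta>)) \<and> D \<subseteq> {..<k} \<and> card D = half \<and> (\<exists>\<delta>\<in>D. \<rho> z = (i + \<delta>) mod k)"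
  proof -
    have "\<rho> z \<in> (\<lambda>\<delta>. (i + \<delta>) mod k) ` {..<k}"
      using grown_\<rho>[OF grown z] bij_mod_offset[of i k] by (auto simp: bij_betw_def)
    then obtain \<delta> where \<delta>: "\<delta> < k" "\<rho> z = (i + \<delta>) mod k" by auto
    from S show ?thesis
    proof
      assume S: "S = fwd i"
      have "card S = (\<Sum>\<delta>\<in>{1..half}. A (i + \<delta>))"
        unfolding S by (rule card_class_offsets) (use closer_Suc_iff k in auto)
      moreover have "\<delta> \<in> {1..half}" using zS \<delta> closer_Suc_iff[OF \<delta>(1), of i] unfolding S by auto
      ultimately show ?thesis using \<delta> k by (intro exI[of _ "{1..half}"]) auto
    next
      assume S: "S = bwd i"
      have "card S = (\<Sum>\<delta>\<in>insert 0 {k - half + 1..<k}. A (i + \<delta>))"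
        unfolding S by (rule card_class_offsets) (use closer_iff k in auto)
      moreover have "\<delta> \<in> insert 0 {k - half + 1..<k}" using zS \<delta> closer_iff[OF \<delta>(1), of i] unfolding S by auto
      moreover have "card (insert 0 {k - half + 1..<k}) = half" using k by (simp add: card_insert_if)
      ultimately show ?thesis using \<delta> k by (intro exI[of _ "insert 0 {k - half + 1..<k}"]) auto
    qed
  qed
  then obtain D \<delta> where D: "card S = (\<Sum>\<delta>\<in>D. A (i + \<delta>))" "D \<subseteq> {..<k}" "card D = half" "\<delta> \<in> D" "\<rho> z = (i + \<delta>) mod k"
    by blast
  have fin: "finite D" using D(2) finite_subset by blast
  have "card S = A (i + \<delta>) + (\<Sum>\<delta>\<in>D - {\<delta>}. A (i + \<delta>))"
    using D fin by (simp add: sum.remove)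
  moreover have "(\<Sum>\<delta>\<in>D - {\<delta>}. A (i + \<delta>)) \<ge> half - 1"
    using sum_mono[of "D - {\<delta>}" "\<lambda>_. 1" "\<lambda>\<delta>. A (i + \<delta>)"] A_pos D fin by simp
  moreover have "Suc (h z) \<le> A (i + \<delta>)"
    using grown_class_card[OF grown z] D(5) by (simp add: A_def)
  ultimately show ?thesis using k by linarith
qed

lemma cyc_weight:
  assumes "i < k"
  shows "edge_weight E (cyc_edge i) =
    (W (Suc i) - (if even k then 1 else 0)) * (W (i + k - half + 1) - (if even k then 1 else 0))"
proof -
  have "c i \<noteq> c (Suc i mod k)" using c_eq Suc_mod_less Suc_mod_neq(1)[of i] assms by simp
  moreover have "m_edge E (c (Suc i mod k)) (c i) = W (Suc i) - (if even k then 1 else 0)"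
    "m_edge E (c i) (c (Suc i mod k)) = W (i + k - half + 1) - (if even k then 1 else 0)"
    using grown_cycle_m[OF grown assms] card_fwd[of i] card_bwd[of i] assms by auto
  ultimately show ?thesis by (simp add: edge_weight_doubleton)
qed

lemma sum_EC: "sum f EC = (\<Sum>i<k. f (cyc_edge i))"
  unfolding cycle_edges_def using sum.reindex[OF cyc_edge_inj] by simp

lemma cycle_dist_le: "p < k \<Longrightarrow> i < k \<Longrightarrow> cycle_dist k p i \<le> half"
proof -
  assume "p < k" "i < k"
  then obtain \<delta> where "\<delta> < k" "p = (i + \<delta>) mod k" using mod_offset by blast
  then show ?thesis using cycle_dist_offset[of \<delta> k i] \<open>i < k\<close> by simp
qed

lemma gdist_cc: "i < k \<Longrightarrow> p < k \<Longrightarrow> gdist E (c p) (c i) = cycle_dist k p i"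
  using grown_gdist_c[OF grown, of i "c p"] grown_c[OF grown] \<rho>_c h_c by simp

end

section \<open>Edges of the path that lie on the cycle\<close>

locale grown_path = grown_graph k c \<rho> h V E + geodesic_path V E x d
  for k and c :: "nat \<Rightarrow> 'a" and \<rho> h and V :: "'a set" and E :: "'a set set" and x d
begin

definition J :: "nat set" where "J = {j. j < d \<and> path_edge j \<in> EC}"
definition idx :: "nat \<Rightarrow> nat" where "idx j = (SOME i. i < k \<and> path_edge j = cyc_edge i)"

lemma idx:
  assumes "j \<in> J"
  shows "idx j < k" "path_edge j = cyc_edge (idx j)"
proof -
  have "\<exists>i. i < k \<and> path_edge j = cyc_edge i" using assms unfolding J_def cycle_edges_def by auto
  from someI_ex[OF this] show "idx j < k" "path_edge j = cyc_edge (idx j)" unfolding idx_def by auto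
qed

lemma J_less: "j \<in> J \<Longrightarrow> j < d" by (simp add: J_def)

lemma finJ: "finite J" unfolding J_def by simp

lemma idx_inj: "inj_on idx J"
proof (rule inj_onI)
  fix i j assume "i \<in> J" "j \<in> J" "idx i = idx j"
  then show "i = j" using idx(2)[of i] idx(2)[of j] inj_onD[OF path_edge_inj, of i j] J_less by simp
qed

lemma gdist_path:
  assumes "a \<le> d" "b \<le> d"
  shows "gdist E (x a) (x b) = (if a \<le> b then b - a else a - b)"
  using x_dist[of a b] x_dist[of b a] assms gdist_sym[of E "x a" "x b"] by auto

text \<open>Each end of the path reaches the farther end of the edge with at most
  \<open>half\<close> steps on the cycle, which bounds the length of the path on its side; and the
  two ends of the path lie on different sides. There are two cases because the path may run along
  the numbering of the cycle or against it.\<close>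

lemma path_side:
  assumes "j \<in> J"
  shows "j < h (x 0) + half" "d - 1 - j < h (x d) + half"
    "(x j = c (idx j) \<and> x (Suc j) = c (Suc (idx j) mod k) \<and>
      h (x 0) + half \<le> W (idx j + k - half + 1) \<and> h (x d) + half \<le> W (Suc (idx j))) \<or>
     (x (Suc j) = c (idx j) \<and> x j = c (Suc (idx j) mod k) \<and>
      h (x d) + half \<le> W (idx j + k - half + 1) \<and> h (x 0) + half \<le> W (Suc (idx j)))"
proof -
  define i where "i = idx j"
  have i: "i < k" "path_edge j = cyc_edge i" "Suc i mod k < k" using idx[OF assms] Suc_mod_less by (auto simp: i_def)
  have j: "j < d" using assms J_less by simp
  have gd: "gdist E (x 0) (x j) = j" "gdist E (x 0) (x (Suc j)) = Suc j"
    "gdist E (x d) (x j) = d - j" "gdist E (x d) (x (Suc j)) = d - Suc j"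
    using j gdist_path by auto
  have dist: "gdist E (x 0) (c p) = h (x 0) + cycle_dist k (\<rho> (x 0)) p" "gdist E (x d) (c p) = h (x d) + cycle_dist k (\<rho> (x d)) p"
    "cycle_dist k (\<rho> (x 0)) p \<le> half" "cycle_dist k (\<rho> (x d)) p \<le> half"
    if "p < k" for p
    using grown_gdist_c[OF grown that] xV cycle_dist_le grown_\<rho>[OF grown] that by auto
  consider "x j = c i" "x (Suc j) = c (Suc i mod k)" | "x (Suc j) = c i" "x j = c (Suc i mod k)"
    using i(2) by (auto simp: doubleton_eq_iff)
  then have "j < h (x 0) + half \<and> d - 1 - j < h (x d) + half \<and>
    ((x j = c i \<and> x (Suc j) = c (Suc i mod k) \<and>
      h (x 0) + half \<le> W (i + k - half + 1) \<and> h (x d) + half \<le> W (Suc i)) \<or>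
     (x (Suc j) = c i \<and> x j = c (Suc i mod k) \<and>
      h (x d) + half \<le> W (i + k - half + 1) \<and> h (x 0) + half \<le> W (Suc i)))"
  proof cases
    case 1
    have "x 0 \<in> bwd i" "x d \<in> fwd i" using gd[unfolded 1] dist[OF i(1)] dist[OF i(3)] i(1) xV[of 0] xV[of d] j by simp_all
    then have "h (x 0) + half \<le> W (i + k - half + 1)" "h (x d) + half \<le> W (Suc i)"
      using class_in_side[of "x 0" "bwd i" i] class_in_side[of "x d" "fwd i" i] xV
      unfolding card_fwd card_bwd by auto
    moreover have "j < h (x 0) + half" "d - 1 - j < h (x d) + half"
      using gd[unfolded 1] dist[OF i(1)] dist[OF i(3)] j by linarith+
    ultimately show ?thesis using 1 by blast
  next
    case 2
    have "x d \<in> bwd i" "x 0 \<in> fwd i" using gd[unfolded 2] dist[OF i(1)] dist[OF i(3)] i(1) xV[of 0] xV[of d] j by simp_all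
    then have "h (x d) + half \<le> W (i + k - half + 1)" "h (x 0) + half \<le> W (Suc i)"
      using class_in_side[of "x d" "bwd i" i] class_in_side[of "x 0" "fwd i" i] xV
      unfolding card_fwd card_bwd by auto
    moreover have "j < h (x 0) + half" "d - 1 - j < h (x d) + half"
      using gd[unfolded 2] dist[OF i(1)] dist[OF i(3)] j by linarith+
    ultimately show ?thesis using 2 by blast
  qed
  then show "j < h (x 0) + half" "d - 1 - j < h (x d) + half"
    "(x j = c (idx j) \<and> x (Suc j) = c (Suc (idx j) mod k) \<and>
      h (x 0) + half \<le> W (idx j + k - half + 1) \<and> h (x d) + half \<le> W (Suc (idx j))) \<or>
     (x (Suc j) = c (idx j) \<and> x j = c (Suc (idx j) mod k) \<and>
      h (x d) + half \<le> W (idx j + k - half + 1) \<and> h (x 0) + half \<le> W (Suc (idx j)))"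
    unfolding i_def by auto
qed

end

section \<open>The lower bound\<close>

text \<open>For a fixed sum, the product is smallest when the factors are as far apart as the lower
  bound permits.\<close>

lemma mult_ge_of_ge:
  fixes p q m :: int
  assumes "m \<le> p" "m \<le> q"
  shows "m * (p + q - m) \<le> p * q"
proof -
  have "0 \<le> (p - m) * (q - m)" using assms by simp
  then show ?thesis by (simp add: algebra_simps)
qed

text \<open>Here p and q are the sides of an edge of an odd cycle, a is the size of the equidistant
  class and f the weight of the opposite edge. The lower bounds for p q and for f add up to (m + 1)
  (N - m), in which a has cancelled.\<close>

lemma odd_pair_bound:
  fixes p q m a f N :: int
  assumes "m + 1 \<le> p" "m + 1 \<le> q" "0 \<le> m" "p + a + q = N" "(m + 1) * (a + 1) \<le> f"
  shows "m * (N - 1 - m) + N \<le> p * q + f"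
proof -
  have "(m + 1) * (p + q - (m + 1)) \<le> p * q" using mult_ge_of_ge[of "m + 1" p q] assms by simp
  moreover have "p + q = N - a" using assms by simp
  ultimately have "(m + 1) * (N - a - (m + 1)) + (m + 1) * (a + 1) \<le> p * q + f" using assms(5) by simp
  then show ?thesis by (simp add: algebra_simps)
qed

text \<open>On an even cycle opposite edges have equal weight, hence the factor 2, and both are
  tied, hence N - 2. For positive m the slack is at least
  \<open>(m - 1) * (N - 4 - m)\<close>.\<close>

lemma even_pair_bound:
  fixes p q m N :: int
  assumes "m \<le> p" "m \<le> q" "1 \<le> p" "1 \<le> q" "0 \<le> m" "p + q = N - 2" "6 \<le> N"
  shows "m * (N - 1 - m) + N - 4 \<le> 2 * (p * q)"
proof (cases "m = 0")
  case True
  then show ?thesis using mult_ge_of_ge[of 1 p q] assms by simp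
next
  case False
  have "0 \<le> (m - 1) * (N - 4 - m)" using assms False by (intro mult_nonneg_nonneg) auto
  moreover have "m * (N - 2 - m) \<le> p * q" using mult_ge_of_ge[of m p q] assms by simp
  ultimately show ?thesis by (simp add: algebra_simps)
qed

text \<open>The slack over the stronger bound is at least \<open>(m + 1) * (N - 6 - m)\<close>. This
  can be negative only for N = 6 and m = 1, where it equals -2; hence the two versions.\<close>

lemma even_pair_bound_strict:
  fixes p q m N :: int
  assumes "m + 1 \<le> p" "m + 1 \<le> q" "0 \<le> m" "p + q = N - 2" "6 \<le> N"
  shows "m * (N - 1 - m) + N - 2 \<le> 2 * (p * q)"
    and "m = 0 \<or> 7 \<le> N \<Longrightarrow> m * (N - 1 - m) + N \<le> 2 * (p * q)"
proof -
  have "p + q - (m + 1) = N - 3 - m" using assms by simp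
  then have pq: "(m + 1) * (N - 3 - m) \<le> p * q" using mult_ge_of_ge[OF assms(1,2)] by (simp only:)
  have id: "2 * ((m + 1) * (N - 3 - m)) = m * (N - 1 - m) + N + (m + 1) * (N - 6 - m)" by (simp add: algebra_simps)
  show 1: "m * (N - 1 - m) + N \<le> 2 * (p * q)" if "m = 0 \<or> 7 \<le> N"
  proof -
    have "0 \<le> (m + 1) * (N - 6 - m)" using that assms by (intro mult_nonneg_nonneg) auto
    then show ?thesis using pq id by linarith
  qed
  show "m * (N - 1 - m) + N - 2 \<le> 2 * (p * q)"
  proof (cases "m = 0 \<or> 7 \<le> N")
    case False
    then have "N = 6" "m = 1" using assms by auto
    then show ?thesis using pq by simp
  qed (use 1 in simp)
qed

section \<open>Pairing shared edges with their opposites\<close>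

locale extremal_path = grown_path +
  assumes d3: "3 \<le> d" and nd: "d + 2 \<le> card V" and n6: "6 \<le> card V"
begin

text \<open>\<open>F p\<close> is the weight of a bridge with p edges on one side, and \<open>\<mu> j\<close> is a lower bound for the number
  of edges on either side of the j-th edge of the path.\<close>
definition F :: "nat \<Rightarrow> int" where "F p = int p * (int n - 1 - int p)"
definition \<mu> :: "nat \<Rightarrow> nat" where "\<mu> j = min j (d - 1 - j)"
abbreviation "b \<equiv> (d - 1) div 2"
text \<open>On an odd cycle two edges are opposite to edge i; the one starting at the equidistant
  vertex is chosen.\<close>

abbreviation "opp i \<equiv> (i + (k - half)) mod k"
definition g :: "nat \<Rightarrow> int" where "g i = int (edge_weight E (cyc_edge i))"
definition pair_weight :: "nat \<Rightarrow> int" where "pair_weight j = g (idx j) + g (opp (idx j))"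

lemma mu_le_b: "\<mu> j \<le> b" unfolding \<mu>_def by (auto simp: min_def)

lemma b_pos: "1 \<le> b" using d3 by simp

lemma g_nonneg: "0 \<le> g i" by (simp add: g_def)

lemma bridge_weight_ge:
  assumes "j < d" "j \<notin> J"
  shows "F (\<mu> j) \<le> int (edge_weight E (path_edge j))"
proof -
  have e: "path_edge j \<in> E" "path_edge j \<notin> EC" using assms xE by (auto simp: J_def)
  have "x j \<noteq> x (Suc j)" using x_inj[of j "Suc j"] assms by simp
  then have *: "edge_weight E (path_edge j) = m_edge E (x j) (x (Suc j)) * m_edge E (x (Suc j)) (x j)"
    by (rule edge_weight_doubleton)
  have "int (\<mu> j) \<le> int (m_edge E (x j) (x (Suc j)))" "int (\<mu> j) \<le> int (m_edge E (x (Suc j)) (x j))"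
    using path_m_lower[OF assms(1)] by (auto simp: \<mu>_def)
  from mult_ge_of_ge[OF this]
  have "int (\<mu> j) * (int (m_edge E (x j) (x (Suc j)) + m_edge E (x (Suc j)) (x j)) - int (\<mu> j))
      \<le> int (edge_weight E (path_edge j))" unfolding * by simp
  moreover have "int (m_edge E (x j) (x (Suc j)) + m_edge E (x (Suc j)) (x j)) = int n - 1"
    using grown_bridge_m[OF grown e] by simp
  ultimately show ?thesis by (simp add: F_def)
qed

lemma opp_less: "opp i < k" using k by simp

lemma opp_inj: "inj_on opp {..<k}"
  using inj_on_mod_offset[of "k - half" k] by (simp add: add.commute)

lemma opp_neq: "i < k \<Longrightarrow> opp i \<noteq> i"
proof
  assume i: "i < k" "opp i = i"
  then have "(i + (k - half)) mod k = (i + 0) mod k" by simp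
  then show False using inj_onD[OF inj_on_mod_offset[of i k], of "k - half" 0] k by auto
qed

text \<open>The distances between the ends of two edges of a geodesic differ by as much as 2, those between
  the ends of opposite edges of the cycle by at most 1.\<close>
lemma opp_not_on_path:
  assumes "j \<in> J" "j' \<in> J"
  shows "idx j' \<noteq> opp (idx j)"
proof
  assume eq: "idx j' = opp (idx j)"
  define i \<delta> where "i = idx j" and "\<delta> = k - half"
  have i: "i < k" using idx(1)[OF assms(1)] by (simp add: i_def)
  have \<delta>: "\<delta> < k" using k by (auto simp: \<delta>_def)
  have q: "Suc ((i + \<delta>) mod k) mod k = Suc (i + \<delta>) mod k" by (simp add: mod_Suc_eq)
  have im: "i mod k = i" using i by simp
  have near: "half \<le> Suc (gdist E p q) \<and> gdist E p q \<le> half" if "p \<in> path_edge j'" "q \<in> path_edge j" for p q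
  proof -
    have "p \<in> {c ((i + \<delta>) mod k), c (Suc (i + \<delta>) mod k)}" "q \<in> {c i, c (Suc i mod k)}"
      using that idx(2)[OF assms(1)] idx(2)[OF assms(2)] eq q by (auto simp: i_def \<delta>_def)
    then have "gdist E p q \<in> {cycle_dist k ((i + \<delta>) mod k) (i mod k), cycle_dist k ((i + \<delta>) mod k) (Suc i mod k),
        cycle_dist k (Suc (i + \<delta>) mod k) (i mod k), cycle_dist k (Suc (i + \<delta>) mod k) (Suc i mod k)}"
      using gdist_cc i k unfolding im by auto
    moreover have "cycle_dist k ((i + \<delta>) mod k) (i mod k) = half" unfolding cycle_dist_offset[OF \<delta>] using \<delta>_def by auto
    moreover have "cycle_dist k ((i + \<delta>) mod k) (Suc i mod k) \<in> {half - 1, half}"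
      unfolding cycle_dist_offset_Suc[OF \<delta>] insert_iff using \<delta>_def k by (simp add: min_def; linarith)
    moreover have "cycle_dist k (Suc (i + \<delta>) mod k) (i mod k) \<in> {half - 1, half}"
      unfolding cycle_dist_Suc_offset[OF \<delta>] insert_iff using \<delta>_def k by (simp add: min_def; linarith)
    moreover have "cycle_dist k (Suc (i + \<delta>) mod k) (Suc i mod k) = half"
      unfolding cycle_dist_Suc_offset_Suc[OF \<delta>] using \<delta>_def by auto
    ultimately show ?thesis by (auto; linarith)
  qed
  have jd: "j < d" "j' < d" using assms J_less by auto
  have "j \<noteq> j'" using eq opp_neq[OF i] i_def by auto
  then consider "j < j'" | "j' < j" by linarith
  then show False
  proof cases
    case 1
    then have "gdist E (x j') (x (Suc j)) = j' - Suc j" "gdist E (x (Suc j')) (x j) = Suc j' - j"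
      using x_dist[of "Suc j" j'] x_dist[of j "Suc j'"] jd by (simp_all add: gdist_sym)
    then show ?thesis using near[of "x j'" "x (Suc j)"] near[of "x (Suc j')" "x j"] 1 by simp linarith
  next
    case 2
    then have "gdist E (x (Suc j')) (x j) = j - Suc j'" "gdist E (x j') (x (Suc j)) = Suc j - j'"
      using x_dist[of "Suc j'" j] x_dist[of j' "Suc j"] jd by simp_all
    then show ?thesis using near[of "x (Suc j')" "x j"] near[of "x j'" "x (Suc j)"] 2 by simp linarith
  qed
qed

definition rest :: "nat set" where "rest = {..<k} - idx ` J - opp ` idx ` J"

lemma rest_sub: "rest \<subseteq> {..<k}" and fin_rest: "finite rest" by (auto simp: rest_def)

text \<open>No opposite of a shared edge is itself shared, so the shared edges and their opposites
  form two disjoint sets of equal size.\<close>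

lemma cycle_split:
  "(\<Sum>i<k. g i) = (\<Sum>j\<in>J. pair_weight j) + sum g rest"
  "k = 2 * card J + card rest"
proof -
  have I: "idx ` J \<subseteq> {..<k}" using idx(1) by auto
  have O: "opp ` idx ` J \<subseteq> {..<k}" using opp_less by auto
  have dj: "idx ` J \<inter> opp ` idx ` J = {}" using opp_not_on_path by auto
  have injO: "inj_on opp (idx ` J)" using inj_on_subset[OF opp_inj I] .
  have un: "{..<k} = (idx ` J \<union> opp ` idx ` J) \<union> rest" using I O by (auto simp: rest_def)
  have dr: "(idx ` J \<union> opp ` idx ` J) \<inter> rest = {}" by (auto simp: rest_def)
  have fJ: "finite (idx ` J)" "finite (opp ` idx ` J)" using finJ by auto
  have "(\<Sum>i<k. g i) = (sum g (idx ` J) + sum g (opp ` idx ` J)) + sum g rest"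
    unfolding un using fJ fin_rest dj dr by (simp add: sum.union_disjoint)
  also have "sum g (idx ` J) = (\<Sum>j\<in>J. g (idx j))" using sum.reindex[OF idx_inj] by simp
  also have "sum g (opp ` idx ` J) = (\<Sum>j\<in>J. g (opp (idx j)))"
    using sum.reindex[OF injO, of g] sum.reindex[OF idx_inj, of "\<lambda>i. g (opp i)"] by (simp add: comp_def)
  finally show "(\<Sum>i<k. g i) = (\<Sum>j\<in>J. pair_weight j) + sum g rest"
    by (simp add: sum.distrib pair_weight_def)
  have "card {..<k} = (card (idx ` J) + card (opp ` idx ` J)) + card rest"
    unfolding un using fJ fin_rest dj dr by (simp add: card_Un_disjoint)
  then show "k = 2 * card J + card rest"
    using card_image[OF idx_inj] card_image[OF injO] by simp
qed

text \<open>The side behind edge i has the size of the side in front of the opposite edge.\<close>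

lemma W_opp: "W (i + k - half + 1) = W (Suc (opp i))"
  using W_mod[of "Suc (i + (k - half))"] W_mod[of "Suc (opp i)"] k by (simp add: mod_Suc_eq)

lemma W_opp': "W (Suc (opp i)) = W (Suc (i + (k - half)))"
  using W_mod[of "Suc (i + (k - half))"] W_mod[of "Suc (opp i)"] by (simp add: mod_Suc_eq)

text \<open>Passing to the opposite edge twice returns to edge i on an even cycle, but advances by
  one edge on an odd cycle.\<close>

lemma W_opp_opp: "W (Suc (opp (opp i))) = (if even k then W (Suc i) else W (Suc (Suc i)))"
proof -
  have "W (Suc (opp (opp i))) = W (Suc (opp i + (k - half)))" by (rule W_opp')
  also have "\<dots> = W (Suc (i + (k - half) + (k - half)))"
    using W_mod[of "Suc (opp i + (k - half))"] W_mod[of "Suc (i + (k - half) + (k - half))"]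
    by (metis mod_Suc_eq mod_add_left_eq)
  also have "\<dots> = (if even k then W (Suc i) else W (Suc (Suc i)))"
  proof (cases "even k")
    case True
    then have "Suc (i + (k - half) + (k - half)) = Suc i + k" by (auto elim!: evenE)
    then show ?thesis using True W_period[of "Suc i"] by simp
  next
    case False
    then have "Suc (i + (k - half) + (k - half)) = Suc (Suc i) + k" by (auto elim!: oddE)
    then show ?thesis using False W_period[of "Suc (Suc i)"] by simp
  qed
  finally show ?thesis .
qed

lemma sum_A_le:
  assumes "S \<subseteq> {..<k}"
  shows "(\<Sum>i\<in>S. A (i + m)) \<le> n"
proof -
  have "(\<Sum>i\<in>S. A (i + m)) \<le> (\<Sum>i<k. A (m + i))"
    using assms sum_mono2[of "{..<k}" S "\<lambda>i. A (m + i)"] by (simp add: add.commute)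
  then show ?thesis using sum_A by simp
qed

lemma path_side':
  assumes "j \<in> J"
  shows "j < h (x 0) + half" "d - 1 - j < h (x d) + half"
    "(h (x 0) + half \<le> W (Suc (opp (idx j))) \<and> h (x d) + half \<le> W (Suc (idx j))) \<or>
     (h (x d) + half \<le> W (Suc (opp (idx j))) \<and> h (x 0) + half \<le> W (Suc (idx j)))"
  using path_side[OF assms] unfolding W_opp by auto

lemma mu_less_W:
  assumes "j \<in> J"
  shows "\<mu> j + 1 \<le> W (Suc (idx j))" "\<mu> j + 1 \<le> W (Suc (opp (idx j)))"
proof -
  have "\<mu> j + 1 \<le> h (x 0) + half" "\<mu> j + 1 \<le> h (x d) + half"
    using path_side'(1,2)[OF assms] unfolding \<mu>_def by linarith+
  then show "\<mu> j + 1 \<le> W (Suc (idx j))" "\<mu> j + 1 \<le> W (Suc (opp (idx j)))"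
    using path_side'(3)[OF assms] by auto
qed

end

section \<open>Odd cycles\<close>

locale odd_extremal = extremal_path +
  assumes odd: "odd k"
begin

lemma k_odd: "k = 2 * half + 1" using odd by simp

lemma W_total: "W (Suc i) + A (i + (k - half)) + W (Suc (opp i)) = n"
proof -
  have "(\<Sum>\<delta><k. A (Suc i + \<delta>)) = (\<Sum>\<delta><half + (1 + half). A (Suc i + \<delta>))"
    by (rule sum.cong) (use k_odd in auto)
  also have "\<dots> = W (Suc i) + (A (Suc i + half) + (\<Sum>\<delta><half. A (Suc i + (half + (1 + \<delta>)))))"
    by (subst sum_lessThan_add, subst sum_lessThan_add) (simp add: W_def)
  also have "(\<Sum>\<delta><half. A (Suc i + (half + (1 + \<delta>)))) = W (Suc (i + (k - half)))"
    unfolding W_def by (rule sum.cong[OF refl], rule arg_cong[of _ _ A], use k_odd in linarith)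
  also have "Suc i + half = i + (k - half)" using k_odd by simp
  finally show ?thesis using sum_A[of "Suc i"] W_opp'[of i] by simp
qed

lemma g_odd: "i < k \<Longrightarrow> g i = int (W (Suc i)) * int (W (Suc (opp i)))"
  using cyc_weight odd W_opp by (simp add: g_def)

text \<open>The product of two positive integers is at least their sum minus 1, and the sum misses
  only the equidistant class.\<close>

lemma g_odd_ge:
  assumes "i < k"
  shows "int n - 1 - int (A (i + (k - half))) \<le> g i"
proof -
  have "1 \<le> int (W (Suc i))" "1 \<le> int (W (Suc (opp i)))" using W_ge[of "Suc i"] W_ge[of "Suc (opp i)"] k by linarith+
  from mult_ge_of_ge[OF this] show ?thesis using g_odd[OF assms] W_total[of i] by simp
qed

lemma g_opp_odd: "i < k \<Longrightarrow> g (opp i) = int (W (Suc (opp i))) * int (W (Suc (Suc i)))"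
  using g_odd[OF opp_less, of i] W_opp_opp[of i] odd by simp

text \<open>Different edges miss different classes, so all these losses together amount to at most
  n.\<close>

lemma rest_odd_ge: "int (card rest) * (int n - 1) - int n \<le> sum g rest"
proof -
  have "(\<Sum>i\<in>rest. int n - 1 - int (A (i + (k - half)))) \<le> sum g rest"
    using rest_sub g_odd_ge by (intro sum_mono) auto
  moreover have "(\<Sum>i\<in>rest. int (A (i + (k - half)))) \<le> int n"
    using sum_A_le[OF rest_sub, of "k - half"] by (simp flip: of_nat_sum)
  ultimately show ?thesis by (simp add: sum_subtractf)
qed

text \<open>The class opposite to the edge is lost for this edge but counts in full for the opposite edge,
  whose other side is at least as large as the path forces.\<close>
lemma pair_odd_ge:
  assumes "j \<in> J" "5 \<le> k"
  shows "F (\<mu> j) + int n \<le> pair_weight j"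
proof -
  define i where "i = idx j"
  have i: "i < k" using idx(1)[OF assms(1)] by (simp add: i_def)
  \<comment> \<open>With at least two classes per side, a side of the opposite edge contains the
    missed class and one more vertex. In a triangle it would be the missed class alone.\<close>
  have half: "2 \<le> half" using assms by simp
  have "W (Suc (Suc i)) = (\<Sum>\<delta><(half - 1) + 1. A (Suc (Suc i) + \<delta>))" unfolding W_def using half by simp
  also have "\<dots> = (\<Sum>\<delta><half - 1. A (Suc (Suc i) + \<delta>)) + A (Suc (Suc i) + (half - 1))"
    by (subst sum_lessThan_add) simp
  also have "Suc (Suc i) + (half - 1) = i + (k - half)" using half k_odd by linarith
  finally have "W (Suc (Suc i)) = (\<Sum>\<delta><half - 1. A (Suc (Suc i) + \<delta>)) + A (i + (k - half))" .
  moreover have "half - 1 \<le> (\<Sum>\<delta><half - 1. A (Suc (Suc i) + \<delta>))"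
    using sum_mono[of "{..<half - 1}" "\<lambda>_. 1" "\<lambda>\<delta>. A (Suc (Suc i) + \<delta>)"] A_pos by simp
  ultimately have W2: "A (i + (k - half)) + 1 \<le> W (Suc (Suc i))" using half by linarith
  have "(int (\<mu> j) + 1) * (int (A (i + (k - half))) + 1) \<le> g (opp i)"
    unfolding g_opp_odd[OF i] using mu_less_W[OF assms(1)] W2 by (intro mult_mono) (auto simp: i_def)
  from odd_pair_bound[OF _ _ _ _ this, of "int (W (Suc i))" "int (W (Suc (opp i)))" "int n"]
  show ?thesis using mu_less_W[OF assms(1)] W_total[of i] g_odd[OF i] by (simp add: F_def i_def pair_weight_def)
qed

lemma odd5_bound:
  assumes "5 \<le> k"
  shows "(\<Sum>j\<in>J. F (\<mu> j)) + 2 * int n - 3 - 2 * int b < (\<Sum>i<k. g i)"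
proof -
  have "(\<Sum>j\<in>J. F (\<mu> j) + int n) \<le> (\<Sum>j\<in>J. pair_weight j)"
    using pair_odd_ge[OF _ assms] by (intro sum_mono)
  then have 1: "(\<Sum>j\<in>J. F (\<mu> j)) + int (card J) * int n + sum g rest \<le> (\<Sum>i<k. g i)"
    unfolding cycle_split(1) by (simp add: sum.distrib)
  have b: "1 \<le> int b" "6 \<le> int n" using b_pos n6 by linarith+
  have r0: "0 \<le> sum g rest" using g_nonneg by (intro sum_nonneg)
  \<comment> \<open>With at most one shared edge the unpaired edges supply the missing weight; two
    pairs already gain 2n by themselves.\<close>
  consider "card J = 0" | "card J = 1" | "2 \<le> card J" by linarith
  then show ?thesis
  proof cases
    case 1
    then have "5 * (int n - 1) \<le> int (card rest) * (int n - 1)"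
      using cycle_split(2) assms n6 by (intro mult_right_mono) auto
    then show ?thesis using \<open>_ \<le> (\<Sum>i<k. g i)\<close> 1 rest_odd_ge b n6 by simp
  next
    case 2
    then have "3 * (int n - 1) \<le> int (card rest) * (int n - 1)"
      using cycle_split(2) assms n6 by (intro mult_right_mono) auto
    then show ?thesis using 1 2 rest_odd_ge b n6 by simp
  next
    case 3
    then have "2 * int n \<le> int (card J) * int n" by (intro mult_right_mono) auto
    then show ?thesis using 1 r0 b by linarith
  qed
qed

end

section \<open>Even cycles\<close>

locale even_extremal = extremal_path +
  assumes even: "even k"
begin

lemma k_even: "k = 2 * half" using even by simp

lemma half_ge_2: "2 \<le> half" using k_even k by linarith

lemma W_total: "W (Suc i) + W (Suc (opp i)) = n"
proof -
  have "(\<Sum>\<delta><k. A (Suc i + \<delta>)) = (\<Sum>\<delta><half + half. A (Suc i + \<delta>))"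
    by (rule sum.cong) (use k_even in auto)
  also have "\<dots> = W (Suc i) + (\<Sum>\<delta><half. A (Suc i + (half + \<delta>)))"
    by (subst sum_lessThan_add) (simp add: W_def)
  also have "(\<Sum>\<delta><half. A (Suc i + (half + \<delta>))) = W (Suc (i + (k - half)))"
    unfolding W_def by (rule sum.cong[OF refl], rule arg_cong[of _ _ A], use k_even in linarith)
  finally show ?thesis using sum_A[of "Suc i"] W_opp'[of i] by simp
qed

lemma g_even: "i < k \<Longrightarrow> g i = (int (W (Suc i)) - 1) * (int (W (Suc (opp i))) - 1)"
  using cyc_weight[of i] even W_opp[of i] W_ge[of "Suc i"] W_ge[of "Suc (opp i)"] half_ge_2 by (simp add: g_def of_nat_diff)

lemma g_even_ge:
  assumes "i < k"
  shows "int n - 3 \<le> g i"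
proof -
  have "1 \<le> int (W (Suc i)) - 1" "1 \<le> int (W (Suc (opp i))) - 1"
    using W_ge[of "Suc i"] W_ge[of "Suc (opp i)"] half_ge_2 by linarith+
  from mult_ge_of_ge[OF this] show ?thesis using g_even[OF assms] W_total[of i] by simp
qed

lemma g_opp_even: "i < k \<Longrightarrow> g (opp i) = g i"
  using g_even[OF opp_less, of i] W_opp_opp[of i] even g_even[of i] by (simp add: mult.commute)

text \<open>The sides are now named after the path instead of the numbering of the cycle: p belongs
  to the side of \<open>x 0\<close>, q to that of \<open>x d\<close>.\<close>

lemma pair_even:
  assumes "j \<in> J"
  obtains p q :: int where "pair_weight j = 2 * (p * q)" "p + q = int n - 2"
    "int (h (x 0) + half) - 1 \<le> p" "int (h (x d) + half) - 1 \<le> q"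
proof -
  define p q where "p = int (W (Suc (idx j))) - 1" and "q = int (W (Suc (opp (idx j)))) - 1"
  have i: "idx j < k" using idx(1)[OF assms] .
  have pq: "pair_weight j = 2 * (p * q)" "p + q = int n - 2"
    using g_opp_even[OF i] g_even[OF i] W_total[of "idx j"] by (simp_all add: p_def q_def pair_weight_def)
  show ?thesis
    using path_side'(3)[OF assms]
  proof
    assume "h (x 0) + half \<le> W (Suc (opp (idx j))) \<and> h (x d) + half \<le> W (Suc (idx j))"
    then show ?thesis using that[of q p] pq by (simp add: p_def q_def mult.commute)
  next
    assume "h (x d) + half \<le> W (Suc (opp (idx j))) \<and> h (x 0) + half \<le> W (Suc (idx j))"
    then show ?thesis using that[of p q] pq by (simp add: p_def q_def)
  qed
qed

lemma pair_even_ge: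
  assumes "j \<in> J"
  shows "F (\<mu> j) + int n - 4 \<le> pair_weight j"
proof -
  from pair_even[OF assms] obtain p q :: int where pq: "pair_weight j = 2 * (p * q)" "p + q = int n - 2"
    "int (h (x 0) + half) - 1 \<le> p" "int (h (x d) + half) - 1 \<le> q" .
  show ?thesis unfolding pq(1) F_def
    by (rule even_pair_bound) (use path_side'(1,2)[OF assms] pq(2-4) half_ge_2 n6 in \<open>auto simp: \<mu>_def\<close>)
qed

text \<open>On a bad edge of the path one side is exactly as small as the path allows. Such an edge is the
  first or last one that the path shares with the cycle, and there is at most one.\<close>
definition bad :: "nat \<Rightarrow> bool" where
  "bad j \<longleftrightarrow> j + 1 = h (x 0) + half \<and> \<mu> j = j \<or> d - j = h (x d) + half \<and> \<mu> j = d - 1 - j"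

lemma pair_even_good:
  assumes "j \<in> J" "\<not> bad j"
  shows "F (\<mu> j) + int n - 2 \<le> pair_weight j"
    "\<mu> j = 0 \<or> 7 \<le> n \<Longrightarrow> F (\<mu> j) + int n \<le> pair_weight j"
proof -
  from pair_even[OF assms(1)] obtain p q :: int where pq: "pair_weight j = 2 * (p * q)" "p + q = int n - 2"
    "int (h (x 0) + half) - 1 \<le> p" "int (h (x d) + half) - 1 \<le> q" .
  have *: "min j e + 1 < L \<and> min j e + 1 < R"
    if "j < L" "e < R" "\<not> (j + 1 = L \<and> min j e = j \<or> e + 1 = R \<and> min j e = e)" for L R e
    using that by linarith
  have "d - j = d - 1 - j + 1" using J_less[OF assms(1)] by simp
  then have "\<mu> j + 1 < h (x 0) + half" "\<mu> j + 1 < h (x d) + half"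
    using *[of "h (x 0) + half" "d - 1 - j" "h (x d) + half"] assms(2) path_side'(1,2)[OF assms(1)]
    unfolding bad_def \<mu>_def by auto
  then have "int (\<mu> j) + 1 \<le> p" "int (\<mu> j) + 1 \<le> q" using pq by linarith+
  note B = even_pair_bound_strict[OF this of_nat_0_le_iff pq(2)]
  have "6 \<le> int n" using n6 by simp
  with B show "F (\<mu> j) + int n - 2 \<le> pair_weight j"
    "\<mu> j = 0 \<or> 7 \<le> n \<Longrightarrow> F (\<mu> j) + int n \<le> pair_weight j"
    unfolding pq(1) F_def by simp_all
qed

text \<open>If j is bad because \<open>j + 1\<close> attains its largest possible value
  \<open>h (x 0) + half\<close>, every other shared index is smaller than j and thus nearer to the
  end of the path from which \<mu> is measured. The other kind of badness is symmetric.\<close>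

lemma bad_other:
  assumes "j \<in> J" "j' \<in> J" "bad j" "j' \<noteq> j"
  shows "\<not> bad j'" "\<mu> j' < \<mu> j"
proof -
  have *: "\<not> (j' + 1 = L \<and> min j' e' = j' \<or> e' + 1 = R \<and> min j' e' = e') \<and> min j' e' < min j e"
    if "j + e = j' + e'" "j < L" "e < R" "j' < L" "e' < R"
      "j + 1 = L \<and> min j e = j \<or> e + 1 = R \<and> min j e = e" for L R e e'
  proof -
    have "j + 1 = L \<and> j' < j \<and> e < e' \<and> j \<le> e \<or> e + 1 = R \<and> e' < e \<and> j < j' \<and> e \<le> j"
      using that assms(4) by linarith
    then show ?thesis using that by auto
  qed
  have d: "d - j = d - 1 - j + 1" "d - j' = d - 1 - j' + 1" "j + (d - 1 - j) = j' + (d - 1 - j')"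
    using J_less[OF assms(1)] J_less[OF assms(2)] by simp_all
  show "\<not> bad j'" "\<mu> j' < \<mu> j"
    using *[OF d(3) path_side'(1,2)[OF assms(1)] path_side'(1,2)[OF assms(2)]
        assms(3)[unfolded bad_def \<mu>_def d]]
    unfolding bad_def \<mu>_def d by blast+
qed

text \<open>A bad pair is only known to gain n - 4, but then the other pair is good and gains n; two
  good pairs gain n - 2 each.\<close>

lemma two_pairs:
  assumes "j1 \<in> J" "j2 \<in> J" "j1 \<noteq> j2"
  shows "F (\<mu> j1) + F (\<mu> j2) + 2 * int n - 4 \<le>
    pair_weight j1 + pair_weight j2"
proof -
  have one_bad: "F (\<mu> i) + F (\<mu> j) + 2 * int n - 4 \<le> pair_weight i + pair_weight j"
    if "i \<in> J" "j \<in> J" "i \<noteq> j" "bad j" for i j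
  proof -
    \<comment> \<open>This excludes the boundary case n = 6, \<open>\<mu> i\<close> = 1: either d is
      at most 4 and \<open>\<mu> i\<close> = 0, or d is at least 5 and so n is at least 7.\<close>
    have "\<mu> i < b" using bad_other(2)[OF that(2,1,4,3)] mu_le_b[of j] by simp
    then have "\<mu> i = 0 \<or> 5 \<le> d" by linarith
    then have "\<mu> i = 0 \<or> 7 \<le> n" using nd by auto
    then show ?thesis
      using pair_even_good(2)[OF that(1) bad_other(1)[OF that(2,1,4,3)]] pair_even_ge[OF that(2)] by linarith
  qed
  consider "bad j1" | "bad j2" | "\<not> bad j1" "\<not> bad j2" by blast
  then show ?thesis
  proof cases
    case 1
    then show ?thesis using one_bad[of j2 j1] assms by simp
  next
    case 2
    then show ?thesis using one_bad[of j1 j2] assms by simp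
  next
    case 3
    then show ?thesis using pair_even_good(1)[of j1] pair_even_good(1)[of j2] assms by linarith
  qed
qed

lemma even_bound: "(\<Sum>j\<in>J. F (\<mu> j)) + 2 * int n - 3 - 2 * int b < (\<Sum>i<k. g i)"
proof -
  let ?p = pair_weight
  have b: "1 \<le> int b" "6 \<le> int n" using b_pos n6 by linarith+
  have "(\<Sum>i\<in>rest. int n - 3) \<le> sum g rest"
    using rest_sub g_even_ge by (intro sum_mono) auto
  then have r: "int (card rest) * (int n - 3) \<le> sum g rest" by simp
  have pairs: "(\<Sum>j\<in>S. F (\<mu> j)) + int (card S) * (int n - 4) \<le> sum ?p S" if "S \<subseteq> J" for S
  proof -
    have "(\<Sum>j\<in>S. F (\<mu> j) + int n - 4) \<le> sum ?p S" using that pair_even_ge by (intro sum_mono) auto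
    then show ?thesis by (simp add: sum.distrib sum_subtractf algebra_simps)
  qed
  have even_rest: "even (card rest)" using cycle_split(2) even by (metis dvd_add_right_iff dvd_triv_left)
  \<comment> \<open>The number of unpaired edges is even, so if there are any, there are at least
    two, which supply the missing weight. If there are none, at least two edges are shared and
    \<open>two_pairs\<close> applies.\<close>
  consider "card J = 0" | "1 \<le> card J" "card rest \<noteq> 0" | "card rest = 0" by linarith
  then show ?thesis
  proof cases
    case 1
    then have "4 * (int n - 3) \<le> int (card rest) * (int n - 3)"
      using cycle_split(2) half_ge_2 n6 by (intro mult_right_mono) auto
    then show ?thesis unfolding cycle_split(1) using 1 r b n6 finJ by simp
  next
    case 2
    then have "2 * (int n - 3) \<le> int (card rest) * (int n - 3)"
      using even_rest n6 by (intro mult_right_mono) (auto elim!: evenE)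
    moreover have "int n - 4 \<le> int (card J) * (int n - 4)"
      using 2 n6 mult_right_mono[of 1 "int (card J)" "int n - 4"] by simp
    moreover have "S + 2 * N - 3 - 2 * B < P + R"
      if "2 * (N - 3) \<le> R'" "N - 4 \<le> C" "S + C \<le> P" "R' \<le> R" "1 \<le> B" "6 \<le> N" for S N B P R R' C :: int
      using that by presburger
    ultimately show ?thesis unfolding cycle_split(1) using pairs[OF order_refl] r b by blast
  next
    case 3
    then have "2 \<le> card J" using cycle_split(2) half_ge_2 by linarith
    then obtain j1 j2 where j: "j1 \<in> J" "j2 \<in> J" "j1 \<noteq> j2"
      by (metis card_le_Suc0_iff_eq finJ not_less_eq_eq numeral_2_eq_2)
    have split: "sum f J = f j1 + f j2 + sum f (J - {j1, j2})" for f :: "nat \<Rightarrow> int"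
      using j finJ by (simp add: sum.remove[of J j1] sum.remove[of "J - {j1}" j2] Diff_insert2[symmetric] insert_commute)
    have C: "0 \<le> int (card (J - {j1, j2})) * (int n - 4)" using n6 by simp
    have r0: "0 \<le> sum g rest" using r 3 by simp
    have arith: "S1 + S2 + S3 + 2 * N - 3 - 2 * B < G1 + G2 + G3 + R"
      if "0 \<le> C" "S1 + S2 + 2 * N - 4 \<le> G1 + G2" "S3 + C \<le> G3" "0 \<le> R" "1 \<le> B"
      for S1 S2 S3 N B C G1 G2 G3 R :: int
      using that by presburger
    show ?thesis
      unfolding cycle_split(1) split[of ?p] split[of "\<lambda>j. F (\<mu> j)"]
      by (rule arith[OF C two_pairs[OF j] pairs[OF Diff_subset] r0 b(1)])
  qed
qed

end

text \<open>The sum treats all edges of the path as bridges. The remaining terms are the excess over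
  \<open>F b\<close> of a triangle with trees of b + 1, n - 2 - b and 1 vertices, where b = (d - 1)
  div 2.\<close>

definition min_szeged :: "nat \<Rightarrow> nat \<Rightarrow> int" where
  "min_szeged n d = (\<Sum>j<d. int (min j (d - 1 - j)) * (int n - 1 - int (min j (d - 1 - j))))
     + 2 * int n - 3 - 2 * int ((d - 1) div 2)"

text \<open>The excess over the bound is a sum of three nonnegative terms, and equality makes each
  of them vanish. The assumptions on D, the length of the path, make \<open>p + q - m - 2\<close>
  positive, which is what forces z = 1.\<close>

lemma triangle_arith:
  fixes p q z m N D B :: int
  assumes "m + 1 \<le> p" "m + 1 \<le> q" "1 \<le> z" "p + q + z = N" "D + 1 \<le> p + q" "2 * m + 1 \<le> D" "3 \<le> D"
    "0 \<le> m" "m \<le> B"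
  shows "m * (N - 1 - m) + 2 * N - 3 - 2 * B \<le> p * q + z * (p + q)"
    and "p * q + z * (p + q) = m * (N - 1 - m) + 2 * N - 3 - 2 * B \<Longrightarrow>
      z = 1 \<and> m = B \<and> (p = m + 1 \<or> q = m + 1)"
proof -
  have id: "p * q + z * (p + q) - (m * (N - 1 - m) + 2 * N - 3 - 2 * B) =
      (p - m - 1) * (q - m - 1) + (z - 1) * (p + q - m - 2) + 2 * (B - m)"
    using assms(4) by (simp add: algebra_simps flip: assms(4))
  have X: "0 \<le> (p - m - 1) * (q - m - 1)" using assms by simp
  have pos: "0 < p + q - m - 2" using assms by linarith
  then have Y: "0 \<le> (z - 1) * (p + q - m - 2)" using assms(3) by simp
  have "0 \<le> p * q + z * (p + q) - (m * (N - 1 - m) + 2 * N - 3 - 2 * B)"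
    unfolding id using X Y assms(9) by (intro add_nonneg_nonneg) auto
  then show "m * (N - 1 - m) + 2 * N - 3 - 2 * B \<le> p * q + z * (p + q)" by (simp only: diff_ge_0_iff_ge)
  assume "p * q + z * (p + q) = m * (N - 1 - m) + 2 * N - 3 - 2 * B"
  then have sum0: "(p - m - 1) * (q - m - 1) + (z - 1) * (p + q - m - 2) + 2 * (B - m) = 0"
    using id by simp
  have "a = 0 \<and> b = 0 \<and> e = 0" if "a + b + 2 * e = 0" "0 \<le> a" "0 \<le> b" "0 \<le> e" for a b e :: int
    using that by linarith
  from this[OF sum0 X Y] have "(p - m - 1) * (q - m - 1) = 0" "(z - 1) * (p + q - m - 2) = 0" "m = B"
    using assms(9) by auto
  then show "z = 1 \<and> m = B \<and> (p = m + 1 \<or> q = m + 1)" using pos by auto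
qed

section \<open>Triangles\<close>

context odd_extremal
begin

lemma triangle_bound:
  assumes k3: "k = 3"
  shows "(\<Sum>j\<in>J. F (\<mu> j)) + 2 * int n - 3 - 2 * int b \<le> (\<Sum>i<k. g i)" (is "?T \<le> _")
    and "(\<Sum>i<k. g i) = (\<Sum>j\<in>J. F (\<mu> j)) + 2 * int n - 3 - 2 * int b \<Longrightarrow>
      \<exists>j. J = {j} \<and> \<mu> j = b \<and> A (idx j + 2) = 1 \<and> (A (idx j) = b + 1 \<or> A (Suc (idx j)) = b + 1)"
proof -
  have "?T \<le> (\<Sum>i<k. g i) \<and> ((\<Sum>i<k. g i) = ?T \<longrightarrow>
      (\<exists>j. J = {j} \<and> \<mu> j = b \<and> A (idx j + 2) = 1 \<and> (A (idx j) = b + 1 \<or> A (Suc (idx j)) = b + 1)))"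
  proof (cases "card J = 0")
    case True
    \<comment> \<open>If the path shares no edge with the triangle, the three unpaired edges weigh
      at least 3(n - 1) - n = 2n - 3, which is too much.\<close>
    then have "J = {}" using finJ by simp
    moreover have "card rest = 3" using cycle_split(2) k3 True by simp
    ultimately show ?thesis using rest_odd_ge b_pos cycle_split(1) by simp
  next
    case False
    then have "card J = 1" using cycle_split(2) k3 by simp
    then obtain j where j: "J = {j}" by (auto simp: card_1_singleton_iff)
    define i where "i = idx j"
    have jJ: "j \<in> J" using j by simp
    have i: "i < k" using idx(1)[OF jJ] by (simp add: i_def)
    have WA: "W m = A m" for m unfolding W_def using k3 by simp
    have o: "opp i = (i + 2) mod k" for i using k3 by simp
    have q: "W (Suc (opp i)) = A i"
    proof -
      have "W (Suc (opp i)) = A (Suc (i + (k - half)))" using W_opp'[of i] WA by simp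
      also have "Suc (i + (k - half)) = i + k" using k3 by simp
      finally show ?thesis using A_period by simp
    qed
    have g0: "g i = int (A (Suc i)) * int (A i)" using g_odd[OF i] q WA by simp
    have g2: "g (opp i) = int (A i) * int (A (i + 2))" using g_opp_odd[OF i] q WA by simp
    have g1: "g ((i + 1) mod k) = int (A (i + 2)) * int (A (Suc i))"
    proof -
      have "W (Suc ((i + 1) mod k)) = A (i + 2)"
        using W_mod[of "Suc ((i + 1) mod k)"] W_mod[of "i + 2"] WA by (simp add: mod_Suc_eq)
      moreover have "opp ((i + 1) mod k) = i" using i k3 by (simp add: mod_simps)
      ultimately show ?thesis using g_odd[of "(i + 1) mod k"] k WA by simp
    qed
    have set3: "{..<k} = {0, 1, 2}" using k3 by auto
    have "(\<Sum>i<k. g i) = (\<Sum>\<delta><k. g ((i + \<delta>) mod k))"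
      using sum.reindex_bij_betw[OF bij_mod_offset[of i k], of g] by simp
    also have "\<dots> = g (i mod k) + g ((i + 1) mod k) + g ((i + 2) mod k)"
      unfolding set3 by simp
    also have "\<dots> = int (A (Suc i)) * int (A i) + int (A (i + 2)) * (int (A (Suc i)) + int (A i))"
      using g0 g1 g2[unfolded o] mod_less[OF i] by (simp only: distrib_left mult.commute)
    finally have G: "(\<Sum>i<k. g i) = int (A (Suc i)) * int (A i) + int (A (i + 2)) * (int (A (Suc i)) + int (A i))" .
    have half: "half = 1" using k3 by simp
    have "int (\<mu> j) + 1 \<le> int (A (Suc i))" "int (\<mu> j) + 1 \<le> int (A i)"
    proof -
      have "\<mu> j + 1 \<le> A (Suc i)" "\<mu> j + 1 \<le> A i"
        using mu_less_W[OF jJ] q WA unfolding i_def by simp_all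
      then show "int (\<mu> j) + 1 \<le> int (A (Suc i))" "int (\<mu> j) + 1 \<le> int (A i)" by linarith+
    qed
    moreover have "1 \<le> int (A (i + 2))" using A_pos[of "i + 2"] by linarith
    moreover have "int (A (Suc i)) + int (A i) + int (A (i + 2)) = int n"
      using W_total[of i] q WA k3 by simp
    \<comment> \<open>The two trees at the ends of the shared edge have together at least as many
      vertices as the path.\<close>
    moreover have "int d + 1 \<le> int (A (Suc i)) + int (A i)"
    proof -
      have "(h (x 0) + 1 \<le> A i \<and> h (x d) + 1 \<le> A (Suc i)) \<or> (h (x d) + 1 \<le> A i \<and> h (x 0) + 1 \<le> A (Suc i))"
        using path_side'(3)[OF jJ] q unfolding WA half i_def by simp
      then have "h (x 0) + h (x d) + 2 \<le> A (Suc i) + A i" by auto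
      moreover have "j \<le> h (x 0)" "d - 1 - j \<le> h (x d)"
        using path_side'(1,2)[OF jJ] unfolding half by simp_all
      ultimately show ?thesis using J_less[OF jJ] by linarith
    qed
    moreover have "2 * int (\<mu> j) + 1 \<le> int d" using J_less[OF jJ] by (simp add: \<mu>_def min_def; linarith)
    moreover have "3 \<le> int d" using d3 by simp
    moreover have "0 \<le> int (\<mu> j)" by simp
    moreover have "int (\<mu> j) \<le> int b" using mu_le_b[of j] by (simp only: of_nat_le_iff)
    ultimately have "int (\<mu> j) * (int n - 1 - int (\<mu> j)) + 2 * int n - 3 - 2 * int b \<le> (\<Sum>i<k. g i)"
      "(\<Sum>i<k. g i) = int (\<mu> j) * (int n - 1 - int (\<mu> j)) + 2 * int n - 3 - 2 * int b \<Longrightarrow>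
       int (A (i + 2)) = 1 \<and> int (\<mu> j) = int b \<and> (int (A (Suc i)) = int (\<mu> j) + 1 \<or> int (A i) = int (\<mu> j) + 1)"
      unfolding G by (rule triangle_arith)+
    moreover have "?T = int (\<mu> j) * (int n - 1 - int (\<mu> j)) + 2 * int n - 3 - 2 * int b"
      using j by (simp add: F_def)
    ultimately show ?thesis using j unfolding i_def
      by (intro conjI impI) (auto intro!: exI[of _ j])
  qed
  then show "?T \<le> (\<Sum>i<k. g i)"
    "(\<Sum>i<k. g i) = ?T \<Longrightarrow>
      \<exists>j. J = {j} \<and> \<mu> j = b \<and> A (idx j + 2) = 1 \<and> (A (idx j) = b + 1 \<or> A (Suc (idx j)) = b + 1)"
    by blast+
qed

end

section \<open>The bound for the whole graph and the case of equality\<close>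

context extremal_path
begin

lemma cycle_bound:
  shows "(\<Sum>j\<in>J. F (\<mu> j)) + 2 * int n - 3 - 2 * int b \<le> (\<Sum>i<k. g i)"
    and "(\<Sum>i<k. g i) = (\<Sum>j\<in>J. F (\<mu> j)) + 2 * int n - 3 - 2 * int b \<Longrightarrow> k = 3 \<and>
      (\<exists>j. J = {j} \<and> \<mu> j = b \<and> A (idx j + 2) = 1 \<and> (A (idx j) = b + 1 \<or> A (Suc (idx j)) = b + 1))"
proof -
  consider "even k" | "odd k" "5 \<le> k" | "odd k" "k = 3"
  proof -
    have "odd k \<Longrightarrow> k \<noteq> 4" by auto
    then show ?thesis using that k by (cases "k = 3"; cases "even k"; force)
  qed
  then have "(\<Sum>j\<in>J. F (\<mu> j)) + 2 * int n - 3 - 2 * int b \<le> (\<Sum>i<k. g i) \<and>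
    ((\<Sum>i<k. g i) = (\<Sum>j\<in>J. F (\<mu> j)) + 2 * int n - 3 - 2 * int b \<longrightarrow> k = 3 \<and>
      (\<exists>j. J = {j} \<and> \<mu> j = b \<and> A (idx j + 2) = 1 \<and> (A (idx j) = b + 1 \<or> A (Suc (idx j)) = b + 1)))"
  proof cases
    case 1
    then interpret even_extremal by unfold_locales
    show ?thesis using even_bound by auto
  next
    case 2
    then interpret odd_extremal by unfold_locales
    show ?thesis using odd5_bound[OF 2(2)] by auto
  next
    case 3
    then interpret odd_extremal by unfold_locales
    show ?thesis using triangle_bound[OF 3(2)] 3(2) by blast
  qed
  then show "(\<Sum>j\<in>J. F (\<mu> j)) + 2 * int n - 3 - 2 * int b \<le> (\<Sum>i<k. g i)"
    "(\<Sum>i<k. g i) = (\<Sum>j\<in>J. F (\<mu> j)) + 2 * int n - 3 - 2 * int b \<Longrightarrow> k = 3 \<and>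
      (\<exists>j. J = {j} \<and> \<mu> j = b \<and> A (idx j + 2) = 1 \<and> (A (idx j) = b + 1 \<or> A (Suc (idx j)) = b + 1))"
    by blast+
qed

definition off_edges :: "'a set set" where "off_edges = E - EC - path_edge ` {..<d}"

lemma szeged_split:
  "int (edge_szeged E) = (\<Sum>i<k. g i) + (\<Sum>j\<in>{..<d} - J. int (edge_weight E (path_edge j)))
    + (\<Sum>e\<in>off_edges. int (edge_weight E e))"
proof -
  let ?w = "\<lambda>e. int (edge_weight E e)"
  have fin: "finite EC" "finite (path_edge ` ({..<d} - J))" "finite off_edges"
    using finE finite_subset[OF grown_EC[OF grown]] by (auto simp: off_edges_def)
  have un: "E = (EC \<union> path_edge ` ({..<d} - J)) \<union> off_edges"
    using grown_EC[OF grown] xE unfolding off_edges_def J_def by auto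
  have d1: "EC \<inter> path_edge ` ({..<d} - J) = {}" unfolding J_def by auto
  have d2: "(EC \<union> path_edge ` ({..<d} - J)) \<inter> off_edges = {}" unfolding off_edges_def by auto
  have "int (edge_szeged E) = sum ?w E" using edge_szeged_sum[OF simple] by simp
  also have "\<dots> = sum ?w ((EC \<union> path_edge ` ({..<d} - J)) \<union> off_edges)" using un by simp
  also have "\<dots> = sum ?w EC + sum ?w (path_edge ` ({..<d} - J)) + sum ?w off_edges"
    using fin d1 d2 by (simp add: sum.union_disjoint)
  also have "sum ?w EC = (\<Sum>i<k. g i)" unfolding sum_EC g_def ..
  also have "sum ?w (path_edge ` ({..<d} - J)) = (\<Sum>j\<in>{..<d} - J. ?w (path_edge j))"
    using sum.reindex[OF inj_on_subset[OF path_edge_inj, of "{..<d} - J"], of ?w] by (simp add: subset_eq)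
  finally show ?thesis .
qed

lemma min_szeged_eq: "min_szeged n d =
    ((\<Sum>j\<in>J. F (\<mu> j)) + 2 * int n - 3 - 2 * int b) + (\<Sum>j\<in>{..<d} - J. F (\<mu> j))"
proof -
  have "J \<subseteq> {..<d}" by (auto simp: J_def)
  then have "(\<Sum>j<d. F (\<mu> j)) = (\<Sum>j\<in>{..<d} - J. F (\<mu> j)) + (\<Sum>j\<in>J. F (\<mu> j))"
    by (intro sum.subset_diff) auto
  then show ?thesis by (simp add: min_szeged_def F_def \<mu>_def)
qed

text \<open>The cycle, the bridges on the path and the remaining edges are bounded separately, so
  equality in total forces equality in each part and, for the last two, for every single
  edge.\<close>

lemma szeged_ge: "min_szeged n d \<le> int (edge_szeged E)"
  and szeged_eq: "int (edge_szeged E) = min_szeged n d \<Longrightarrow> k = 3 \<and>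
      (\<exists>j. J = {j} \<and> \<mu> j = b \<and> A (idx j + 2) = 1 \<and> (A (idx j) = b + 1 \<or> A (Suc (idx j)) = b + 1)) \<and>
      (\<forall>j<d. j \<notin> J \<longrightarrow> int (edge_weight E (path_edge j)) = F (\<mu> j)) \<and> (\<forall>e\<in>off_edges. edge_weight E e = 0)"
proof -
  have fin: "finite off_edges" using finE by (auto simp: off_edges_def)
  have p: "(\<Sum>j\<in>{..<d} - J. F (\<mu> j)) \<le> (\<Sum>j\<in>{..<d} - J. int (edge_weight E (path_edge j)))"
    using bridge_weight_ge by (intro sum_mono) auto
  have o: "0 \<le> (\<Sum>e\<in>off_edges. int (edge_weight E e))" by (intro sum_nonneg) auto
  show "min_szeged n d \<le> int (edge_szeged E)"
    unfolding szeged_split min_szeged_eq using p o cycle_bound(1) by linarith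
  assume "int (edge_szeged E) = min_szeged n d"
  then have eq: "(\<Sum>i<k. g i) = (\<Sum>j\<in>J. F (\<mu> j)) + 2 * int n - 3 - 2 * int b"
    "(\<Sum>j\<in>{..<d} - J. int (edge_weight E (path_edge j))) = (\<Sum>j\<in>{..<d} - J. F (\<mu> j))"
    "(\<Sum>e\<in>off_edges. int (edge_weight E e)) = 0"
    unfolding szeged_split min_szeged_eq using p o cycle_bound(1) by linarith+
  have "F (\<mu> j) = int (edge_weight E (path_edge j))" if "j < d" "j \<notin> J" for j
  proof -
    have "(\<Sum>j\<in>{..<d} - J. int (edge_weight E (path_edge j)) - F (\<mu> j)) = 0"
      using eq(2) by (simp add: sum_subtractf)
    then have "int (edge_weight E (path_edge j)) - F (\<mu> j) = 0"
      using that bridge_weight_ge by (subst (asm) sum_nonneg_eq_0_iff) auto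
    then show ?thesis by simp
  qed
  moreover have "edge_weight E e = 0" if "e \<in> off_edges" for e
    using eq(3) that fin by (subst (asm) sum_nonneg_eq_0_iff) auto
  ultimately show "k = 3 \<and>
      (\<exists>j. J = {j} \<and> \<mu> j = b \<and> A (idx j + 2) = 1 \<and> (A (idx j) = b + 1 \<or> A (Suc (idx j)) = b + 1)) \<and>
      (\<forall>j<d. j \<notin> J \<longrightarrow> int (edge_weight E (path_edge j)) = F (\<mu> j)) \<and> (\<forall>e\<in>off_edges. edge_weight E e = 0)"
    using cycle_bound(2)[OF eq(1)] by auto
qed

end

section \<open>The structure of minimal graphs\<close>

lemma C3_ab:
  assumes "1 \<le> d"
  shows "C3_a d = d div 2" "C3_b d = (d - 1) div 2"
proof -
  have "\<lceil>(real d - 1) / 2\<rceil> = int (d div 2)"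
    by (cases "even d") (auto elim!: evenE oddE intro!: ceiling_unique)
  moreover have "\<lfloor>(real d - 1) / 2\<rfloor> = int ((d - 1) div 2)"
    using assms by (cases "even d") (auto elim!: evenE oddE intro!: floor_unique)
  ultimately show "C3_a d = d div 2" "C3_b d = (d - 1) div 2" by (simp_all add: C3_a_def C3_b_def)
qed

text \<open>Another edge at u would be at distance 0 from u but not from v.\<close>

lemma (in cgraph) only_neighbour:
  assumes "{u, v} \<in> E" "m_edge E u v = 0" "{u, q} \<in> E"
  shows "q = v"
proof (rule ccontr)
  assume "q \<noteq> v"
  have V: "u \<in> V" "v \<in> V" "q \<in> V" "u \<noteq> v" using simple_graphD[OF simple] assms by auto
  have "edist E {u, q} u < edist E {u, q} v"
    using gdist_eq_0[of u v] gdist_eq_0[of q v] V \<open>q \<noteq> v\<close> by (simp add: edist_doubleton)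
  then have "{u, q} \<in> {f \<in> E. edist E f u < edist E f v}" using assms(3) by simp
  then show False using assms(2) finE unfolding m_edge_def by auto
qed

context extremal_path
begin

text \<open>Sizes are compared as unordered pairs because the path may traverse the shared edge in
  either direction of the numbering.\<close>

lemma triangle_apex:
  assumes k3: "k = 3" and j: "j \<in> J" and one: "A (idx j + 2) = 1"
  obtains w where "w \<in> V" "EC = {path_edge j, {x j, w}, {x (Suc j), w}}" "card {z \<in> V. \<rho> z = \<rho> w} = 1"
    "{A (idx j), A (Suc (idx j))} =
      {card {z \<in> V. \<rho> z = \<rho> (x j)}, card {z \<in> V. \<rho> z = \<rho> (x (Suc j))}}"
proof -
  define i where "i = idx j"
  have i: "i < k" "path_edge j = cyc_edge i" using idx[OF j] by (simp_all add: i_def)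
  define w where "w = c ((i + 2) mod k)"
  have im: "i \<in> {0, 1, 2}" using i(1) k3 by auto
  have set3: "{..<k} = {0, 1, 2}" using k3 by auto
  have EC0: "EC = {{c 0, c 1}, {c 1, c 2}, {c 2, c 0}}"
    unfolding cycle_edges_def set3 by (simp add: k3 numeral_2_eq_2)
  consider "i = 0" | "i = 1" | "i = 2" using im by blast
  then have "EC = {cyc_edge i, {c i, w}, {c (Suc i mod k), w}}"
    unfolding EC0 w_def by cases (simp_all add: k3 insert_commute numeral_2_eq_2)
  moreover have ends: "(x j = c i \<and> x (Suc j) = c (Suc i mod k)) \<or> (x j = c (Suc i mod k) \<and> x (Suc j) = c i)"
    using i(2) by (simp add: doubleton_eq_iff)
  ultimately have EC: "EC = {path_edge j, {x j, w}, {x (Suc j), w}}"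
    unfolding i(2) by (elim disjE conjE) (simp_all add: insert_commute)
  have A: "A m = card {z \<in> V. \<rho> z = \<rho> (c (m mod k))}" for m
    using \<rho>_c[of "m mod k"] k by (simp add: A_def)
  have "{A i, A (Suc i)} = {card {z \<in> V. \<rho> z = \<rho> (x j)}, card {z \<in> V. \<rho> z = \<rho> (x (Suc j))}}"
    using ends i(1) unfolding A by (elim disjE conjE) (simp_all add: insert_commute)
  moreover have "card {z \<in> V. \<rho> z = \<rho> w} = 1" using one A[of "i + 2"] by (simp add: w_def i_def)
  moreover have "w \<in> V" unfolding w_def using k by (intro grown_c[OF grown]) simp
  ultimately show ?thesis using that EC by (simp add: i_def)
qed

end

section \<open>Reconstructing a minimal graph\<close>

locale minimal_path = extremal_path +
  fixes w B
  assumes B_eq: "B = (d - 1) div 2" and Jb: "J = {B}" and w: "w \<in> V"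
    and EC_w: "EC = {path_edge B, {x B, w}, {x (Suc B), w}}"
    and class_w: "card {z \<in> V. \<rho> z = \<rho> w} = 1"
    and class_b: "card {z \<in> V. \<rho> z = \<rho> (x B)} = Suc B"
    and path_weight: "\<And>j. j < d \<Longrightarrow> j \<noteq> B \<Longrightarrow> int (edge_weight E (path_edge j)) = F (\<mu> j)"
    and off_weight: "\<And>e. e \<in> off_edges \<Longrightarrow> edge_weight E e = 0"
begin

lemma bd: "B < d" "2 * B + 1 \<le> d" "d \<le> 2 * B + 2" "1 \<le> B"
  using d3 unfolding B_eq by linarith+

lemma w_edges: "{x B, w} \<in> E" "{x (Suc B), w} \<in> E"
  using EC_w grown_EC[OF grown] by auto

lemma w_off: "w \<notin> x ` {..d}"
proof
  assume "w \<in> x ` {..d}"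
  then obtain i where i: "i \<le> d" "w = x i" by auto
  have "gdist E (x B) w = 1" "gdist E (x (Suc B)) w = 1" using gdist_edge w_edges by auto
  then have "(if B \<le> i then i - B else B - i) = 1" "(if Suc B \<le> i then i - Suc B else Suc B - i) = 1"
    using gdist_path[of B i] gdist_path[of "Suc B" i] i bd by auto
  then show False by (auto split: if_splits)
qed

lemma path_bridge:
  assumes "j < d" "j \<noteq> B"
  shows "path_edge j \<in> E" "path_edge j \<notin> EC"
  using assms xE Jb by (auto simp: J_def)

lemma lower_class: "i \<le> B \<Longrightarrow> \<rho> (x (B - i)) = \<rho> (x B)"
proof (induction i)
  case (Suc i)
  define j where "j = B - Suc i"
  have j: "j < d" "j \<noteq> B" "B - i = Suc j" using Suc.prems bd by (auto simp: j_def)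
  have "\<rho> (x j) = \<rho> (x (Suc j))" using grown_bridge_\<rho>[OF grown path_bridge[OF j(1,2)]] .
  then show ?case using Suc j by (simp add: j_def)
qed simp

text \<open>The vertices \<open>x 0\<close>, ..., \<open>x B\<close> already fill this class, so
  nothing else hangs on the lower part of the path.\<close>

lemma lower_class_eq: "{z \<in> V. \<rho> z = \<rho> (x B)} = x ` {..B}"
proof -
  have "x ` {..B} \<subseteq> {z \<in> V. \<rho> z = \<rho> (x B)}"
  proof
    fix z assume "z \<in> x ` {..B}"
    then obtain i where "i \<le> B" "z = x i" by auto
    then show "z \<in> {z \<in> V. \<rho> z = \<rho> (x B)}" using lower_class[of "B - i"] xV bd by auto
  qed
  moreover have "card (x ` {..B}) = Suc B"
    using card_image[of x "{..B}"] x_inj bd by (auto simp: inj_on_def)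
  ultimately have "x ` {..B} = {z \<in> V. \<rho> z = \<rho> (x B)}"
    by (intro card_subset_eq) (use class_b finV in simp_all)
  then show ?thesis ..
qed

text \<open>The neighbour of z towards the path is not a leaf, so z is.\<close>
lemma off_path_leaf:
  assumes z: "z \<in> V" "z \<notin> x ` {..d}" "z \<noteq> w"
  obtains y where "{z, y} \<in> E" "gdist E z (x (Suc B)) = Suc (gdist E y (x (Suc B)))"
    "\<forall>q. {z, q} \<in> E \<longrightarrow> q = y" "{z, y} \<notin> EC" "y \<in> V"
proof -
  let ?v = "x (Suc B)"
  have v: "?v \<in> V" using xV bd by simp
  have "z \<noteq> ?v" using z(2) bd by auto
  from gdist_desc[OF z(1) v this] obtain y where y: "y \<in> V" "{z, y} \<in> E" "gdist E z ?v = Suc (gdist E y ?v)" .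
  have bd': "x B \<in> x ` {..d}" "?v \<in> x ` {..d}" using bd by auto
  then have nEC: "{z, y} \<notin> EC" using z unfolding EC_w by (auto simp: doubleton_eq_iff)
  have "{z, y} \<noteq> path_edge i" if "i < d" for i
  proof -
    have "x i \<in> x ` {..d}" "x (Suc i) \<in> x ` {..d}" using that by auto
    then show ?thesis using z by (auto simp: doubleton_eq_iff)
  qed
  then have "{z, y} \<in> off_edges" using y nEC by (auto simp: off_edges_def)
  then have "edge_weight E {z, y} = 0" by (rule off_weight)
  moreover have "z \<noteq> y" using simple_graphD[OF simple y(2)] by simp
  ultimately have "m_edge E z y = 0 \<or> m_edge E y z = 0" by (simp add: edge_weight_doubleton)
  \<comment> \<open>The vertex y keeps a second neighbour: w if y is \<open>?v\<close>, and
    otherwise the next vertex on the way to \<open>?v\<close>.\<close>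
  moreover have "m_edge E y z \<noteq> 0"
  proof
    assume m0: "m_edge E y z = 0"
    have "{y, z} \<in> E" using y by (simp add: insert_commute)
    note only = only_neighbour[OF this m0]
    show False
    proof (cases "y = ?v")
      case True
      then have "{y, w} \<in> E" using w_edges by simp
      then show False using only z by blast
    next
      case False
      from gdist_desc[OF y(1) v this] obtain q where "{y, q} \<in> E" "gdist E y ?v = Suc (gdist E q ?v)" .
      then show False using only y by auto
    qed
  qed
  ultimately have "m_edge E z y = 0" by simp
  then show ?thesis using that y nEC only_neighbour[OF y(2)] by blast
qed

text \<open>A branch at \<open>x i\<close> would add an edge to the smaller side of the path edge
  just below it. The smaller side is so far below n / 2 that \<open>F\<close> still strictly
  increases from p to p + 1, against the exact weight known for this edge.\<close>

lemma no_branch_above: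
  assumes i: "Suc B < i" "i \<le> d" and z: "z \<in> V" "z \<notin> x ` {..d}"
  shows "{z, x i} \<notin> E"
proof
  assume e: "{z, x i} \<in> E"
  define j where "j = i - 1"
  have j: "j < d" "i = Suc j" "j \<noteq> B" "B < j" using i by (auto simp: j_def)
  define p where "p = d - 1 - j"
  have mu: "\<mu> j = p" using j bd unfolding \<mu>_def p_def by linarith
  let ?S = "insert {z, x i} (path_edge ` {Suc j..<d})"
  have "{z, x i} \<notin> path_edge ` {Suc j..<d}"
  proof
    assume "{z, x i} \<in> path_edge ` {Suc j..<d}"
    then obtain l where l: "l < d" "{z, x i} = path_edge l" by auto
    then have "z \<in> {x l, x (Suc l)}" by blast
    then show False using z l by auto
  qed
  then have "card ?S = Suc (card (path_edge ` {Suc j..<d}))" by simp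
  also have "card (path_edge ` {Suc j..<d}) = p"
    using card_image[OF inj_on_subset[OF path_edge_inj, of "{Suc j..<d}"]] by (simp add: subset_eq p_def)
  finally have cS: "card ?S = Suc p" .
  have "edist E {z, x i} (x i) < edist E {z, x i} (x j)"
  proof -
    have "x j \<noteq> z" using z j by auto
    then have "gdist E z (x j) \<noteq> 0" using gdist_eq_0[OF z(1)] xV[of j] j by auto
    moreover have "gdist E (x i) (x j) = 1" using gdist_path[of i j] j by simp
    ultimately show ?thesis by (simp add: edist_doubleton)
  qed
  then have new: "{z, x i} \<in> {f \<in> E. edist E f (x (Suc j)) < edist E f (x j)}"
    using e j(2) by simp
  have old: "path_edge l \<in> {f \<in> E. edist E f (x (Suc j)) < edist E f (x j)}" if "l \<in> {Suc j..<d}" for l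
    using that xE[of l] path_edist'[of j l] path_edist'[of "Suc j" l] by (simp; linarith)
  have "card ?S \<le> card {f \<in> E. edist E f (x (Suc j)) < edist E f (x j)}"
  proof (rule card_mono)
    show "finite {f \<in> E. edist E f (x (Suc j)) < edist E f (x j)}" using finE by simp
    show "?S \<subseteq> {f \<in> E. edist E f (x (Suc j)) < edist E f (x j)}" using new old by blast
  qed
  then have "Suc p \<le> m_edge E (x (Suc j)) (x j)" using cS by (simp add: m_edge_def)
  moreover have "Suc p \<le> m_edge E (x j) (x (Suc j))"
    using path_m_lower(1)[OF j(1)] j bd unfolding p_def by linarith
  ultimately have m: "int (Suc p) \<le> int (m_edge E (x j) (x (Suc j)))" "int (Suc p) \<le> int (m_edge E (x (Suc j)) (x j))"
    by simp_all
  have tot: "int (m_edge E (x j) (x (Suc j))) + int (m_edge E (x (Suc j)) (x j)) = int n - 1"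
    using grown_bridge_m[OF grown path_bridge[OF j(1,3)]] by linarith
  have "x j \<noteq> x (Suc j)" using x_inj[of j "Suc j"] j by simp
  then have wt: "int (edge_weight E (path_edge j)) = int (m_edge E (x j) (x (Suc j))) * int (m_edge E (x (Suc j)) (x j))"
    by (simp add: edge_weight_doubleton)
  have "int (Suc p) * (int n - 1 - int (Suc p)) \<le> int (edge_weight E (path_edge j))"
    using mult_ge_of_ge[OF m] unfolding wt tot .
  also have "\<dots> = int p * (int n - 1 - int p)" using path_weight[OF j(1,3)] mu by (simp add: F_def)
  finally have "int n \<le> 2 * int p + 2" by (simp add: algebra_simps)
  moreover have "2 * p \<le> d - 2" using j bd unfolding p_def by linarith
  ultimately show False using nd d3 by linarith
qed

text \<open>The neighbour of the leaf is found by exclusion: the class of w has no second vertex,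
  another vertex off the path is itself a leaf, the lower part of the path is full, and the upper
  part beyond \<open>x (Suc B)\<close> admits no branch.\<close>

lemma off_path_adj:
  assumes z: "z \<in> V" "z \<notin> x ` {..d}" "z \<noteq> w"
  shows "{x (Suc B), z} \<in> E"
proof -
  let ?v = "x (Suc B)"
  obtain y where y: "{z, y} \<in> E" "gdist E z ?v = Suc (gdist E y ?v)" "\<forall>q. {z, q} \<in> E \<longrightarrow> q = y"
    "{z, y} \<notin> EC" "y \<in> V"
    by (rule off_path_leaf[OF z])
  have \<rho>: "\<rho> z = \<rho> y" using grown_bridge_\<rho>[OF grown y(1,4)] .
  have "y \<noteq> w"
  proof
    assume "y = w"
    then have "{z, w} \<subseteq> {z \<in> V. \<rho> z = \<rho> w}" using \<rho> z w by auto
    then have "card {z, w} \<le> card {z \<in> V. \<rho> z = \<rho> w}" by (rule card_mono[rotated]) (simp add: finV)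
    then show False using z class_w by simp
  qed
  moreover have "y \<in> x ` {..d}"
  proof (rule ccontr)
    assume "y \<notin> x ` {..d}"
    note yy = this
    obtain q where q: "{y, q} \<in> E" "gdist E y ?v = Suc (gdist E q ?v)" "\<forall>q'. {y, q'} \<in> E \<longrightarrow> q' = q"
      "{y, q} \<notin> EC" "q \<in> V"
      by (rule off_path_leaf[OF y(5) yy \<open>y \<noteq> w\<close>])
    have "z = q" using q(3) y(1) by (simp add: insert_commute)
    then show False using y(2) q(2) by simp
  qed
  then obtain i where i: "i \<le> d" "y = x i" by auto
  moreover have "\<not> i \<le> B"
  proof
    assume "i \<le> B"
    then have "y \<in> {z \<in> V. \<rho> z = \<rho> (x B)}" unfolding lower_class_eq using i by auto
    then have "z \<in> x ` {..B}" using \<rho> z unfolding lower_class_eq[symmetric] by auto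
    then show False using z bd by auto
  qed
  moreover have "\<not> Suc B < i" using no_branch_above[of i z] i z(1,2) y(1) by auto
  ultimately have "i = Suc B" by simp
  then show ?thesis using y(1) i by (simp add: insert_commute)
qed

definition off :: "'a set" where "off = V - x ` {..d} - {w}"

lemma card_off: "card off = n - (d + 2)"
proof -
  have "card (insert w (x ` {..d})) = d + 2"
    using w_off card_image[of x "{..d}"] x_inj by (auto simp: inj_on_def)
  moreover have "off = V - insert w (x ` {..d})" by (auto simp: off_def)
  moreover have "insert w (x ` {..d}) \<subseteq> V" using w xV by auto
  ultimately show ?thesis using finV by (simp add: card_Diff_subset finite_subset)
qed

lemma embedding:
  obtains f where "bij_betw f {0..<n} V" "\<And>e. e \<in> C3_E n d \<Longrightarrow> f ` e \<in> E"
proof -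
  define a where "a = d div 2"
  have C3: "C3_a d = a" "C3_b d = B" using C3_ab[of d] d3 by (simp_all add: a_def B_eq)
  have dab: "d = a + B + 1" "1 \<le> a" "1 \<le> B" using bd unfolding a_def by auto
  have "card {d + 2..<n} = card off" using card_off by simp
  then obtain \<beta> where \<beta>: "bij_betw \<beta> {d + 2..<n} off"
    using finite_same_card_bij[of "{d + 2..<n}" off] finV by (auto simp: off_def)
  \<comment> \<open>The leaves hang on \<open>x (Suc B)\<close>, so this vertex becomes 0. The upper
    part of the path, with a edges, becomes the pendent path at 0 and the lower part, with B edges,
    the one at 1.\<close>
  define f where "f m = (if m = 0 then x (Suc B) else if m = 1 then x B else if m = 2 then w
    else if m \<le> a + 2 then x (Suc B + (m - 2)) else if m \<le> d + 1 then x (B - (m - (a + 2))) else \<beta> m)" for m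
  \<comment> \<open>Covering V is enough: with n arguments for n vertices, f is then injective as
    well.\<close>
  have "V \<subseteq> f ` {0..<n}"
  proof
    fix z assume z: "z \<in> V"
    consider i where "z = x i" "i \<le> d" | "z = w" | "z \<in> off" using z by (auto simp: off_def)
    then have "\<exists>m<n. f m = z"
    proof cases
      case 1
      consider "i < B" | "i = B" | "i = Suc B" | "Suc B < i" by linarith
      then show ?thesis
      proof cases
        case 1
        then show ?thesis using \<open>z = x i\<close> dab nd by (intro exI[of _ "a + 2 + (B - i)"]) (auto simp: f_def)
      next
        case 2
        then show ?thesis using \<open>z = x i\<close> nd by (intro exI[of _ 1]) (auto simp: f_def)
      next
        case 3
        then show ?thesis using \<open>z = x i\<close> nd by (intro exI[of _ 0]) (auto simp: f_def)
      next
        case 4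
        then show ?thesis using \<open>z = x i\<close> \<open>i \<le> d\<close> dab nd by (intro exI[of _ "i - Suc B + 2"]) (auto simp: f_def)
      qed
    next
      case 2
      then show ?thesis using nd by (intro exI[of _ 2]) (use n6 in \<open>auto simp: f_def\<close>)
    next
      case 3
      then have "z \<in> \<beta> ` {d + 2..<n}" using \<beta> by (simp add: bij_betw_def)
      then obtain m where "z = \<beta> m" "m \<in> {d + 2..<n}" by (rule imageE)
      then show ?thesis using dab by (intro exI[of _ m]) (simp add: f_def)
    qed
    then show "z \<in> f ` {0..<n}" by auto
  qed
  moreover have "card (f ` {0..<n}) \<le> n" using card_image_le[of "{0..<n}" f] by simp
  ultimately have im: "f ` {0..<n} = V" using card_seteq[of "f ` {0..<n}" V] by simp
  then have "bij_betw f {0..<n} V"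
    using eq_card_imp_inj_on[of "{0..<n}" f] by (simp add: bij_betw_def)
  moreover have "f ` e \<in> E" if "e \<in> C3_E n d" for e
  proof -
    have tri: "f 0 = x (Suc B)" "f 1 = x B" "f 2 = w" by (simp_all add: f_def)
    have up: "f (i + 2) = x (Suc B + i)" if "1 \<le> i" "i \<le> a" for i using that by (simp add: f_def)
    have down: "f (a + i + 2) = x (B - i)" if "1 \<le> i" "i \<le> B" for i using that dab by (simp add: f_def)
    from that consider "e = {0, 1}" | "e = {1, 2}" | "e = {0, 2}"
      | i where "e = {if i = 1 then 0 else i + 1, i + 2}" "1 \<le> i" "i \<le> a"
      | i where "e = {if i = 1 then 1 else a + i + 1, a + i + 2}" "1 \<le> i" "i \<le> B"
      | m where "e = {0, m}" "a + B + 3 \<le> m" "m < n"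
      unfolding C3_E_def C3 by blast
    then show ?thesis
    proof cases
      case 1
      then show ?thesis using tri xE[OF bd(1)] by (simp add: insert_commute)
    next
      case 2
      then show ?thesis using tri w_edges by simp
    next
      case 3
      then show ?thesis using tri w_edges by simp
    next
      case 4
      have "f (if i = 1 then 0 else i + 1) = x (B + i)"
        using tri up[of "i - 1"] 4 by (cases "i = 1") auto
      then show ?thesis using 4 up[of i] xE[of "B + i"] dab by simp
    next
      case 5
      have "f (if i = 1 then 1 else a + i + 1) = x (Suc (B - i))"
        using tri down[of "i - 1"] 5 by (cases "i = 1") (auto simp: Suc_diff_le)
      then show ?thesis using 5 down[of i] xE[of "B - i"] dab by (simp add: insert_commute)
    next
      case 6
      then have "f m \<in> off" using \<beta> dab by (auto simp: f_def bij_betw_def)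
      then show ?thesis using 6 tri off_path_adj[of "f m"] by (auto simp: off_def)
    qed
  qed
  ultimately show ?thesis using that by blast
qed

end

section \<open>The extremal graph\<close>

locale C3_graph =
  fixes n d a b :: nat
  assumes C3: "C3_a d = a" "C3_b d = b" and dab: "d = a + b + 1" "1 \<le> b" "b \<le> a" "a \<le> b + 1"
    and nd: "d + 2 \<le> n"
begin

text \<open>For m at least 3 this is the vertex to which m is attached. Labels increase along each
  pendent path; 3 and a + 3 begin the paths.\<close>

definition par :: "nat \<Rightarrow> nat" where
  "par m = (if m = 3 then 0 else if m = a + 3 then 1 else if m \<le> a + b + 2 then m - 1 else 0)"
definition \<rho> :: "nat \<Rightarrow> nat" where
  "\<rho> m = (if m < 3 then m else if m \<le> a + 2 then 0 else if m \<le> a + b + 2 then 1 else 0)"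
definition h :: "nat \<Rightarrow> nat" where
  "h m = (if m < 3 then 0 else if m \<le> a + 2 then m - 2 else if m \<le> a + b + 2 then m - (a + 2) else 1)"
definition G :: "nat \<Rightarrow> nat set set" where
  "G m = cycle_edges 3 id \<union> (\<lambda>i. {i, par i}) ` {3..<m}"
text \<open>Since labels run consecutively along a pendent path, the subtree below m is the interval
  from m to \<open>last_desc m\<close>.\<close>

definition last_desc :: "nat \<Rightarrow> nat" where
  "last_desc m = (if m \<le> a + 2 then a + 2 else if m \<le> a + b + 2 then a + b + 2 else m)"

sublocale rooted_cycle 3 id \<rho> h
  by unfold_locales (auto simp: \<rho>_def h_def)

lemma par_less: "3 \<le> m \<Longrightarrow> par m < m"
  by (auto simp: par_def)

lemma \<rho>_par: "3 \<le> m \<Longrightarrow> \<rho> m = \<rho> (par m)"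
  using dab by (auto simp: par_def \<rho>_def)

lemma h_par: "3 \<le> m \<Longrightarrow> h m = Suc (h (par m))"
  using dab by (auto simp: par_def h_def)

lemma grown_G:
  assumes "3 \<le> m"
  shows "grown {..<m} (G m)"
  using assms
proof (induction m rule: dec_induct)
  case base
  have "id ` {..<3} = {..<3 :: nat}" "G 3 = cycle_edges 3 id" by (simp_all add: G_def)
  then show ?case using leaf_grown.cycle[of 3 id \<rho> h] by (simp only:)
next
  case (step m)
  have "G (Suc m) = insert {m, par m} (G m)" using step by (simp add: G_def atLeastLessThanSuc)
  then show ?case
    using leaf_grown.leaf[OF step.IH, of "par m" m] par_less \<rho>_par h_par step by (simp add: lessThan_Suc)
qed

lemma EC_eq: "cycle_edges 3 id = {{0, 1}, {1, 2}, {0, 2 :: nat}}"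
proof -
  have "{..<3} = {0, 1, 2 :: nat}" by auto
  then show ?thesis by (simp add: cycle_edges_def numeral_2_eq_2 insert_commute)
qed

lemma C3_E_eq: "C3_E n d = G n"
proof -
  have closed: "{f i | i. 1 \<le> i \<and> i \<le> m} = f ` {1..<m + 1}" for f :: "nat \<Rightarrow> nat set" and m by auto
  have half_open: "{f i | i. l \<le> i \<and> i < m} = f ` {l..<m}" for f :: "nat \<Rightarrow> nat set" and l m by auto
  have 1: "{{if i = 1 then 0 else i + 1, i + 2} | i. 1 \<le> i \<and> i \<le> a} = (\<lambda>i. {i, par i}) ` {3..<a + 3}"
  proof -
    have "{{if i = 1 then 0 else i + 1, i + 2} | i. 1 \<le> i \<and> i \<le> a} =
        (\<lambda>i. {if i = 1 then 0 else i + 1, i + 2}) ` {1..<a + 1}" by (rule closed)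
    also have "\<dots> = (\<lambda>i. {i + 2, par (i + 2)}) ` {1..<a + 1}"
    proof (rule image_cong)
      fix i assume "i \<in> {1..<a + 1}"
      then have "par (i + 2) = (if i = 1 then 0 else i + 1)" using dab by (auto simp: par_def)
      then show "{if i = 1 then 0 else i + 1, i + 2} = {i + 2, par (i + 2)}" by (simp add: insert_commute)
    qed simp
    also have "\<dots> = (\<lambda>i. {i, par i}) ` (\<lambda>i. i + 2) ` {1..<a + 1}" by (simp only: image_image)
    also have "(\<lambda>i. i + 2) ` {1..<a + 1} = {3..<a + 3}"
      unfolding image_add_atLeastLessThan' by (rule arg_cong2[of _ _ _ _ atLeastLessThan]) simp_all
    finally show ?thesis .
  qed
  have 2: "{{if j = 1 then 1 else a + j + 1, a + j + 2} | j. 1 \<le> j \<and> j \<le> b} = (\<lambda>i. {i, par i}) ` {a + 3..<a + b + 3}"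
  proof -
    have "{{if j = 1 then 1 else a + j + 1, a + j + 2} | j. 1 \<le> j \<and> j \<le> b} =
        (\<lambda>j. {if j = 1 then 1 else a + j + 1, a + j + 2}) ` {1..<b + 1}" by (rule closed)
    also have "\<dots> = (\<lambda>j. {j + (a + 2), par (j + (a + 2))}) ` {1..<b + 1}"
    proof (rule image_cong)
      fix j assume "j \<in> {1..<b + 1}"
      then have "par (j + (a + 2)) = (if j = 1 then 1 else a + j + 1)" using dab by (auto simp: par_def)
      then show "{if j = 1 then 1 else a + j + 1, a + j + 2} = {j + (a + 2), par (j + (a + 2))}"
        by (simp add: insert_commute add_ac)
    qed simp
    also have "\<dots> = (\<lambda>i. {i, par i}) ` (\<lambda>i. i + (a + 2)) ` {1..<b + 1}" by (simp only: image_image)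
    also have "(\<lambda>i. i + (a + 2)) ` {1..<b + 1} = {a + 3..<a + b + 3}"
      unfolding image_add_atLeastLessThan' by (rule arg_cong2[of _ _ _ _ atLeastLessThan]) simp_all
    finally show ?thesis .
  qed
  have 3: "{{0, k} | k. a + b + 3 \<le> k \<and> k < n} = (\<lambda>i. {i, par i}) ` {a + b + 3..<n}"
  proof -
    have "{{0, k} | k. a + b + 3 \<le> k \<and> k < n} = (\<lambda>k. {0, k}) ` {a + b + 3..<n}" by (rule half_open)
    also have "\<dots> = (\<lambda>i. {i, par i}) ` {a + b + 3..<n}"
    proof (rule image_cong)
      fix k assume "k \<in> {a + b + 3..<n}"
      then have "par k = 0" using dab by (auto simp: par_def)
      then show "{0, k} = {k, par k}" by (simp add: insert_commute)
    qed simp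
    finally show ?thesis .
  qed
  have "{3..<n} = {3..<a + 3} \<union> {a + 3..<a + b + 3} \<union> {a + b + 3..<n}" using dab nd by auto
  then show ?thesis unfolding C3_E_def C3 1 2 3 G_def EC_eq by (simp only: image_Un Un_assoc)
qed

text \<open>Vertices are attached in the order of their labels, and a new vertex M lies on the side
  of m exactly if \<open>par M\<close> does.\<close>

lemma closer_to_child:
  assumes m: "3 \<le> m" and "Suc m \<le> M"
  shows "{z \<in> {..<M}. gdist (G M) z m < gdist (G M) z (par m)} = {m..<min M (Suc (last_desc m))}"
  using assms(2)
proof (induction M rule: dec_induct)
  case base
  interpret leaf_ext "{..<m}" "G m" m "par m"
    using grown_leaf_ext[OF grown_G[OF m]] par_less[OF m] by simp
  have G: "G (Suc m) = insert {m, par m} (G m)" using m by (simp add: G_def atLeastLessThanSuc)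
  have "gdist (G (Suc m)) z m < gdist (G (Suc m)) z (par m) \<longleftrightarrow> z = m" if "z < Suc m" for z
    using that leaf_gdist'[of z] leaf_gdist(1)[of "par m" z] leaf_gdist(2)[of "par m"] y unfolding G
    by (cases "z = m") auto
  moreover have "m \<le> last_desc m" by (auto simp: last_desc_def)
  ultimately show ?case by auto
next
  case (step M)
  interpret leaf_ext "{..<M}" "G M" M "par M"
    using grown_leaf_ext[OF grown_G, of M "par M" M] par_less[of M] step m by simp
  have G: "G (Suc M) = insert {M, par M} (G M)" using step m by (simp add: G_def atLeastLessThanSuc)
  have pm: "par m \<in> {..<M}" "m \<in> {..<M}" using par_less[OF m] step by auto
  have IH: "gdist (G M) z m < gdist (G M) z (par m) \<longleftrightarrow> z \<in> {m..<min M (Suc (last_desc m))}" if "z < M" for z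
  proof -
    have "z \<in> {z \<in> {..<M}. gdist (G M) z m < gdist (G M) z (par m)} \<longleftrightarrow> z \<in> {m..<min M (Suc (last_desc m))}"
      by (simp only: step.IH)
    then show ?thesis using that by simp
  qed
  have old: "gdist (G (Suc M)) z m < gdist (G (Suc M)) z (par m) \<longleftrightarrow> z \<in> {m..<min M (Suc (last_desc m))}"
    if "z < M" for z
  proof -
    have z: "z \<in> {..<M}" using that by simp
    show ?thesis unfolding G leaf_gdist(1)[OF pm(1) z] leaf_gdist(1)[OF pm(2) z] using IH[OF that] .
  qed
  have new: "gdist (G (Suc M)) M m < gdist (G (Suc M)) M (par m) \<longleftrightarrow> M \<le> last_desc m"
  proof -
    have "gdist (G (Suc M)) M m < gdist (G (Suc M)) M (par m) \<longleftrightarrow> par M \<in> {m..<min M (Suc (last_desc m))}"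
      unfolding G leaf_gdist(2)[OF pm(1)] leaf_gdist(2)[OF pm(2)] using IH[of "par M"] y by simp
    also have "\<dots> \<longleftrightarrow> M \<le> last_desc m"
    proof -
      have mM: "m < M" "3 < M" using m step(1) by auto
      consider "M = a + 3" | "M \<noteq> a + 3" "M \<le> a + b + 2" | "a + b + 2 < M" by linarith
      then show ?thesis
      proof cases
        case 1
        then have "par M = 1" "last_desc m = a + 2" using mM by (simp_all add: par_def last_desc_def)
        then show ?thesis using 1 m by simp
      next
        case 2
        then have "par M = M - 1" using mM by (simp add: par_def)
        then have "par M \<in> {m..<min M (Suc (last_desc m))} \<longleftrightarrow> M - 1 \<le> last_desc m" using mM by auto
        moreover have "last_desc m \<noteq> M - 1" using 2 mM by (auto simp: last_desc_def)
        ultimately show ?thesis by linarith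
      next
        case 3
        then have "par M = 0" using mM dab by (simp add: par_def)
        then show ?thesis using 3 m mM by (auto simp: last_desc_def)
      qed
    qed
    finally show ?thesis .
  qed
  have "z \<in> {z \<in> {..<Suc M}. gdist (G (Suc M)) z m < gdist (G (Suc M)) z (par m)} \<longleftrightarrow>
      z \<in> {m..<min (Suc M) (Suc (last_desc m))}" for z
    using old[of z] new step(1) by (cases "z = M") auto
  then show ?case by blast
qed

sublocale grown_graph 3 id \<rho> h "{..<n}" "G n"
proof -
  have "3 \<le> n" using nd dab by simp
  then show "grown_graph 3 id \<rho> h {..<n} (G n)"
    using grown_G grown_cgraph rooted_cycle_axioms by (simp add: grown_graph_def grown_graph_axioms_def)
qed

lemma bridge_weight:
  assumes m: "3 \<le> m" "m < n"
  shows "int (edge_weight (G n) {m, par m}) = int (last_desc m - m) * (int n - 1 - int (last_desc m - m))"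
proof -
  have e: "{m, par m} \<in> G n" using m by (auto simp: G_def)
  have nEC: "{m, par m} \<notin> EC" unfolding EC_eq using m by (auto simp: doubleton_eq_iff)
  have "m_edge (G n) m (par m) + 1 = card {m..<min n (Suc (last_desc m))}"
    using grown_h_parent[OF grown e nEC] h_par[OF m(1)] closer_to_child[OF m(1), of n] m by simp
  also have "min n (Suc (last_desc m)) = Suc (last_desc m)" using m nd dab by (auto simp: last_desc_def)
  also have "card {m..<Suc (last_desc m)} = last_desc m - m + 1" by (auto simp: last_desc_def Suc_diff_le)
  finally have 1: "m_edge (G n) m (par m) = last_desc m - m" by simp
  have 2: "m_edge (G n) m (par m) + m_edge (G n) (par m) m + 1 = n"
    using grown_bridge_m[OF grown e nEC] by simp
  have "edge_weight (G n) {m, par m} = m_edge (G n) m (par m) * m_edge (G n) (par m) m"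
    using par_less[OF m(1)] by (intro edge_weight_doubleton) simp
  moreover have "int (m_edge (G n) (par m) m) = int n - 1 - int (last_desc m - m)" using 1 2 by linarith
  ultimately show ?thesis using 1 by simp
qed

lemma class_sizes: "A 0 = n - 2 - b" "A 1 = b + 1" "A 2 = 1"
proof -
  have "{z \<in> {..<n}. \<rho> z = 1} = insert 1 {a + 3..<a + b + 3}" using nd dab by (auto simp: \<rho>_def)
  then show A1: "A 1 = b + 1" by (simp add: A_def)
  have "{z \<in> {..<n}. \<rho> z = 2} = {2}" using nd dab by (auto simp: \<rho>_def)
  then show A2: "A 2 = 1" by (simp add: A_def)
  have "{..<3} = {0, 1, 2 :: nat}" by auto
  then have "A 0 + A 1 + A 2 = n" using sum_A[of 0] by simp
  then show "A 0 = n - 2 - b" using A1 A2 by simp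
qed

text \<open>In a triangle a side is a single tree, so each edge weighs the product of the sizes of
  the trees at its ends.\<close>

lemma cycle_weights: "(\<Sum>i<3. int (edge_weight (G n) (cyc_edge i))) =
  int b * (int n - 1 - int b) + 2 * int n - 3 - 2 * int b"
proof -
  define gw where "gw i = int (edge_weight (G n) (cyc_edge i))" for i
  have W: "W m = A m" for m by (simp add: W_def)
  have w: "gw i = int (A (Suc i)) * int (A i)" if "i < 3" for i
  proof -
    have off: "i + 3 - 3 div 2 + 1 = i + 3" by simp
    have "edge_weight (G n) (cyc_edge i) = A (Suc i) * A i"
      using cyc_weight[OF that] unfolding off A_period W by simp
    then show ?thesis by (simp only: gw_def of_nat_mult)
  qed
  have A3: "A 3 = A 0" using A_period[of 0] by simp
  have sum3: "(\<Sum>i<3. f i) = f 0 + f 1 + f 2" for f :: "nat \<Rightarrow> int"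
    by (simp add: numeral_3_eq_3 numeral_2_eq_2)
  have "gw 0 = int (A 1) * int (A 0)" "gw 1 = int (A 2) * int (A 1)" "gw 2 = int (A 0) * int (A 2)"
    using w[of 0] w[of 1] w[of 2] A3 by (simp_all add: numeral_2_eq_2 numeral_3_eq_3)
  then have "(\<Sum>i<3. gw i) = int (A 1) * int (A 0) + int (A 2) * int (A 1) + int (A 0) * int (A 2)"
    unfolding sum3 by simp
  moreover have "int (A 0) = int n - 2 - int b" "int (A 1) = int b + 1" "int (A 2) = 1"
    using class_sizes nd dab by linarith+
  ultimately have "(\<Sum>i<3. gw i) = int b * (int n - 1 - int b) + 2 * int n - 3 - 2 * int b"
    by (simp add: algebra_simps)
  then show ?thesis by (simp only: gw_def)
qed

lemma szeged_C3: "int (edge_szeged (C3_E n d)) = min_szeged n d"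
proof -
  define F where "F p = int p * (int n - 1 - int p)" for p
  let ?w = "\<lambda>e. int (edge_weight (G n) e)"
  have inj: "inj_on (\<lambda>i. {i, par i}) {3..<n}"
  proof (rule inj_onI)
    fix i j assume "i \<in> {3..<n}" "j \<in> {3..<n}" "{i, par i} = {j, par j}"
    then show "i = j" using par_less[of i] par_less[of j] by (auto simp: doubleton_eq_iff)
  qed
  have dj: "EC \<inter> (\<lambda>i. {i, par i}) ` {3..<n} = {}"
  proof (rule ccontr)
    assume "EC \<inter> (\<lambda>i. {i, par i}) ` {3..<n} \<noteq> {}"
    then obtain i where i: "3 \<le> i" "{i, par i} \<in> EC" by auto
    have "e \<subseteq> {0, 1, 2}" if "e \<in> EC" for e using that unfolding EC_eq by auto
    from this[OF i(2)] i(1) show False by simp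
  qed
  have fin: "finite EC" unfolding EC_eq by simp
  have "int (edge_szeged (C3_E n d)) = sum ?w (G n)" using edge_szeged_sum[OF simple] by (simp add: C3_E_eq)
  also have "\<dots> = sum ?w (EC \<union> (\<lambda>i. {i, par i}) ` {3..<n})"
    by (rule sum.cong) (simp_all add: G_def[of n])
  also have "\<dots> = sum ?w EC + sum ?w ((\<lambda>i. {i, par i}) ` {3..<n})"
    by (rule sum.union_disjoint) (use dj fin in simp_all)
  also have "sum ?w EC = F b + 2 * int n - 3 - 2 * int b"
    unfolding sum_EC cycle_weights F_def ..
  also have "sum ?w ((\<lambda>i. {i, par i}) ` {3..<n}) = (\<Sum>m\<in>{3..<n}. F (last_desc m - m))"
    unfolding sum.reindex[OF inj] comp_def F_def by (rule sum.cong) (use bridge_weight in simp_all)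
  also have "\<dots> = (\<Sum>m\<in>{3..<a + 3}. F (last_desc m - m)) + (\<Sum>m\<in>{a + 3..<a + b + 3}. F (last_desc m - m))
      + (\<Sum>m\<in>{a + b + 3..<n}. F (last_desc m - m))"
    using nd dab by (simp add: sum.atLeastLessThan_concat)
  \<comment> \<open>The edge above m cuts off the part of the pendent path beyond m, so a path with
    a edges contributes \<open>F 0\<close>, ..., \<open>F (a - 1)\<close>.\<close>
  also have "(\<Sum>m\<in>{3..<a + 3}. F (last_desc m - m)) = (\<Sum>p<a. F p)"
    by (rule sum.reindex_bij_witness[of _ "\<lambda>p. a + 2 - p" "\<lambda>m. a + 2 - m"]) (auto simp: last_desc_def)
  also have "(\<Sum>m\<in>{a + 3..<a + b + 3}. F (last_desc m - m)) = (\<Sum>p<b. F p)"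
    by (rule sum.reindex_bij_witness[of _ "\<lambda>p. a + b + 2 - p" "\<lambda>m. a + b + 2 - m"]) (auto simp: last_desc_def)
  also have "(\<Sum>m\<in>{a + b + 3..<n}. F (last_desc m - m)) = 0"
    by (rule sum.neutral) (auto simp: last_desc_def F_def)
  finally have S: "int (edge_szeged (C3_E n d)) =
    F b + 2 * int n - 3 - 2 * int b + ((\<Sum>p<a. F p) + (\<Sum>p<b. F p) + 0)" .
  \<comment> \<open>The minima rise from 0 to b and then, as a is b or b + 1, fall from a - 1 to 0.
    The summand \<open>F b\<close> matches the triangle, the others the two pendent paths.\<close>
  have "(\<Sum>j<d. F (min j (d - 1 - j))) = (\<Sum>j<b + 1. F (min j (d - 1 - j))) + (\<Sum>j<a. F (min (b + 1 + j) (d - 1 - (b + 1 + j))))"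
    using sum_lessThan_add[of "\<lambda>j. F (min j (d - 1 - j))" "b + 1" a] dab by (simp add: add_ac)
  also have "(\<Sum>j<b + 1. F (min j (d - 1 - j))) = (\<Sum>j<b + 1. F j)"
    by (rule sum.cong) (use dab in auto)
  also have "(\<Sum>j<a. F (min (b + 1 + j) (d - 1 - (b + 1 + j)))) = (\<Sum>p<a. F p)"
    by (rule sum.reindex_bij_witness[of _ "\<lambda>p. a - 1 - p" "\<lambda>p. a - 1 - p"]) (use dab in \<open>auto simp: min_def\<close>)
  finally have "(\<Sum>j<d. F (min j (d - 1 - j))) = (\<Sum>p<b. F p) + F b + (\<Sum>p<a. F p)" by simp
  moreover have "(d - 1) div 2 = b" using dab by auto
  ultimately show ?thesis unfolding S min_szeged_def F_def by simp
qed

lemma diameter_C3: "diameter (C3_V n) (C3_E n d) = d"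
proof -
  have V: "C3_V n = {..<n}" by (auto simp: C3_V_def)
  have le: "gdist (G n) u v \<le> d" if uv: "u < n" "v < n" for u v
  proof -
    have \<rho>: "\<rho> u < 3" "\<rho> v < 3" using grown_\<rho>[OF grown] uv by auto
    \<comment> \<open>Two vertices of the same tree have total depth at most 2a, which is at most a
      + b + 1 because a exceeds b by at most one.\<close>
    have hd: "h u + h v \<le> a + b + (if \<rho> u = \<rho> v then 1 else 0)"
      using dab by (auto simp: h_def \<rho>_def)
    show ?thesis
    proof (cases "\<rho> u = \<rho> v")
      case True
      have "gdist (G n) u (id (\<rho> u)) = h u" "gdist (G n) v (id (\<rho> u)) = h v"
        using grown_gdist_c[OF grown \<rho>(1), of u] grown_gdist_c[OF grown \<rho>(1), of v] uv True by simp_all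
      then have "gdist (G n) u v \<le> h u + h v"
        using gdist_triangle[of u "id (\<rho> u)" v] gdist_sym[of "G n" v] grown_c[OF grown \<rho>(1)] uv by simp
      then show ?thesis using hd True dab by simp
    next
      case False
      have "cycle_dist 3 (\<rho> u) (\<rho> v) \<le> 1" using cycle_dist_le[OF \<rho>] by simp
      then show ?thesis using grown_gdist_classes[OF grown _ _ False] uv hd False dab by simp
    qed
  qed
  have eq: "gdist (G n) (a + 2) (a + b + 2) = d"
  proof -
    have r: "\<rho> (a + 2) = 0" "\<rho> (a + b + 2) = 1" "h (a + 2) = a" "h (a + b + 2) = b"
      using dab by (auto simp: \<rho>_def h_def)
    have "cycle_dist 3 0 1 = 1" by (simp add: cycle_dist_def)
    then show ?thesis using grown_gdist_classes[OF grown, of "a + 2" "a + b + 2"] r nd dab by simp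
  qed
  have "{gdist (G n) u v | u v. u \<in> {..<n} \<and> v \<in> {..<n}} = (\<lambda>(u, v). gdist (G n) u v) ` ({..<n} \<times> {..<n})" by auto
  moreover have "Max ((\<lambda>(u, v). gdist (G n) u v) ` ({..<n} \<times> {..<n})) = d"
  proof (rule Max_eqI)
    have "(a + 2, a + b + 2) \<in> {..<n} \<times> {..<n}" using nd dab by auto
    from imageI[OF this, of "\<lambda>(u, v). gdist (G n) u v"]
    show "d \<in> (\<lambda>(u, v). gdist (G n) u v) ` ({..<n} \<times> {..<n})" using eq by simp
  qed (use le in auto)
  ultimately show ?thesis unfolding diameter_def V C3_E_eq by simp
qed

lemma unicyclic_C3: "unicyclic (C3_V n) (C3_E n d)"
proof -
  have "C3_V n = {..<n}" by (auto simp: C3_V_def)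
  then show ?thesis using simple conn grown_card[OF grown] by (simp add: unicyclic_def C3_E_eq)
qed

end

section \<open>Isomorphism and the main theorem\<close>

lemma inj_on_image_edges:
  assumes "simple_graph V E" "inj_on f V"
  shows "inj_on ((`) f) E"
  by (rule inj_on_subset[OF inj_on_image_Pow[OF assms(2)]]) (use assms(1) in \<open>auto simp: simple_graph_def\<close>)

lemma image_edges_iff:
  assumes "simple_graph V E" "inj_on f V" "u \<in> V" "v \<in> V"
  shows "{f u, f v} \<in> (`) f ` E \<longleftrightarrow> {u, v} \<in> E"
proof
  assume "{f u, f v} \<in> (`) f ` E"
  then obtain e where e: "e \<in> E" "f ` {u, v} = f ` e" by auto
  have "e \<subseteq> V" using assms(1) e(1) by (auto simp: simple_graph_def)
  then have "{u, v} = e" using inj_on_image_eq_iff[OF assms(2), of "{u, v}" e] e(2) assms(3,4) by simp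
  then show "{u, v} \<in> E" using e(1) by simp
next
  assume "{u, v} \<in> E"
  then show "{f u, f v} \<in> (`) f ` E" by (metis image_empty image_eqI image_insert)
qed

text \<open>Distances carry over by \<open>gdist_eqI\<close>, with the distance in E pulled back
  along the inverse of f as potential; the counts and weights follow.\<close>

lemma edge_szeged_image:
  assumes "cgraph V E" "cgraph V' E'" and f: "bij_betw f V V'" and E': "E' = (`) f ` E"
  shows "edge_szeged E' = edge_szeged E"
proof -
  interpret cgraph V E by fact
  interpret C: cgraph V' E' by fact
  have inj: "inj_on f V" and im: "f ` V = V'" using f by (auto simp: bij_betw_def)
  define g where "g = inv_into V f"
  have gf: "g (f u) = u" if "u \<in> V" for u using inj that by (simp add: g_def)
  have edge: "{f u, f v} \<in> E' \<longleftrightarrow> {u, v} \<in> E" if "u \<in> V" "v \<in> V" for u v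
    unfolding E' by (rule image_edges_iff[OF simple inj that])
  have dist: "gdist E' (f u) (f v) = gdist E u v" if uv: "u \<in> V" "v \<in> V" for u v
  proof -
    have "gdist E' (f u) (f v) = gdist E (g (f u)) v"
    proof (rule gdist_eqI[where V = V'])
      show "gdist E (g (f v)) v = 0" using gf uv by simp
    next
      fix p q assume pq: "{p, q} \<in> E'"
      then have "p \<in> f ` V" "q \<in> f ` V" using simple_graphD[OF C.simple pq] im by auto
      then obtain p' q' where "p = f p'" "q = f q'" "p' \<in> V" "q' \<in> V" by auto
      then show "gdist E (g p) v \<le> Suc (gdist E (g q) v)" using gdist_lip[of p' q' v] edge pq gf uv by simp
    next
      fix p assume p: "p \<in> V'" "p \<noteq> f v"
      then obtain p' where p': "p = f p'" "p' \<in> V" "p' \<noteq> v" using im by auto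
      from gdist_desc[OF p'(2) uv(2) p'(3)] obtain q where
        "q \<in> V" "{p', q} \<in> E" "gdist E p' v = Suc (gdist E q v)" .
      then show "\<exists>q\<in>V'. {p, q} \<in> E' \<and> gdist E (g p) v = Suc (gdist E (g q) v)"
        using p' edge gf im by (intro bexI[of _ "f q"]) auto
    next
      show "f u \<in> V'" using im uv by auto
    qed
    then show ?thesis using gf uv by simp
  qed
  have ed: "edist E' (f ` e) (f u) = edist E e u" if eu: "e \<in> E" "u \<in> V" for e u
  proof -
    from simple eu(1) obtain p q where "e = {p, q}" "p \<in> V" "q \<in> V" by (rule simple_graphE)
    then show ?thesis using dist eu(2) by (simp add: edist_doubleton)
  qed
  have injE: "inj_on ((`) f) E" by (rule inj_on_image_edges[OF simple inj])
  have m: "m_edge E' (f u) (f v) = m_edge E u v" if "u \<in> V" "v \<in> V" for u v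
  proof -
    have "{e \<in> E'. edist E' e (f u) < edist E' e (f v)} = (`) f ` {e \<in> E. edist E e u < edist E e v}"
      unfolding E'[unfolded E'] using ed that by (auto simp: E')
    then show ?thesis
      unfolding m_edge_def by (simp only:) (rule card_image, rule inj_on_subset[OF injE], blast)
  qed
  have w: "edge_weight E' (f ` e) = edge_weight E e" if "e \<in> E" for e
  proof -
    from simple that obtain p q where pq: "e = {p, q}" "p \<noteq> q" "p \<in> V" "q \<in> V" by (rule simple_graphE)
    then have "f p \<noteq> f q" using inj by (auto dest: inj_onD)
    then show ?thesis using pq m by (simp add: edge_weight_doubleton)
  qed
  have "edge_szeged E' = sum (edge_weight E') ((`) f ` E)" using edge_szeged_sum[OF C.simple] E' by simp
  also have "\<dots> = (\<Sum>e\<in>E. edge_weight E e)"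
    unfolding sum.reindex[OF injE] by (rule sum.cong) (simp_all add: w)
  finally show ?thesis using edge_szeged_sum[OF simple] by simp
qed

text \<open>\<open>graph_iso\<close> compares only pairs of vertices; as all edges are such pairs, f
  maps E onto E'.\<close>

lemma edge_szeged_iso:
  assumes c: "cgraph V E" "cgraph V' E'" and iso: "graph_iso V E V' E'"
  shows "edge_szeged E = edge_szeged E'"
proof -
  interpret cgraph V E by fact
  interpret C: cgraph V' E' by fact
  obtain f where f: "bij_betw f V V'" "\<And>u v. u \<in> V \<Longrightarrow> v \<in> V \<Longrightarrow> {u, v} \<in> E \<longleftrightarrow> {f u, f v} \<in> E'"
    using iso unfolding graph_iso_def by blast
  have im: "f ` V = V'" using f(1) by (simp add: bij_betw_def)
  have "E' = (`) f ` E"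
  proof (intro set_eqI iffI)
    fix e assume e: "e \<in> E'"
    from C.simple e obtain p q where pq: "e = {p, q}" "p \<noteq> q" "p \<in> V'" "q \<in> V'" by (rule simple_graphE)
    then obtain p' q' where "p = f p'" "q = f q'" "p' \<in> V" "q' \<in> V" using im by auto
    then show "e \<in> (`) f ` E" using e pq f(2)[of p' q'] by (intro image_eqI[of _ _ "{p', q'}"]) auto
  next
    fix e assume "e \<in> (`) f ` E"
    then obtain e' where e': "e = f ` e'" "e' \<in> E" by auto
    from simple e'(2) obtain p q where "e' = {p, q}" "p \<noteq> q" "p \<in> V" "q \<in> V" by (rule simple_graphE)
    then show "e \<in> E'" using e' f(2)[of p q] by simp
  qed
  from edge_szeged_image[OF c f(1) this] show ?thesis by simp
qed

text \<open>An injective image of E inside E' with equally many edges is all of E', so preserving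
  edges in one direction suffices.\<close>

lemma graph_iso_of_embedding:
  assumes s: "simple_graph V E" "simple_graph V' E'" and f: "bij_betw f V V'"
    and emb: "\<And>e. e \<in> E \<Longrightarrow> f ` e \<in> E'" and card: "card E = card E'"
  shows "graph_iso V' E' V E"
proof -
  have inj: "inj_on f V" and im: "f ` V = V'" using f by (auto simp: bij_betw_def)
  have "card ((`) f ` E) = card E'" using card_image[OF inj_on_image_edges[OF s(1) inj]] card by simp
  then have E': "(`) f ` E = E'"
    using emb simple_graph_finite_edges[OF s(2)] by (intro card_subset_eq) auto
  have "{u, v} \<in> E' \<longleftrightarrow> {inv_into V f u, inv_into V f v} \<in> E" if "u \<in> V'" "v \<in> V'" for u v
    using image_edges_iff[OF s(1) inj, of "inv_into V f u" "inv_into V f v"] that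
    unfolding E' im[symmetric] by (simp add: f_inv_into_f inv_into_into)
  then show ?thesis unfolding graph_iso_def using bij_betw_inv_into[OF f] by blast
qed

context extremal_path
begin

text \<open>The classes at the ends of the shared edge have to accommodate the two parts into which
  it divides the path.\<close>

lemma class_ge:
  assumes k3: "k = 3" and j: "j \<in> J"
  shows "Suc j \<le> card {z \<in> V. \<rho> z = \<rho> (x j)}" "d - j \<le> card {z \<in> V. \<rho> z = \<rho> (x (Suc j))}"
proof -
  have half: "half = 1" using k3 by simp
  have W: "W m = A m" for m unfolding W_def half by simp
  have A: "A m = card {z \<in> V. \<rho> z = \<rho> (c (m mod k))}" for m
    using \<rho>_c[of "m mod k"] k by (simp add: A_def)
  have off: "idx j + k - half + 1 = idx j + k" using k half by simp
  have i: "idx j mod k = idx j" using idx(1)[OF j] by simp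
  have "d - j = d - 1 - j + 1" using J_less[OF j] by simp
  then show "Suc j \<le> card {z \<in> V. \<rho> z = \<rho> (x j)}" "d - j \<le> card {z \<in> V. \<rho> z = \<rho> (x (Suc j))}"
    using path_side[OF j, unfolded off] unfolding W A_period A[of "idx j"] A[of "Suc (idx j)"] i half by auto
qed

lemma minimal_pathI:
  assumes eq: "int (edge_szeged E) = min_szeged n d" and j: "j \<in> J"
    and cls: "card {z \<in> V. \<rho> z = \<rho> (x j)} = Suc b"
  shows "\<exists>w. minimal_path k c \<rho> h V E x d w b"
proof -
  from szeged_eq[OF eq] obtain j' where k3: "k = 3" and j': "J = {j'}" "\<mu> j' = b" "A (idx j' + 2) = 1"
    and wt: "\<forall>i<d. i \<notin> J \<longrightarrow> int (edge_weight E (path_edge i)) = F (\<mu> i)" "\<forall>e\<in>off_edges. edge_weight E e = 0"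
    by blast
  have jj: "j' = j" using j j' by simp
  \<comment> \<open>For even d two middle edges satisfy \<open>\<mu> j\<close> = b; the size of the
    class at \<open>x j\<close> selects the lower one.\<close>
  have "j \<le> b" using class_ge(1)[OF k3 j] cls by simp
  moreover have "b \<le> j" using j'(2) min.cobounded1[of j "d - 1 - j"] by (simp only: jj \<mu>_def)
  ultimately have jb: "j = b" by simp
  obtain w where w: "w \<in> V" "EC = {path_edge j, {x j, w}, {x (Suc j), w}}" "card {z \<in> V. \<rho> z = \<rho> w} = 1"
    "{A (idx j), A (Suc (idx j))} =
      {card {z \<in> V. \<rho> z = \<rho> (x j)}, card {z \<in> V. \<rho> z = \<rho> (x (Suc j))}}"
    by (rule triangle_apex[OF k3 j j'(3)[unfolded jj]])
  have "minimal_path k c \<rho> h V E x d w b"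
  proof unfold_locales
    show "J = {b}" "EC = {path_edge b, {x b, w}, {x (Suc b), w}}" "card {z \<in> V. \<rho> z = \<rho> (x b)} = Suc b"
      using j'(1) w(2) cls unfolding jj jb by simp_all
    show "int (edge_weight E (path_edge i)) = F (\<mu> i)" if "i < d" "i \<noteq> b" for i
    proof -
      have "i \<notin> J" using that(2) unfolding j'(1) jj jb by simp
      then show ?thesis using wt(1) that(1) by simp
    qed
  qed (use w wt(2) in simp_all)
  then show ?thesis by blast
qed

lemma reverse_extremal: "extremal_path k c \<rho> h V E (\<lambda>i. x (d - i)) d"
proof unfold_locales
  fix i assume "i < d"
  then have "{x (d - i), x (d - Suc i)} = path_edge (d - Suc i)" by (simp add: Suc_diff_Suc insert_commute)
  then show "{x (d - i), x (d - Suc i)} \<in> E" using xE[of "d - Suc i"] \<open>i < d\<close> by simp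
next
  fix i j assume "i \<le> j" "j \<le> d"
  then show "gdist E (x (d - i)) (x (d - j)) = j - i" using x_dist[of "d - j" "d - i"] gdist_sym[of E] by simp
qed (use xV d3 nd n6 in auto)

text \<open>If the class with b + 1 vertices belongs to the later end of the shared edge, the path
  is read backwards.\<close>

lemma minimal_path_exists:
  assumes eq: "int (edge_szeged E) = min_szeged n d"
  shows "\<exists>y w. minimal_path k c \<rho> h V E y d w b"
proof -
  from szeged_eq[OF eq] obtain j where k3: "k = 3" and j: "J = {j}" "\<mu> j = b" "A (idx j + 2) = 1"
    and A: "A (idx j) = b + 1 \<or> A (Suc (idx j)) = b + 1" by blast
  have jJ: "j \<in> J" using j by simp
  have "{A (idx j), A (Suc (idx j))} =
      {card {z \<in> V. \<rho> z = \<rho> (x j)}, card {z \<in> V. \<rho> z = \<rho> (x (Suc j))}}"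
    by (rule triangle_apex[OF k3 jJ j(3)])
  then consider "card {z \<in> V. \<rho> z = \<rho> (x j)} = Suc b" | "card {z \<in> V. \<rho> z = \<rho> (x (Suc j))} = Suc b"
    using A by (auto simp: doubleton_eq_iff)
  then show ?thesis
  proof cases
    case 1
    then show ?thesis using minimal_pathI[OF eq jJ] by blast
  next
    case 2
    interpret R: extremal_path k c \<rho> h V E "\<lambda>i. x (d - i)" d by (rule reverse_extremal)
    have jd: "j < d" using J_less[OF jJ] .
    have "{x (d - (d - Suc j)), x (d - Suc (d - Suc j))} = path_edge j"
      using jd by (simp add: Suc_diff_Suc insert_commute)
    then have "d - Suc j \<in> R.J" using jJ jd by (simp add: R.J_def J_def)
    moreover have "d - (d - Suc j) = Suc j" using jd by simp
    ultimately show ?thesis using R.minimal_pathI[OF eq, of "d - Suc j"] 2 by auto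
  qed
qed

end

lemma (in C3_graph) szeged_unicyclic:
  fixes V :: "'b set"
  assumes uni: "unicyclic V E" and card: "card V = n" and diam: "diameter V E = d" and n6: "6 \<le> n"
  shows "edge_szeged (C3_E n d) \<le> edge_szeged E"
    and "edge_szeged E = edge_szeged (C3_E n d) \<longleftrightarrow> graph_iso V E (C3_V n) (C3_E n d)"
proof -
  from unicyclic_leaf_grown[OF uni] obtain k c \<rho>' h' where
    rc: "rooted_cycle k c \<rho>' h'" and gr: "leaf_grown k c \<rho>' h' V E" .
  interpret H: cgraph V E using rooted_cycle.grown_cgraph[OF rc gr] .
  have "V \<noteq> {}" using H.conn by (simp add: connected_graph_def)
  moreover have "{gdist E u v | u v. u \<in> V \<and> v \<in> V} = (\<lambda>(u, v). gdist E u v) ` (V \<times> V)" by auto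
  ultimately have "d \<in> (\<lambda>(u, v). gdist E u v) ` (V \<times> V)"
    using diam H.finV Max_in[of "(\<lambda>(u, v). gdist E u v) ` (V \<times> V)"] unfolding diameter_def by auto
  then obtain u v where "u \<in> V" "v \<in> V" "gdist E u v = d" by auto
  from H.geodesic[OF this] obtain x where x: "\<And>i. i < d \<Longrightarrow> {x i, x (Suc i)} \<in> E"
    "\<And>i. i \<le> d \<Longrightarrow> x i \<in> V" "\<And>i j. i \<le> j \<Longrightarrow> j \<le> d \<Longrightarrow> gdist E (x i) (x j) = j - i" by metis
  interpret M: extremal_path k c \<rho>' h' V E x d
  proof (intro_locales)
    show "rooted_cycle k c \<rho>' h'" by (rule rc)
    show "grown_graph_axioms k c \<rho>' h' V E" using gr by (simp add: grown_graph_axioms_def)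
    show "geodesic_path_axioms V E x d" using x by (simp add: geodesic_path_axioms_def)
    show "extremal_path_axioms V d" using nd dab n6 card by (simp add: extremal_path_axioms_def)
  qed
  have le: "min_szeged n d \<le> int (edge_szeged E)" using M.szeged_ge card by simp
  then show "edge_szeged (C3_E n d) \<le> edge_szeged E" using szeged_C3 by simp
  have C: "cgraph (C3_V n) (C3_E n d)"
    using unicyclic_C3 by (auto simp: unicyclic_def cgraph_def)
  show "edge_szeged E = edge_szeged (C3_E n d) \<longleftrightarrow> graph_iso V E (C3_V n) (C3_E n d)"
  proof
    assume "graph_iso V E (C3_V n) (C3_E n d)"
    then show "edge_szeged E = edge_szeged (C3_E n d)" by (rule edge_szeged_iso[OF H.cgraph_axioms C])
  next
    assume "edge_szeged E = edge_szeged (C3_E n d)"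
    then have "int (edge_szeged E) = min_szeged (card V) d" using szeged_C3 card by simp
    from M.minimal_path_exists[OF this] obtain y w where "minimal_path k c \<rho>' h' V E y d w M.b" by blast
    then obtain f where f: "bij_betw f {0..<card V} V" "\<And>e. e \<in> C3_E (card V) d \<Longrightarrow> f ` e \<in> E"
      by (rule minimal_path.embedding) blast
    have "card (C3_E n d) = card E" using unicyclic_C3 uni card by (simp add: unicyclic_def C3_V_def)
    then show "graph_iso V E (C3_V n) (C3_E n d)"
      using graph_iso_of_embedding[of "C3_V n" "C3_E n d" V E f] f C H.simple card
      by (simp add: C3_V_def cgraph_def)
  qed
qed

theorem theorem1p1:
  fixes n d :: nat
  assumes "6 \<le> n" and "3 \<le> d" and "d \<le> n - 2"
  shows "unicyclic (C3_V n) (C3_E n d) \<and> card (C3_V n) = n \<and> diameter (C3_V n) (C3_E n d) = d \<and>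
    (\<forall>(V :: 'a set) E. unicyclic V E \<and> card V = n \<and> diameter V E = d \<longrightarrow>
       edge_szeged (C3_E n d) \<le> edge_szeged E \<and>
       (edge_szeged E = edge_szeged (C3_E n d) \<longleftrightarrow> graph_iso V E (C3_V n) (C3_E n d)))"
proof -
  interpret C3_graph n d "d div 2" "(d - 1) div 2"
    by unfold_locales (use assms C3_ab[of d] in auto)
  show ?thesis
    using unicyclic_C3 diameter_C3 szeged_unicyclic assms(1) by (auto simp: C3_V_def)
qed

end
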